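(* Let $\alpha\in(0,1)$, let $\rho\colon[1,\infty)\to(0,\infty)$ be regularly varying with index $-\alpha$, let $c\in(0,1]$, $c_\#>0$ and let $N_\#\ge1$ be an integer. Then there is a constant $C$, depending only on $c_\#,N_\#,c,\rho$, such that the following holds. Let $(p_n)_{n\ge1}$ be any sequence of non-negative reals with $\sum_{n\ge1}p_n=1$ and $\gcd\{1\le k\le N_\#:p_k\ge c_\#\}=1$, and suppose that $z_n=\sum_{k>n}p_k$ satisfies $$c\,\rho(n)\le z_n\le\rho(n)\qquad\text{for all } n\ge1.$$ Let $P$ be the transition operator of the Markov chain on $\{0,1,2,\ldots\}$ associated with $(p_n)$. (1) If $\alpha\in(\tfrac12,1)$, then for all integers $n\ge\ell\ge1$ $$\|P^{n+\ell}\delta_0-P^n\delta_0\|_{\mathrm{TV}}\le C\,\frac{n\,\rho(n)^2}{\ell\,\rho(\ell)^2}.$$ (2) If $\alpha\in(0,1)$ and, in addition, $$\sum_{k>n}|p_k-p_{k+1}|\le c^{-1}n^{-1}\rho(n)\qquad\text{for all } n\ge1,$$ then for all integers $n\ge\ell\ge1$ $$\|P^{n+\ell}\delta_0-P^n\delta_0\|_{\mathrm{TV}}\le C\,\frac{\rho(n)}{\rho(\ell)}.$$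
   Context: Model chain: given $p_n\ge0$ with $\sum_{n\ge1}p_n=1$, put $z_n=\sum_{k>n}p_k$ for $n\ge0$ and $q_n=p_{n+1}/z_n$ if $z_n>0$ (with $q_n\in[0,1]$ arbitrary if $z_n=0$). The associated Markov chain $X$ on $\{0,1,2,\ldots\}$ has transition probabilities $\mathbb P(X_1=0\mid X_0=n)=q_n$ and $\mathbb P(X_1=n+1\mid X_0=n)=1-q_n$. Thus $p_n$ is the probability that the first return time to $0$, starting from $0$, equals $n$. Its transition operator $P$ acts on probability measures: if $X_n\sim\mu$ then $X_{n+1}\sim P\mu$. $\delta_0$ is the unit mass at state $0$. $\|\cdot\|_{\mathrm{TV}}$ is the total variation norm, normalized so that $\|\mu-\nu\|_{\mathrm{TV}}=2\sup_A|\mu(A)-\nu(A)|$ for probability measures $\mu,\nu$. A (measurable) function $\rho\colon[a,\infty)\to(0,\infty)$ is regularly varying with index $\beta\in\mathbb R$ if $\lim_{x\to\infty}\rho(\lambda x)/\rho(x)=\lambda^\beta$ for every $\lambda>0$. *)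

theory Defs
  imports "HOL-Probability.Probability"
begin

text \<open>A function on \<open>[a,\<infinity>)\<close> is a total function on the reals whose values below \<open>a\<close> are
  irrelevant. Measurability is Lebesgue measurability, which covers Borel functions as well.\<close>

definition regularly_varying :: "real \<Rightarrow> real \<Rightarrow> (real \<Rightarrow> real) \<Rightarrow> bool" where
  "regularly_varying a \<beta> \<rho> \<longleftrightarrow>
     (\<forall>x\<ge>a. \<rho> x > 0) \<and>
     \<rho> \<in> borel_measurable (lebesgue_on {a..}) \<and>
     (\<forall>t>0. ((\<lambda>x. \<rho> (t * x) / \<rho> x) \<longlongrightarrow> t powr \<beta>) at_top)"

text \<open>A sequence \<open>(p\<^sub>n)\<close>, \<open>n \<ge> 1\<close>, is a function on \<open>nat\<close> whose value at \<open>0\<close> is irrelevant.\<close>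

definition prob_seq :: "(nat \<Rightarrow> real) \<Rightarrow> bool" where
  "prob_seq p \<longleftrightarrow> (\<forall>n\<ge>1. p n \<ge> 0) \<and> (p has_sum 1) {1..}"

definition tail :: "(nat \<Rightarrow> real) \<Rightarrow> nat \<Rightarrow> real" where
  "tail p n = (\<Sum>\<^sub>\<infinity>k\<in>{n<..}. p k)"

definition return_probs :: "(nat \<Rightarrow> real) \<Rightarrow> (nat \<Rightarrow> real) \<Rightarrow> bool" where
  "return_probs p q \<longleftrightarrow>
     (\<forall>n. if tail p n > 0 then q n = p (n + 1) / tail p n else 0 \<le> q n \<and> q n \<le> 1)"

text \<open>\<open>bernoulli_pmf\<close> clamps its parameter to \<open>[0,1]\<close>; this has no effect when
  \<open>return_probs p q\<close> holds for a probability sequence \<open>p\<close>.\<close>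

definition chain_kernel :: "(nat \<Rightarrow> real) \<Rightarrow> nat \<Rightarrow> nat pmf" where
  "chain_kernel q n = map_pmf (\<lambda>b. if b then 0 else n + 1) (bernoulli_pmf (q n))"

definition transition_op :: "(nat \<Rightarrow> real) \<Rightarrow> nat pmf \<Rightarrow> nat pmf" where
  "transition_op q \<mu> = bind_pmf \<mu> (chain_kernel q)"

definition tv_dist :: "'a pmf \<Rightarrow> 'a pmf \<Rightarrow> real" where
  "tv_dist \<mu> \<nu> = 2 * (SUP A. \<bar>measure_pmf.prob \<mu> A - measure_pmf.prob \<nu> A\<bar>)"

end

theory Submission imports Defs
begin

text \<open>
  Let \<open>u\<close> be the renewal sequence of \<open>p\<close>. The chain satisfies \<open>P^n \<delta>_0 (k) = u_(n-k) z_k\<close>, so the total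
  variation distance is at most twice an \<open>l1\<close> norm that is controlled by \<open>u\<close> and its \<open>l\<close>-step
  increments. These are Fourier coefficients: with \<open>s = r e^(it)\<close> one has
  \<open>\<Sum> n u_n s^n = (\<Sum> n p_n s^n) (\<Sum> u_n s^n)^2\<close>, the last factor being \<open>1 / (1 - \<Sum> p_n s^n)^2\<close>.
  Taking \<open>r = m / (m + 1)\<close> makes all series converge while \<open>r^j\<close> stays bounded below for \<open>j \<le> 2m\<close>, so
  that information about indices of order \<open>m\<close> is not lost.

  If \<open>\<alpha> > 1/2\<close>, the trivial bound \<open>\<bar>\<Sum> n p_n s^n\<bar> \<le> C m z_m\<close> gives
  \<open>\<bar>u_(n+l) - u_n\<bar> \<le> C z_n / (l z_l^2)\<close>, which suffices. Under the bounded variation hypothesis, Abel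
  summation improves that bound to \<open>C z_(1/t) / t\<close>; this gives
  \<open>\<bar>u_(n+l) - u_n\<bar> \<le> C / (n z_l)\<close>, which is enough for \<open>n\<close> of the order of the final time but loses a
  logarithm when summed. Over dyadic blocks the \<open>l1\<close> norm is therefore bounded by Bessel's inequality
  and Cauchy-Schwarz, which gains a geometric factor.

  Regular variation enters only through the Potter bounds for \<open>z\<close> with exponents
  \<open>\<beta> < \<alpha> < \<gamma> < 1\<close>, whose constants do not depend on \<open>p\<close>.
\<close>

subsection \<open>Fourier coefficients and power weights\<close>

text \<open>The factor n in front of \<open>u_n\<close> is what makes absolute values affordable:
  the series of \<open>u\<close> has size about \<open>t powr (- \<alpha>)\<close> and the decay of
  its coefficients comes only from cancellation, whereas the series of \<open>n u_n\<close> can be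
  estimated through the integral of its modulus. That integral over \<open>t >= 1/m\<close> has to
  be governed by \<open>t\<close> near \<open>1/m\<close>, so the majorant must decay faster than
  \<open>1/t\<close>. The trivial bound on the numerator leaves \<open>t powr (- 2 \<beta>)\<close>,
  which is the origin of the threshold 1/2; with bounded variation the exponent is
  \<open>1 + \<beta>\<close> and the threshold disappears. An \<open>l\<close>-step increment brings
  the factor \<open>|1 - e^(ilt)| <= min (l t) 2\<close>. It tames the singularity at 0, where the
  exponents become \<open>2 \<gamma> - 1\<close> and \<open>\<gamma>\<close>, both below 1; hence
  the cuts at \<open>1/l\<close>. In the dyadic step the L1 integral is governed by \<open>t\<close>
  near \<open>1/l\<close>, whatever \<open>m\<close> is, but the squared integrand by
  \<open>t\<close> near \<open>1/m\<close>, as \<open>2 \<gamma> > 1\<close>. This turns the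
  logarithm into a gain \<open>(m/l) powr (\<gamma> - 1)\<close> per block.\<close>

definition fser :: "(nat \<Rightarrow> real) \<Rightarrow> real \<Rightarrow> complex" where
  "fser a t = (\<Sum>j. of_real (a j) * cis (real j * t))"

lemma cis_has_integral:
  "((\<lambda>t. cis (of_int k * t)) has_integral (if k = 0 then 2 * pi else 0)) {-pi..pi}"
proof (cases "k = 0")
  case True
  then show ?thesis
    using has_integral_const_real[of "1::complex" "-pi" pi] by (simp add: scaleR_conv_of_real)
next
  case False
  define A where "A = (\<lambda>t. cis (of_int k * t) / (\<i> * of_int k))"
  have "((\<lambda>t. cis (of_int k * t)) has_integral (A pi - A (- pi))) {-pi..pi}"
    using False unfolding A_def
    by (intro fundamental_theorem_of_calculus)
      (auto simp: has_vector_derivative_def scaleR_conv_of_real fun_eq_iff complex_eq_iff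
        intro!: derivative_eq_intros)
  moreover have "sin (of_int k * pi) = 0"
    using sin_zero_iff_int2 by blast
  then have "cis (of_int k * pi) = cis (- (of_int k * pi))"
    by (simp add: complex_eq_iff)
  then have "A pi = A (- pi)"
    by (simp add: A_def)
  ultimately show ?thesis
    using False by simp
qed

context
  fixes a :: "nat \<Rightarrow> real"
  assumes a: "summable (\<lambda>j. \<bar>a j\<bar>)"
begin

lemma fser_uniform_limit:
  "uniform_limit UNIV (\<lambda>M t. \<Sum>j<M. of_real (a j) * cis (real j * t)) (fser a) sequentially"
  unfolding fser_def by (rule Weierstrass_m_test[OF _ a]) (simp add: norm_mult)

lemma summable_fser: "summable (\<lambda>j. of_real (a j) * cis (real j * t))"
  using a by (auto intro: summable_norm_cancel simp: norm_mult)

lemma continuous_fser [continuous_intros]: "continuous_on A (fser a)"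
proof -
  have "continuous_on UNIV (fser a)"
    by (rule uniform_limit_theorem[OF _ fser_uniform_limit])
      (auto intro!: always_eventually continuous_intros)
  then show ?thesis
    using continuous_on_subset by blast
qed

lemma norm_fser_minus: "norm (fser a (- t)) = norm (fser a t)"
proof -
  have "cnj (fser a t) = (\<Sum>j. cnj (of_real (a j) * cis (real j * t)))"
    using summable_fser summable_sums sums_cnj sums_unique unfolding fser_def by blast
  also have "\<dots> = fser a (- t)"
    by (simp add: fser_def cis_cnj)
  finally show ?thesis
    by (metis complex_mod_cnj)
qed

text \<open>Orthogonality of the characters, with the integral taken termwise thanks to uniform
  convergence; once \<open>M\<close> exceeds \<open>i\<close> the integrals of the partial sums no
  longer change.\<close>

lemma fser_coeff:
  "((\<lambda>t. fser a t * cis (- real i * t)) has_integral 2 * pi * a i) {-pi..pi}"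
proof -
  define f where "f = (\<lambda>M t. (\<Sum>j<M. of_real (a j) * cis (real j * t)) * cis (- real i * t))"
  have ul: "uniform_limit {-pi..pi} f (\<lambda>t. fser a t * cis (- real i * t)) sequentially"
  proof (rule uniform_limitI)
    fix e :: real assume "e > 0"
    from uniform_limitD[OF fser_uniform_limit this]
    show "\<forall>\<^sub>F M in sequentially. \<forall>t\<in>{-pi..pi}. dist (f M t) (fser a t * cis (- real i * t)) < e"
      by eventually_elim
        (auto simp: f_def dist_norm norm_mult simp flip: left_diff_distrib)
  qed
  obtain I J where I: "\<And>M. (f M has_integral I M) {-pi..pi}"
    and J: "((\<lambda>t. fser a t * cis (- real i * t)) has_integral J) {-pi..pi}"
    and lim: "I \<longlonglongrightarrow> J"
    by (rule uniform_limit_integral[OF ul]) (auto simp: f_def intro!: continuous_intros)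
  have "(f M has_integral (if i < M then 2 * pi * a i else 0)) {-pi..pi}" for M
  proof -
    have "((\<lambda>t. \<Sum>j<M. of_real (a j) * cis (of_int (int j - int i) * t)) has_integral
        (\<Sum>j<M. complex_of_real (a j) * complex_of_real (if int j - int i = 0 then 2 * pi else 0))) {-pi..pi}"
      by (intro has_integral_sum has_integral_mult_right cis_has_integral) auto
    moreover have "(\<lambda>t. \<Sum>j<M. of_real (a j) * cis (of_int (int j - int i) * t)) = f M"
      unfolding f_def sum_distrib_right mult.assoc cis_mult by (simp add: algebra_simps)
    moreover have "(\<Sum>j<M. complex_of_real (a j) * complex_of_real (if int j - int i = 0 then 2 * pi else 0)) =
        (\<Sum>j<M. if j = i then complex_of_real (2 * pi * a i) else 0)"
      by (intro sum.cong) auto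
    ultimately show ?thesis
      by (simp split: if_splits)
  qed
  with I have "I M = (if i < M then 2 * pi * a i else 0)" for M
    using has_integral_unique by blast
  then have "I \<longlonglongrightarrow> 2 * pi * a i"
    by (intro tendsto_eventually eventually_mono[OF eventually_gt_at_top[of i]]) auto
  with lim J show ?thesis
    using LIMSEQ_unique by blast
qed

text \<open>Real coefficients make the modulus even. All later estimates can therefore be stated for
  positive \<open>t\<close> only.\<close>

lemma integral_even_fser:
  fixes g :: "real \<Rightarrow> real"
  assumes "continuous_on UNIV g"
  shows "integral {-pi..pi} (\<lambda>t. g (norm (fser a t))) = 2 * integral {0..pi} (\<lambda>t. g (norm (fser a t)))"
proof -
  define \<phi> where "\<phi> = (\<lambda>t. g (norm (fser a t)))"
  have cont: "continuous_on A \<phi>" for A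
    unfolding \<phi>_def
    by (intro continuous_on_compose2[OF assms] continuous_intros) auto
  have "integral {-pi..pi} \<phi> = integral {-pi..0} \<phi> + integral {0..pi} \<phi>"
    by (intro Henstock_Kurzweil_Integration.integral_combine[symmetric]
        integrable_continuous_interval cont) auto
  also have "integral {-pi..0} \<phi> = integral {0..pi} (\<lambda>t. \<phi> (- t))"
    using Henstock_Kurzweil_Integration.integral_reflect_real[of pi 0 "\<lambda>t. \<phi> (- t)"]
    by (simp only: minus_minus minus_zero)
  also have "(\<lambda>t. \<phi> (- t)) = \<phi>"
    by (simp add: \<phi>_def norm_fser_minus)
  finally show ?thesis
    by (simp add: \<phi>_def)
qed

lemma coeff_le_integral: "pi * \<bar>a i\<bar> \<le> integral {0..pi} (\<lambda>t. norm (fser a t))"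
proof -
  have "2 * pi * \<bar>a i\<bar> = norm (integral {-pi..pi} (\<lambda>t. fser a t * cis (- real i * t)))"
    using integral_unique[OF fser_coeff[of i]] by (simp add: norm_mult)
  also have "\<dots> \<le> integral {-pi..pi} (\<lambda>t. norm (fser a t))"
    by (intro integral_norm_bound_integral integrable_continuous_interval continuous_intros)
      (auto simp: norm_mult)
  also have "\<dots> = 2 * integral {0..pi} (\<lambda>t. norm (fser a t))"
    using integral_even_fser[of "\<lambda>x. x"] by simp
  finally show ?thesis by simp
qed

end

text \<open>Expand the nonnegative integral of \<open>(norm (G - T))^2\<close>, where
  \<open>T\<close> is the part of the series with indices in \<open>J\<close>.\<close>

lemma Bessel:
  assumes a: "summable (\<lambda>j. \<bar>a j\<bar>)" and "finite J"
  shows "pi * (\<Sum>j\<in>J. (a j)\<^sup>2) \<le> integral {0..pi} (\<lambda>t. (norm (fser a t))\<^sup>2)"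
proof -
  define T where "T = (\<lambda>t. \<Sum>j\<in>J. of_real (a j) * cis (real j * t))"
  define G where "G = fser a"
  define s where "s = (\<Sum>j\<in>J. (a j)\<^sup>2)"
  have contG: "continuous_on A G" for A unfolding G_def by (intro continuous_fser a)
  have contT: "continuous_on A T" for A unfolding T_def by (intro continuous_intros)
  have cnjT: "cnj (T t) = (\<Sum>j\<in>J. of_real (a j) * cis (- real j * t))" for t
    by (simp add: T_def cis_cnj)
  have 1: "((\<lambda>t. fser b t * cnj (T t)) has_integral 2 * pi * s) {-pi..pi}"
    if b: "summable (\<lambda>j. \<bar>b j\<bar>)" "\<And>j. j \<in> J \<Longrightarrow> b j = a j" for b
  proof -
    have "((\<lambda>t. \<Sum>j\<in>J. of_real (a j) * (fser b t * cis (- real j * t))) has_integral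
      (\<Sum>j\<in>J. complex_of_real (a j) * complex_of_real (2 * pi * b j))) {-pi..pi}"
      by (intro has_integral_sum has_integral_mult_right fser_coeff b \<open>finite J\<close>)
    moreover have "(\<Sum>j\<in>J. complex_of_real (a j) * complex_of_real (2 * pi * b j)) = complex_of_real (2 * pi * s)"
      by (simp add: s_def sum_distrib_left power2_eq_square b mult_ac)
    moreover have "(\<lambda>t. \<Sum>j\<in>J. of_real (a j) * (fser b t * cis (- real j * t)))
        = (\<lambda>t. fser b t * cnj (T t))"
      unfolding cnjT by (simp add: sum_distrib_left mult_ac)
    ultimately show ?thesis by simp
  qed
  \<comment> \<open>\<open>T\<close> is itself an \<open>fser\<close>, with truncated coefficients.
    Fact \<open>1\<close> for \<open>b\<close> yields the square norm of \<open>T\<close>, for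
    \<open>a\<close> the cross term; both equal \<open>2 * pi * s\<close>.\<close>
  define b where "b = (\<lambda>j. if j \<in> J then a j else 0)"
  have "T = fser b"
    unfolding T_def fser_def b_def
    by (rule ext, subst suminf_finite[OF \<open>finite J\<close>]) auto
  moreover have "summable (\<lambda>j. \<bar>b j\<bar>)"
    unfolding b_def by (intro summable_finite[OF \<open>finite J\<close>]) auto
  ultimately have TT: "((\<lambda>t. T t * cnj (T t)) has_integral 2 * pi * s) {-pi..pi}"
    using 1[of b] by (simp add: b_def)
  have GT: "((\<lambda>t. G t * cnj (T t)) has_integral 2 * pi * s) {-pi..pi}"
    using 1[of a] a by (simp add: G_def)
  have TT': "((\<lambda>t. (norm (T t))\<^sup>2) has_integral 2 * pi * s) {-pi..pi}"
    using has_integral_linear[OF TT bounded_linear_Re]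
    by (simp add: o_def complex_norm_square[symmetric])
  have GT': "((\<lambda>t. Re (G t * cnj (T t))) has_integral 2 * pi * s) {-pi..pi}"
    using has_integral_linear[OF GT bounded_linear_Re] by (simp add: o_def)
  have GG: "((\<lambda>t. (norm (G t))\<^sup>2) has_integral integral {-pi..pi} (\<lambda>t. (norm (G t))\<^sup>2)) {-pi..pi}"
    by (intro integrable_integral integrable_continuous_interval continuous_intros contG)
  have "((\<lambda>t. (norm (G t))\<^sup>2 - 2 * Re (G t * cnj (T t)) + (norm (T t))\<^sup>2) has_integral
      integral {-pi..pi} (\<lambda>t. (norm (G t))\<^sup>2) - 2 * (2 * pi * s) + 2 * pi * s) {-pi..pi}"
    by (intro has_integral_add has_integral_diff has_integral_mult_right GG GT' TT')
  moreover have "(norm z)\<^sup>2 - 2 * Re (z * cnj w) + (norm w)\<^sup>2 = (norm (z - w))\<^sup>2" for z w :: complex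
    unfolding cmod_power2 by (simp add: power2_diff)
  ultimately have "((\<lambda>t. (norm (G t - T t))\<^sup>2) has_integral
      integral {-pi..pi} (\<lambda>t. (norm (G t))\<^sup>2) - 2 * (2 * pi * s) + 2 * pi * s) {-pi..pi}"
    by simp
  then have "0 \<le> integral {-pi..pi} (\<lambda>t. (norm (G t))\<^sup>2) - 2 * (2 * pi * s) + 2 * pi * s"
    by (rule has_integral_nonneg) simp
  also have "integral {-pi..pi} (\<lambda>t. (norm (G t))\<^sup>2) = 2 * integral {0..pi} (\<lambda>t. (norm (G t))\<^sup>2)"
    unfolding G_def by (intro integral_even_fser a continuous_intros)
  finally show ?thesis by (simp add: G_def s_def)
qed

section \<open>Integrals of functions dominated by a power, away from 0 and at 0\<close>

lemma integral_le_powr_tail: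
  fixes \<phi> :: "real \<Rightarrow> real"
  assumes "0 < a" "a \<le> b" "\<sigma> > 1" "continuous_on {a..b} \<phi>" "M \<ge> 0"
    and le: "\<And>t. a \<le> t \<Longrightarrow> t \<le> b \<Longrightarrow> \<phi> t \<le> M * (t / a) powr (- \<sigma>)"
  shows "integral {a..b} \<phi> \<le> M * a / (\<sigma> - 1)"
proof -
  define A where "A = (\<lambda>t. - M * a / (\<sigma> - 1) * (t / a) powr (1 - \<sigma>))"
  have "((\<lambda>t. M * (t / a) powr (- \<sigma>)) has_integral (A b - A a)) {a..b}"
  proof (rule fundamental_theorem_of_calculus)
    fix t assume "t \<in> {a..b}"
    then have "t > 0" using assms by auto
    have "((\<lambda>t. (t / a) powr (1 - \<sigma>)) has_real_derivative
        (1 - \<sigma>) * (t / a) powr (1 - \<sigma> - 1) * (1 / a)) (at t)"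
      using \<open>t > 0\<close> assms
      by (intro DERIV_chain2[where g = "\<lambda>t. t / a", OF has_real_derivative_powr] DERIV_cdivide DERIV_ident) auto
    from DERIV_cmult[OF this, of "- M * a / (\<sigma> - 1)"]
    have "(A has_real_derivative M * (t / a) powr (- \<sigma>)) (at t)"
      unfolding A_def by (rule back_subst[of "\<lambda>d. (_ has_real_derivative d) _"])
        (use assms in \<open>simp add: field_simps\<close>)
    then show "(A has_vector_derivative M * (t / a) powr (- \<sigma>)) (at t within {a..b})"
      by (simp add: has_field_derivative_at_within has_real_derivative_iff_has_vector_derivative[symmetric])
  qed fact
  then have "integral {a..b} \<phi> \<le> A b - A a"
    using assms
    by (intro has_integral_le[OF integrable_integral[OF integrable_continuous_interval]]) auto
  also have "\<dots> \<le> - A a"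
    using assms by (simp add: A_def)
  also have "\<dots> = M * a / (\<sigma> - 1)"
    using assms by (simp add: A_def)
  finally show ?thesis .
qed

lemma integral_le_powr_head:
  fixes \<phi> :: "real \<Rightarrow> real"
  assumes "0 < a" "\<sigma> < 1" "continuous_on {0..a} \<phi>"
    and le: "\<And>t. 0 < t \<Longrightarrow> t \<le> a \<Longrightarrow> \<phi> t \<le> M * (t / a) powr (- \<sigma>)"
  shows "integral {0..a} \<phi> \<le> M * a / (1 - \<sigma>)"
proof -
  have "((\<lambda>t. t powr (- \<sigma>)) has_integral (a powr (1 - \<sigma>) / (1 - \<sigma>))) {0..a}"
    using has_integral_powr_from_0[of "- \<sigma>" a] assms by (simp add: algebra_simps)
  then have "((\<lambda>t. M * a powr \<sigma> * t powr (- \<sigma>)) has_integral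
      (M * a powr \<sigma> * (a powr (1 - \<sigma>) / (1 - \<sigma>)))) {0..a}"
    by (rule has_integral_mult_right)
  also have "M * a powr \<sigma> * (a powr (1 - \<sigma>) / (1 - \<sigma>)) = M * a / (1 - \<sigma>)"
    using assms by (simp flip: powr_add)
  \<comment> \<open>Since \<open>0 powr x\<close> is 0, the power does not dominate at the origin;
    its value there is replaced by \<open>\<phi> 0\<close>, which leaves the integral
    unchanged.\<close>
  finally have "((\<lambda>t. if t = 0 then \<phi> 0 else M * a powr \<sigma> * t powr (- \<sigma>)) has_integral M * a / (1 - \<sigma>)) {0..a}"
    by (rule has_integral_spike_finite[of "{0}", rotated 2]) auto
  then show ?thesis
  proof (rule has_integral_le[OF integrable_integral[OF integrable_continuous_interval[OF assms(3)]]])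
    fix t assume "t \<in> {0..a}"
    then show "\<phi> t \<le> (if t = 0 then \<phi> 0 else M * a powr \<sigma> * t powr (- \<sigma>))"
    proof (cases "t = 0")
      case False
      then have "(t / a) powr (- \<sigma>) = a powr \<sigma> * t powr (- \<sigma>)"
        using \<open>t \<in> {0..a}\<close> \<open>0 < a\<close> by (simp add: powr_divide powr_minus_divide)
      with False le[of t] \<open>t \<in> {0..a}\<close> show ?thesis
        by (simp add: mult.assoc)
    qed simp
  qed
qed

subsection \<open>Power series and renewal sequences\<close>

definition pser :: "(nat \<Rightarrow> real) \<Rightarrow> complex \<Rightarrow> complex" where
  "pser a s = (\<Sum>n. of_real (a n) * s ^ n)"

text \<open>One growth class for \<open>p\<close>, \<open>u\<close> and their multiples by n, so
  that absolute convergence in the open disc is shown once. It is not closed under Cauchy products,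
  which get their own summability lemma.\<close>

definition lingrow :: "(nat \<Rightarrow> real) \<Rightarrow> bool" where
  "lingrow a \<longleftrightarrow> (\<forall>n. \<bar>a n\<bar> \<le> real n + 1)"

lemma summable_lin_geometric:
  fixes x :: real
  assumes "0 \<le> x" "x < 1"
  shows "summable (\<lambda>n. (real n + 1) * x ^ n)"
proof -
  have "summable (\<lambda>n. real (Suc n) * x ^ n)"
    using geometric_deriv_sums[of x] assms by (auto simp: sums_iff)
  then show ?thesis by (simp add: add.commute)
qed

context
  fixes s :: complex
  assumes s: "norm s < 1"
begin

lemma lingrow_summable_norm: "lingrow a \<Longrightarrow> summable (\<lambda>n. norm (of_real (a n) * s ^ n))"
  by (rule summable_comparison_test'[OF summable_lin_geometric[of "norm s"]])
    (use s in \<open>auto simp: lingrow_def norm_mult norm_power intro!: mult_right_mono\<close>)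

lemma lingrow_summable: "lingrow a \<Longrightarrow> summable (\<lambda>n. of_real (a n) * s ^ n)"
  by (rule summable_norm_cancel) (rule lingrow_summable_norm)

lemma Cauchy_terms:
  "(\<Sum>i\<le>k. (of_real (a i) * s ^ i) * (of_real (b (k - i)) * s ^ (k - i))) =
    of_real (\<Sum>i\<le>k. a i * b (k - i)) * s ^ k"
  unfolding of_real_sum sum_distrib_right
proof (rule sum.cong[OF refl])
  fix i assume "i \<in> {..k}"
  then have "s ^ k = s ^ i * s ^ (k - i)"
    by (simp flip: power_add)
  then show "(of_real (a i) * s ^ i) * (of_real (b (k - i)) * s ^ (k - i)) =
      of_real (a i * b (k - i)) * s ^ k"
    by simp
qed

lemma lingrow_summable_mult:
  assumes "lingrow a" "lingrow b"
  shows "summable (\<lambda>n. of_real (\<Sum>i\<le>n. a i * b (n - i)) * s ^ n)"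
  using summable_Cauchy_product[OF assms[THEN lingrow_summable_norm]]
  by (simp add: Cauchy_terms)

lemma pser_mult:
  assumes "lingrow a" "lingrow b"
  shows "pser a s * pser b s = pser (\<lambda>n. \<Sum>i\<le>n. a i * b (n - i)) s"
  using Cauchy_product[OF assms[THEN lingrow_summable_norm]]
  by (simp add: Cauchy_terms pser_def)

lemma norm_pser_le:
  assumes "lingrow a" "\<And>n. a n \<ge> 0"
  shows "norm (pser a s) \<le> (\<Sum>n. a n * norm s ^ n)"
  unfolding pser_def
  by (rule norm_suminf_le) (use lingrow_summable_norm[OF assms(1)] assms in \<open>auto simp: norm_mult norm_power\<close>)

end

text \<open>A power series restricted to a circle of radius \<open>r\<close> is the Fourier series
  of the damped coefficients.\<close>

lemma fser_eq_pser: "fser (\<lambda>j. r ^ j * a j) t = pser a (of_real r * cis t)"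
proof -
  have "(of_real r * cis t) ^ n = of_real (r ^ n) * cis (real n * t)" for n
    by (simp add: power_mult_distrib Complex.DeMoivre)
  then show ?thesis
    by (simp add: fser_def pser_def mult_ac)
qed

text \<open>The probability that the chain started at 0 is at 0 at time n. The recursion conditions
  on the last earlier visit \<open>j\<close> to 0; only values of \<open>p\<close> at positive
  indices enter.\<close>

fun renewal_seq :: "(nat \<Rightarrow> real) \<Rightarrow> nat \<Rightarrow> real" where
  "renewal_seq p 0 = 1"
| "renewal_seq p (Suc n) = (\<Sum>j\<le>n. renewal_seq p j * p (Suc n - j))"

text \<open>The radius is \<open>1 / (1 + 1/m)\<close>, so Bernoulli's inequality for powers of
  \<open>1 + 1/m\<close> yields upper bounds on its powers.\<close>

definition damping :: "nat \<Rightarrow> real" where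
  "damping m = real m / (real m + 1)"

lemma damping_bounds:
  assumes "m \<ge> 1"
  shows "1 / 2 \<le> damping m" "damping m < 1" "0 < damping m"
  using assms by (auto simp: damping_def field_simps)

lemma one_minus_damping_power:
  assumes "m \<ge> 1"
  shows "1 - damping m ^ l \<le> real l / real m"
proof -
  have "1 + real l * (damping m - 1) \<le> damping m ^ l"
    using Bernoulli_inequality[of "damping m - 1" l] damping_bounds[OF assms] by simp
  moreover have "1 - damping m \<le> 1 / real m"
    using assms by (simp add: damping_def field_simps)
  then have "real l * (1 - damping m) \<le> real l / real m"
    using mult_left_mono[of "1 - damping m" "1 / real m" "real l"] by simp
  ultimately show ?thesis by (simp add: algebra_simps)
qed

lemma damping_power_le_half:
  assumes "m \<ge> 1"
  shows "damping m ^ m \<le> 1 / 2"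
proof -
  have "1 + real m * (1 / real m) \<le> (1 + 1 / real m) ^ m"
    by (rule Bernoulli_inequality) (rule order_trans[of _ 0], auto)
  then have "2 \<le> (1 + 1 / real m) ^ m"
    using assms by simp
  moreover have "damping m = 1 / (1 + 1 / real m)"
    using assms by (simp add: damping_def field_simps)
  ultimately show ?thesis
    by (simp add: power_divide field_simps)
qed

text \<open>\<open>(1 + 1/m) ^ k\<close> is at least \<open>k / m\<close>. Damping thus acts like
  truncating the weight \<open>k\<close> at \<open>m\<close>.\<close>

lemma real_mult_damping_power_le:
  assumes "m \<ge> 1"
  shows "real k * damping m ^ k \<le> real m"
proof -
  define x where "x = (1 + 1 / real m) ^ k"
  have "1 + real k * (1 / real m) \<le> x"
    unfolding x_def by (rule Bernoulli_inequality) (rule order_trans[of _ 0], auto)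
  then have "real k / real m \<le> x"
    by simp
  then have "real k \<le> real m * x"
    using assms by (simp add: pos_divide_le_eq mult.commute)
  moreover have "0 < x"
    unfolding x_def by (intro zero_less_power add_pos_nonneg) auto
  moreover have "damping m = 1 / (1 + 1 / real m)"
    using assms by (simp add: damping_def field_simps)
  then have "damping m ^ k = 1 / x"
    unfolding x_def by (simp only: power_one_over)
  ultimately show ?thesis
    by (simp add: pos_divide_le_eq)
qed

text \<open>\<open>(1 + 1/m) ^ m <= e <= 3\<close>; the square of 1/3 covers exponents up to
  \<open>2 * m\<close>. This is the 9 in all later constants.\<close>

lemma damping_power_ge:
  assumes "m \<ge> 1" "j \<le> 2 * m"
  shows "1 / 9 \<le> damping m ^ j"
proof -
  have "(1 + 1 / real m) ^ m \<le> exp (1 / real m) ^ m"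
    using assms by (intro power_mono exp_ge_add_one_self_aux) auto
  also have "\<dots> = exp 1"
    using assms by (simp flip: exp_of_nat_mult)
  also have "\<dots> \<le> 3" by (rule exp_le)
  finally have 1: "(1 + 1 / real m) ^ m \<le> 3" .
  have "damping m = 1 / (1 + 1 / real m)"
    using assms by (simp add: damping_def field_simps)
  then have "damping m ^ m = 1 / (1 + 1 / real m) ^ m"
    by (simp only: power_one_over)
  moreover have "(1 + 1 / real m) ^ m > 0"
    by (intro zero_less_power add_pos_nonneg) auto
  ultimately have "1 / 3 \<le> damping m ^ m"
    using 1 by (simp only: le_divide_eq) simp
  then have "(1 / 3)\<^sup>2 \<le> (damping m ^ m)\<^sup>2"
    by (intro power_mono) auto
  also have "\<dots> = damping m ^ (2 * m)"
    by (simp add: power_mult mult.commute)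
  also have "\<dots> \<le> damping m ^ j"
    using assms damping_bounds[of m] by (intro power_decreasing) auto
  finally show ?thesis by (simp add: power2_eq_square)
qed

text \<open>Fixing \<open>p 0 = 0\<close> lets all sums run over the whole of \<open>nat\<close>;
  the value at 0 of a given sequence is overwritten before it enters here.\<close>

locale renewal =
  fixes p :: "nat \<Rightarrow> real"
  assumes p_0: "p 0 = 0" and p_nonneg: "\<And>n. p n \<ge> 0" and p_sums: "p sums 1"
begin

abbreviation "u \<equiv> renewal_seq p"

text \<open>The tail, written as the complement of a finite sum so that its recursion is immediate;
  \<open>z_sums\<close> identifies it with the infinite sum.\<close>

definition z :: "nat \<Rightarrow> real" where
  "z n = 1 - (\<Sum>k\<le>n. p k)"

lemma z_0 [simp]: "z 0 = 1"
  by (simp add: z_def p_0)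

lemma z_Suc: "z (Suc n) = z n - p (Suc n)"
  by (simp add: z_def)

lemma p_Suc_eq: "p (Suc n) = z n - z (Suc n)"
  by (simp add: z_Suc)

lemma z_sums: "(\<lambda>k. p (k + Suc n)) sums z n"
  using sums_iff_shift'[of p "Suc n" 1] p_sums by (simp add: z_def lessThan_Suc_atMost)

lemma z_nonneg: "z n \<ge> 0"
  by (rule sums_le[OF _ sums_zero z_sums]) (rule p_nonneg)

lemma z_antimono: "m \<le> n \<Longrightarrow> z n \<le> z m"
proof (induction n rule: dec_induct)
  case (step n)
  then show ?case
    using p_nonneg[of "Suc n"] by (simp add: z_Suc)
qed simp

lemma z_le_1: "z n \<le> 1"
  using z_antimono[of 0 n] by simp

lemma p_le_z: "p (Suc n) \<le> z n"
  using z_nonneg[of "Suc n"] by (simp add: z_Suc)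

lemma p_le_1: "p n \<le> 1"
  using p_0 order_trans[OF p_le_z z_le_1] by (cases n) auto

lemma u_nonneg: "u n \<ge> 0"
  by (induction n rule: less_induct, rename_tac n, case_tac n)
    (auto intro!: sum_nonneg mult_nonneg_nonneg p_nonneg)

text \<open>The summand is the probability that the last visit to 0 up to time n occurs at
  \<open>j\<close>. In the induction the new term \<open>u (Suc n)\<close> replaces exactly what the
  tails lose.\<close>

lemma renewal_identity: "(\<Sum>j\<le>n. u j * z (n - j)) = 1"
proof (induction n)
  case (Suc n)
  have "(\<Sum>j\<le>Suc n. u j * z (Suc n - j)) = u (Suc n) + (\<Sum>j\<le>n. u j * (z (n - j) - p (Suc n - j)))"
    by (auto simp: Suc_diff_le z_Suc intro!: sum.cong)
  also have "\<dots> = 1"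
    using Suc by (simp add: right_diff_distrib sum_subtractf)
  finally show ?case .
qed simp

text \<open>Bounds the expected number of visits to 0 up to time n by \<open>1 / z n\<close>. It is
  used wherever no cancellation between \<open>u (j + l)\<close> and \<open>u j\<close> is
  available.\<close>

lemma u_sum_le: "(\<Sum>j\<le>n. u j) * z n \<le> 1"
proof -
  have "(\<Sum>j\<le>n. u j) * z n \<le> (\<Sum>j\<le>n. u j * z (n - j))"
    unfolding sum_distrib_right
    by (intro sum_mono mult_left_mono z_antimono u_nonneg) auto
  then show ?thesis by (simp add: renewal_identity)
qed

lemma u_le_1: "u n \<le> 1"
proof -
  have "u n * z (n - n) \<le> (\<Sum>j\<le>n. u j * z (n - j))"
    by (rule member_le_sum) (auto intro!: mult_nonneg_nonneg u_nonneg z_nonneg)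
  then show ?thesis by (simp add: renewal_identity)
qed

lemma u_conv: "u n = (if n = 0 then 1 else 0) + (\<Sum>i\<le>n. p i * u (n - i))"
proof (cases n)
  case (Suc m)
  have "(\<Sum>i\<le>n. p i * u (n - i)) = (\<Sum>j\<le>n. p (n - j) * u j)"
    using sum.nat_diff_reindex[of "\<lambda>i. p i * u (n - i)" "Suc n"]
    by (auto simp flip: lessThan_Suc_atMost intro: sum.cong)
  then show ?thesis
    using Suc by (simp add: p_0 mult.commute)
qed (simp add: p_0)

lemma lingrow_seqs:
  "lingrow p" "lingrow u" "lingrow (\<lambda>n. real n * p n)" "lingrow (\<lambda>n. real n * u n)"
proof -
  have "a \<le> real n + 1 \<and> real n * a \<le> real n + 1" if "0 \<le> a" "a \<le> 1" for a n
    using mult_left_mono[OF that(2), of "real n"] that by auto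
  then show "lingrow p" "lingrow u" "lingrow (\<lambda>n. real n * p n)" "lingrow (\<lambda>n. real n * u n)"
    using p_nonneg p_le_1 u_nonneg u_le_1
    by (auto simp: lingrow_def abs_mult intro: order_trans[OF p_le_1] order_trans[OF u_le_1])
qed

context
  fixes s :: complex
  assumes s: "norm s < 1"
begin

lemma pser_u: "pser u s * (1 - pser p s) = 1"
proof -
  have "pser p s * pser u s = (\<Sum>n. of_real (u n) * s ^ n - (if n = 0 then 1 else 0))"
    unfolding pser_mult[OF s lingrow_seqs(1,2)] unfolding pser_def
    by (rule suminf_cong, subst (2) u_conv) (auto simp: distrib_right)
  also have "\<dots> = pser u s - 1"
    using suminf_diff[OF lingrow_summable[OF s lingrow_seqs(2)], of "\<lambda>n. if n = 0 then 1 else 0"]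
      suminf_finite[of "{0::nat}" "\<lambda>n. if n = 0 then 1 else 0 :: complex"]
      summable_finite[of "{0::nat}" "\<lambda>n. if n = 0 then 1 else 0 :: complex"]
    by (simp add: pser_def)
  finally show ?thesis by (simp add: algebra_simps)
qed

text \<open>This is \<open>s U' = s P' U^2\<close>, obtained from \<open>U = 1 / (1 - P)\<close>. It
  is proved on coefficients, by splitting n as \<open>i + (n - i)\<close> inside the convolution,
  without differentiating.\<close>

lemma pser_nu: "pser (\<lambda>n. real n * u n) s = pser (\<lambda>n. real n * p n) s * (pser u s)\<^sup>2"
proof -
  let ?Q = "pser (\<lambda>n. real n * p n) s" and ?B = "pser (\<lambda>n. real n * u n) s"
  have "?Q * pser u s + pser p s * ?B =
      (\<Sum>n. of_real (\<Sum>i\<le>n. real i * p i * u (n - i)) * s ^ n +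
            of_real (\<Sum>i\<le>n. p i * (real (n - i) * u (n - i))) * s ^ n)"
    using suminf_add[OF lingrow_summable_mult[OF s lingrow_seqs(3,2)]
        lingrow_summable_mult[OF s lingrow_seqs(1,4)]]
    unfolding pser_mult[OF s lingrow_seqs(3,2)] pser_mult[OF s lingrow_seqs(1,4)]
    by (simp add: pser_def)
  also have "\<dots> = ?B"
    unfolding pser_def
  proof (rule suminf_cong)
    fix n
    \<comment> \<open>The factor n kills the extra term of \<open>u_conv\<close> at index 0.\<close>
    have "real n * u n = (\<Sum>i\<le>n. real n * (p i * u (n - i)))"
      by (subst u_conv) (simp add: sum_distrib_left)
    also have "\<dots> = (\<Sum>i\<le>n. real i * p i * u (n - i)) + (\<Sum>i\<le>n. p i * (real (n - i) * u (n - i)))"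
      unfolding sum.distrib[symmetric] by (intro sum.cong) (auto simp: of_nat_diff algebra_simps)
    finally show "of_real (\<Sum>i\<le>n. real i * p i * u (n - i)) * s ^ n +
            of_real (\<Sum>i\<le>n. p i * (real (n - i) * u (n - i))) * s ^ n = of_real (real n * u n) * s ^ n"
      by (simp only: of_real_add distrib_right)
  qed
  finally have "?B * (1 - pser p s) = ?Q * pser u s"
    by (simp add: algebra_simps)
  moreover have "?B * (pser u s * (1 - pser p s)) = (?B * (1 - pser p s)) * pser u s"
    by (simp only: mult_ac)
  ultimately have "?B * (pser u s * (1 - pser p s)) = ?Q * (pser u s)\<^sup>2"
    by (simp add: power2_eq_square mult_ac)
  then show ?thesis by (simp add: pser_u)
qed

end

end

section \<open>Elementary bounds near the unit circle, and aperiodicity\<close>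

lemma norm_one_minus_cis_le: "norm (1 - cis x) \<le> \<bar>x\<bar>" "norm (1 - cis x) \<le> 2"
proof -
  have "(norm (1 - cis x))\<^sup>2 = (2 * sin (x / 2))\<^sup>2"
  proof -
    have "(1 - cos x)\<^sup>2 + (sin x)\<^sup>2 = 2 - 2 * cos x"
      using sin_cos_squared_add[of x] by (simp add: power2_eq_square algebra_simps)
    also have "\<dots> = (2 * sin (x / 2))\<^sup>2"
      using cos_double_sin[of "x / 2"] by (simp add: power_mult_distrib)
    finally show ?thesis
      unfolding cmod_power2 by (simp only: minus_complex.sel one_complex.sel cis.sel) simp
  qed
  then have eq: "norm (1 - cis x) = 2 * \<bar>sin (x / 2)\<bar>"
    by (metis abs_mult abs_norm_cancel abs_numeral power2_eq_iff_nonneg abs_ge_zero power2_abs)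
  show "norm (1 - cis x) \<le> \<bar>x\<bar>"
    using abs_sin_x_le_abs_x[of "x / 2"] eq by simp
  show "norm (1 - cis x) \<le> 2"
    using abs_sin_le_one[of "x / 2"] eq by linarith
qed

text \<open>Up to \<open>pi / 2\<close> the imaginary part suffices, by concavity of the sine on
  that interval; beyond it the real part is already at least 1.\<close>

lemma norm_one_minus_polar_ge:
  assumes "1 / 2 \<le> r" "0 \<le> t" "t \<le> pi"
  shows "t / pi \<le> norm (1 - of_real r * cis t)"
proof (cases "t \<le> pi / 2")
  case True
  have "t / pi \<le> 1 / 2 * sin t"
  proof -
    have "concave_on {0..pi/2} sin"
      by (rule f''_le0_imp_concave[where f' = cos and f'' = "\<lambda>x. - sin x"])
        (auto intro!: derivative_eq_intros sin_ge_zero)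
    then have "(1 - 2 * t / pi) * sin 0 + (2 * t / pi) * sin (pi / 2) \<le>
        sin ((1 - 2 * t / pi) *\<^sub>R 0 + (2 * t / pi) *\<^sub>R (pi / 2))"
      using True assms by (intro concave_onD) (auto simp: field_simps)
    then show ?thesis by (simp add: mult.commute)
  qed
  also have "\<dots> \<le> r * sin t"
    using assms by (intro mult_right_mono sin_ge_zero) auto
  also have "\<dots> \<le> norm (1 - of_real r * cis t)"
    using abs_Im_le_cmod[of "1 - of_real r * cis t"] by simp
  finally show ?thesis .
next
  case False
  then have "cos t \<le> 0"
    using assms cos_monotone_0_pi_le[of "pi / 2" t] by simp
  then have "1 \<le> 1 - r * cos t"
    using assms by (simp add: mult_le_0_iff)
  also have "\<dots> \<le> norm (1 - of_real r * cis t)"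
    using complex_Re_le_cmod[of "1 - of_real r * cis t"] by simp
  finally show ?thesis
    using assms by (simp add: field_simps order_trans)
qed

text \<open>If the sum vanished, \<open>e^(ikt) = 1\<close> for all \<open>k\<close> in
  \<open>A\<close>. The integers with this property form a group, so by Bezout it contains the gcd
  1, forcing \<open>e^(it) = 1\<close>.\<close>

lemma sum_one_minus_cos_pos:
  assumes "finite A" "Gcd A = (1::nat)" "0 < t" "t \<le> pi"
  shows "(\<Sum>k\<in>A. 1 - cos (real k * t)) > 0"
proof (rule ccontr)
  assume "\<not> ?thesis"
  then have "(\<Sum>k\<in>A. 1 - cos (real k * t)) = 0"
    by (intro antisym sum_nonneg) auto
  then have cos1: "cos (real k * t) = 1" if "k \<in> A" for k
    using that \<open>finite A\<close> by (subst (asm) sum_nonneg_eq_0_iff) auto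
  define T where "T = {k::int. cis (of_int k * t) = 1}"
  have cis_of_cos: "cis x = 1" if "cos x = 1" for x
    using that cos_one_sin_zero[of x] by (simp add: complex_eq_iff)
  have "Gcd B \<in> int -` T" if "finite B" "B \<subseteq> A" for B
    using that
  proof (induction B rule: finite_induct)
    case empty
    then show ?case by (simp add: T_def)
  next
    case (insert k B)
    have mem: "cis (of_int (int k) * t) = 1" "cis (of_int (int (Gcd B)) * t) = 1"
      using insert cos1 cis_of_cos by (auto simp: T_def)
    obtain x y where xy: "x * int k + y * int (Gcd B) = gcd (int k) (int (Gcd B))"
      using bezout_int by blast
    have "cis (of_int (int (gcd k (Gcd B))) * t) =
        cis (of_int (int k) * t) powi x * cis (of_int (int (Gcd B)) * t) powi y"
      unfolding cis_power_int cis_mult gcd_int_int_eq[symmetric] xy[symmetric]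
      by (simp add: algebra_simps)
    then show ?case
      using mem by (simp add: T_def)
  qed
  from this[of A] assms have "cis t = 1"
    by (simp add: T_def)
  then have "cos t = 1" by (simp add: complex_eq_iff)
  moreover have "cos t < cos 0"
    using assms by (intro cos_monotone_0_pi) auto
  ultimately show False by simp
qed

text \<open>For a single \<open>A\<close> this is compactness of \<open>[\<delta>, pi]\<close>.
  There are finitely many subsets of \<open>{1..N}\<close>, so one constant serves all of them and
  hence all sequences \<open>p\<close>.\<close>

lemma uniform_sum_one_minus_cos:
  assumes "\<delta> > 0"
  obtains \<kappa> :: real where "\<kappa> > 0"
    "\<And>A t. A \<subseteq> {1..N} \<Longrightarrow> Gcd A = (1::nat) \<Longrightarrow> \<delta> \<le> t \<Longrightarrow> t \<le> pi \<Longrightarrow>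
      \<kappa> \<le> (\<Sum>k\<in>A. 1 - cos (real k * t))"
proof -
  have "\<exists>\<kappa>>0. \<forall>t\<in>{\<delta>..pi}. \<kappa> \<le> (\<Sum>k\<in>A. 1 - cos (real k * t))"
    if A: "A \<subseteq> {1..N}" "Gcd A = 1" for A
  proof (cases "{\<delta>..pi} = {}")
    case False
    have "finite A" using A finite_subset by blast
    have "\<exists>t\<in>{\<delta>..pi}. \<forall>y\<in>{\<delta>..pi}.
        (\<Sum>k\<in>A. 1 - cos (real k * t)) \<le> (\<Sum>k\<in>A. 1 - cos (real k * y))"
      using False by (intro continuous_attains_inf continuous_intros) auto
    then obtain t where t: "t \<in> {\<delta>..pi}"
      "\<And>y. y \<in> {\<delta>..pi} \<Longrightarrow> (\<Sum>k\<in>A. 1 - cos (real k * t)) \<le> (\<Sum>k\<in>A. 1 - cos (real k * y))"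
      by blast
    have "(\<Sum>k\<in>A. 1 - cos (real k * t)) > 0"
      using t assms by (intro sum_one_minus_cos_pos \<open>finite A\<close> A) auto
    with t show ?thesis by blast
  qed (auto intro: exI[of _ 1])
  then obtain \<kappa> where \<kappa>: "\<And>A. A \<subseteq> {1..N} \<Longrightarrow> Gcd A = 1 \<Longrightarrow> \<kappa> A > 0"
    "\<And>A t. A \<subseteq> {1..N} \<Longrightarrow> Gcd A = 1 \<Longrightarrow> t \<in> {\<delta>..pi} \<Longrightarrow> \<kappa> A \<le> (\<Sum>k\<in>A. 1 - cos (real k * t))"
    by metis
  \<comment> \<open>Inserting 1 keeps the set nonempty even if no \<open>A\<close>
    qualifies.\<close>
  define D where "D = insert 1 (\<kappa> ` {A. A \<subseteq> {1..N} \<and> Gcd A = 1})"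
  have "finite D" unfolding D_def by simp
  show ?thesis
  proof
    show "Min D > 0"
      using \<kappa>(1) \<open>finite D\<close> by (subst Min_gr_iff) (auto simp: D_def)
    fix A t assume "A \<subseteq> {1..N}" "Gcd A = 1" "\<delta> \<le> t" "t \<le> pi"
    moreover from this have "Min D \<le> \<kappa> A"
      using \<open>finite D\<close> by (intro Min_le) (auto simp: D_def)
    ultimately show "Min D \<le> (\<Sum>k\<in>A. 1 - cos (real k * t))"
      using \<kappa>(2)[of A t] by auto
  qed
qed

section \<open>Bounds on the generating functions of one renewal sequence\<close>

context renewal
begin

text \<open>The right side is the mean of the return time truncated at \<open>m\<close>. Terms up to
  \<open>m\<close> are bounded without damping, later ones by \<open>m * p k\<close>; the two
  boundary terms \<open>m * z m\<close> cancel.\<close>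

lemma damped_sum_le:
  assumes "m \<ge> 1"
  shows "(\<Sum>k. real k * p k * damping m ^ k) \<le> (\<Sum>i<m. z i)"
proof -
  let ?a = "\<lambda>k. real k * p k * damping m ^ k"
  have d: "0 < damping m" "damping m < 1"
    using damping_bounds assms by auto
  have "summable (\<lambda>n. norm (of_real (real n * p n) * complex_of_real (damping m) ^ n))"
    using d by (intro lingrow_summable_norm lingrow_seqs) auto
  then have summ: "summable ?a"
    using d p_nonneg by (simp add: norm_mult norm_power)
  have zsum: "(\<Sum>k\<le>n. real k * p k) = (\<Sum>i<n. z i) - real n * z n" for n
    by (induction n) (auto simp: p_Suc_eq algebra_simps p_0)
  have le1: "?a k \<le> real k * p k" for k
    using p_nonneg[of k] d mult_left_le[of "damping m ^ k" "real k * p k"] by (simp add: power_le_one)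
  have le2: "?a k \<le> real m * p k" for k
    using mult_right_mono[OF real_mult_damping_power_le[OF assms, of k] p_nonneg[of k]]
    by (simp add: mult_ac)
  have "suminf ?a = (\<Sum>k. ?a (k + Suc m)) + (\<Sum>k<Suc m. ?a k)"
    by (rule suminf_split_initial_segment[OF summ])
  also have "(\<Sum>k. ?a (k + Suc m)) \<le> (\<Sum>k. real m * p (k + Suc m))"
    by (rule suminf_le[OF le2 summable_ignore_initial_segment[OF summ]
        sums_summable[OF sums_mult[OF z_sums]]])
  also have "\<dots> = real m * z m"
    using sums_unique[OF sums_mult[OF z_sums[of m], of "real m"]] by simp
  also have "(\<Sum>k<Suc m. ?a k) \<le> (\<Sum>k\<le>m. real k * p k)"
    unfolding lessThan_Suc_atMost by (intro sum_mono le1)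
  also have "\<dots> = (\<Sum>i<m. z i) - real m * z m" by (rule zsum)
  finally show ?thesis by simp
qed

lemma norm_pser_np_le:
  assumes "m \<ge> 1"
  shows "norm (pser (\<lambda>n. real n * p n) (of_real (damping m) * cis t)) \<le> (\<Sum>i<m. z i)"
proof -
  have d: "0 < damping m" "damping m < 1"
    using damping_bounds assms by auto
  then have "norm (pser (\<lambda>n. real n * p n) (of_real (damping m) * cis t)) \<le>
      (\<Sum>n. real n * p n * norm (of_real (damping m) * cis t) ^ n)"
    by (intro norm_pser_le lingrow_seqs) (auto simp: norm_mult p_nonneg)
  with d damped_sum_le[OF assms] show ?thesis
    by (simp add: norm_mult)
qed

text \<open>Since \<open>u\<close> is nonnegative, the modulus is at most the value at the real
  point, \<open>1 / (1 - P)\<close>. Mass beyond \<open>m\<close> is damped by at least a half, so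
  \<open>1 - P >= z m / 2\<close>. Unlike the bounds in powers of \<open>t\<close>, this one
  survives at \<open>t = 0\<close>.\<close>

lemma norm_pser_u_near:
  assumes "m \<ge> 1" "z m > 0"
  shows "norm (pser u (of_real (damping m) * cis t)) \<le> 2 / z m"
proof -
  let ?r = "damping m"
  have d: "0 < ?r" "?r < 1"
    using damping_bounds assms by auto
  have r: "norm (complex_of_real ?r) < 1" using d by simp
  have real_pser: "pser a (of_real ?r) = of_real (\<Sum>n. a n * ?r ^ n)" "summable (\<lambda>n. a n * ?r ^ n)"
    if a: "lingrow a" for a
  proof -
    have 1: "summable (\<lambda>n. of_real (a n) * complex_of_real ?r ^ n)"
      using lingrow_summable[OF r a] .
    also have "(\<lambda>n. of_real (a n) * complex_of_real ?r ^ n) = (\<lambda>n. of_real (a n * ?r ^ n))"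
      by simp
    finally show s: "summable (\<lambda>n. a n * ?r ^ n)"
      by (simp only: summable_complex_of_real)
    show "pser a (of_real ?r) = of_real (\<Sum>n. a n * ?r ^ n)"
      using suminf_of_real[OF s, where 'a = complex] by (simp add: pser_def)
  qed
  define U where "U = (\<Sum>n. u n * ?r ^ n)"
  define P where "P = (\<Sum>n. p n * ?r ^ n)"
  have "P = (\<Sum>n. p (n + Suc m) * ?r ^ (n + Suc m)) + (\<Sum>n<Suc m. p n * ?r ^ n)"
    unfolding P_def by (rule suminf_split_initial_segment[OF real_pser(2)[OF lingrow_seqs(1)]])
  also have "(\<Sum>n. p (n + Suc m) * ?r ^ (n + Suc m)) \<le> (\<Sum>n. (1/2) * p (n + Suc m))"
  proof (rule suminf_le)
    fix n
    have "?r ^ (n + Suc m) \<le> ?r ^ m"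
      using d by (intro power_decreasing) auto
    also have "\<dots> \<le> 1 / 2" by (rule damping_power_le_half) fact
    finally show "p (n + Suc m) * ?r ^ (n + Suc m) \<le> (1/2) * p (n + Suc m)"
      using p_nonneg[of "n + Suc m"] by (metis mult.commute mult_left_mono)
    show "summable (\<lambda>n. p (n + Suc m) * ?r ^ (n + Suc m))"
      using summable_ignore_initial_segment[OF real_pser(2)[OF lingrow_seqs(1)]] .
    show "summable (\<lambda>n. (1/2) * p (n + Suc m))"
      by (intro summable_mult sums_summable[OF z_sums])
  qed
  also have "\<dots> = z m / 2"
    using sums_unique[OF sums_mult[OF z_sums[of m], of "1/2"]] by simp
  also have "(\<Sum>n<Suc m. p n * ?r ^ n) \<le> (\<Sum>n\<le>m. p n)"
    unfolding lessThan_Suc_atMost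
    using d by (intro sum_mono mult_left_le p_nonneg power_le_one) auto
  also have "\<dots> = 1 - z m" by (simp add: z_def)
  finally have P: "z m / 2 \<le> 1 - P" by simp
  have "complex_of_real U * (1 - of_real P) = 1"
    using pser_u[OF r] real_pser(1)[OF lingrow_seqs(1)] real_pser(1)[OF lingrow_seqs(2)]
    by (simp add: U_def P_def)
  then have UP: "U * (1 - P) = 1"
    by (metis of_real_1 of_real_diff of_real_eq_iff of_real_mult)
  have "norm (pser u (of_real ?r * cis t)) \<le> U"
    using norm_pser_le[of "of_real ?r * cis t" u] d lingrow_seqs u_nonneg
    by (simp add: norm_mult U_def)
  also have "U = 1 / (1 - P)"
    using UP P assms by (simp add: field_simps)
  also have "\<dots> \<le> 1 / (z m / 2)"
    using P assms by (intro divide_left_mono) auto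
  finally show ?thesis by simp
qed

text \<open>The right side is at least the real part, a series of nonnegative terms, of which any
  finite set \<open>A\<close> may be kept.\<close>

lemma norm_one_minus_pser_ge:
  assumes "finite A" "0 \<le> r" "r < 1"
  shows "(\<Sum>k\<in>A. p k * (1 - r ^ k * cos (real k * t))) \<le> norm (1 - pser p (of_real r * cis t))"
proof -
  let ?s = "complex_of_real r * cis t"
  have s: "norm ?s < 1" using assms by (simp add: norm_mult)
  have "(\<lambda>n. of_real (p n) * ?s ^ n) sums pser p ?s"
    unfolding pser_def by (intro summable_sums lingrow_summable s lingrow_seqs)
  then have "(\<lambda>n. Re (of_real (p n) * ?s ^ n)) sums Re (pser p ?s)"
    by (rule sums_Re)
  moreover have "Re (of_real (p n) * ?s ^ n) = p n * (r ^ n * cos (real n * t))" for n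
    by (simp add: power_mult_distrib Complex.DeMoivre Re_power_real flip: of_real_power)
  ultimately have "(\<lambda>n. p n * (r ^ n * cos (real n * t))) sums Re (pser p ?s)"
    by (simp only:)
  from sums_diff[OF p_sums this] have sums: "(\<lambda>n. p n * (1 - r ^ n * cos (real n * t))) sums (1 - Re (pser p ?s))"
    by (simp add: algebra_simps)
  have "r ^ n * cos (real n * t) \<le> 1" for n
    using assms mult_mono[of "r ^ n" 1 "cos (real n * t)" 1]
    by (smt (verit) cos_le_one mult_le_one mult_nonneg_nonpos power_le_one zero_le_power)
  then have "(\<Sum>k\<in>A. p k * (1 - r ^ k * cos (real k * t))) \<le> 1 - Re (pser p ?s)"
    using sums assms p_nonneg
    by (intro sum_le_suminf[of "\<lambda>n. p n * (1 - r ^ n * cos (real n * t))", folded sums_unique[OF sums]]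
        sums_summable[OF sums] ballI mult_nonneg_nonneg) auto
  also have "\<dots> \<le> norm (1 - pser p ?s)"
    using complex_Re_le_cmod[of "1 - pser p ?s"] by simp
  finally show ?thesis .
qed

end

section \<open>Increments of the renewal sequence as Fourier integrals\<close>

lemma fser_shift_diff:
  fixes l :: nat
  assumes a: "summable (\<lambda>j. \<bar>a j\<bar>)"
  defines "d \<equiv> \<lambda>j. a j - (if l \<le> j then a (j - l) else 0)"
  shows "summable (\<lambda>j. \<bar>d j\<bar>)" "fser d t = (1 - cis (real l * t)) * fser a t"
proof -
  define e where "e = (\<lambda>j. if l \<le> j then a (j - l) else 0)"
  have "summable (\<lambda>j. \<bar>e (j + l)\<bar>)"
    using a by (simp add: e_def)
  then have e: "summable (\<lambda>j. \<bar>e j\<bar>)"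
    by (simp only: summable_iff_shift[of "\<lambda>j. \<bar>e j\<bar>" l])
  show "summable (\<lambda>j. \<bar>d j\<bar>)"
    by (rule summable_comparison_test'[OF summable_add[OF a e]]) (simp add: d_def e_def)
  have "(\<lambda>j. of_real (a j) * cis (real j * t)) sums fser a t"
    unfolding fser_def by (intro summable_sums summable_fser a)
  from sums_mult[OF this, of "cis (real l * t)"]
  have "(\<lambda>j. of_real (e (j + l)) * cis (real (j + l) * t)) sums (cis (real l * t) * fser a t)"
    by (simp add: e_def mult_ac distrib_left flip: cis_mult)
  then have "(\<lambda>j. of_real (e j) * cis (real j * t)) sums
      (cis (real l * t) * fser a t + (\<Sum>j<l. of_real (e j) * cis (real j * t)))"
    by (rule sums_iff_shift[THEN iffD1])
  also have "(\<Sum>j<l. of_real (e j) * cis (real j * t)) = 0"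
    by (simp add: e_def)
  finally have "fser e t = cis (real l * t) * fser a t"
    by (simp add: fser_def sums_iff)
  moreover have "fser d t = fser a t - fser e t"
    using suminf_diff[OF summable_fser[OF a, of t] summable_fser[OF e, of t]]
    by (simp add: fser_def d_def e_def left_diff_distrib)
  ultimately show "fser d t = (1 - cis (real l * t)) * fser a t"
    by (simp add: left_diff_distrib)
qed

context renewal
begin

definition bser :: "nat \<Rightarrow> real \<Rightarrow> complex" where
  "bser m t = pser (\<lambda>n. real n * u n) (of_real (damping m) * cis t)"

definition bcoeff :: "nat \<Rightarrow> nat \<Rightarrow> real" where
  "bcoeff m j = damping m ^ j * (real j * u j)"

lemma fser_bcoeff: "fser (bcoeff m) t = bser m t"
  unfolding bser_def bcoeff_def by (rule fser_eq_pser)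

context
  fixes m :: nat
  assumes m: "m \<ge> 1"
begin

lemma summable_bcoeff: "summable (\<lambda>j. \<bar>bcoeff m j\<bar>)"
proof -
  have d: "0 < damping m" "damping m < 1"
    using damping_bounds m by auto
  then have "summable (\<lambda>n. norm (of_real (real n * u n) * complex_of_real (damping m) ^ n))"
    by (intro lingrow_summable_norm lingrow_seqs) auto
  then show ?thesis
    using d by (simp add: norm_mult norm_power bcoeff_def abs_mult power_abs mult_ac)
qed

lemma continuous_bser: "continuous_on A (bser m)"
  using continuous_fser[OF summable_bcoeff] by (simp add: fser_bcoeff[abs_def])

text \<open>Reads off the coefficient of index \<open>m\<close>; the 9 undoes the damping.\<close>

lemma u_le_integral_bser:
  "real m * u m \<le> 9 * integral {0..pi} (\<lambda>t. norm (bser m t))"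
proof -
  have "real m * u m / 9 \<le> \<bar>bcoeff m m\<bar>"
    using mult_right_mono[OF damping_power_ge[OF m, of m], of "real m * u m"] u_nonneg[of m]
      damping_bounds[OF m] by (simp add: bcoeff_def abs_mult)
  also have "\<dots> \<le> pi * \<bar>bcoeff m m\<bar>"
    using pi_gt3 mult_right_mono[of 1 pi "\<bar>bcoeff m m\<bar>"] by simp
  also have "\<dots> \<le> integral {0..pi} (\<lambda>t. norm (bser m t))"
    using coeff_le_integral[OF summable_bcoeff, of m] by (simp add: fser_bcoeff)
  finally show ?thesis by simp
qed

text \<open>Differences are taken of the weighted sequence \<open>bcoeff\<close>, extended by 0 to
  negative indices, because then the Fourier series is multiplied exactly by
  \<open>1 - e^(ilt)\<close>.\<close>

definition bdiff :: "nat \<Rightarrow> nat \<Rightarrow> real" where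
  "bdiff l j = bcoeff m j - (if l \<le> j then bcoeff m (j - l) else 0)"

text \<open>Passing from \<open>j r^j u_j\<close> back to \<open>u_j\<close> costs only a multiple of \<open>l u_(j+l)\<close>, because
  \<open>1 - r^l \<le> l / m\<close>.\<close>

lemma u_diff_le:
  assumes "m \<le> j" "j \<le> 2 * m"
  shows "real m * \<bar>u (j + l) - u j\<bar> \<le> 9 * \<bar>bdiff l (j + l)\<bar> + 27 * real l * u (j + l)"
proof -
  let ?r = "damping m"
  have d: "0 < ?r" "?r < 1"
    using damping_bounds m by auto
  \<comment> \<open>The two corrections replace the weight \<open>r^(j+l)\<close> by
    \<open>r^j\<close> and \<open>j + l\<close> by \<open>j\<close>. They cost
    \<open>2 l u (j + l)\<close> and \<open>l u (j + l)\<close>, which multiplied by 9 gives the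
    27.\<close>
  have eq: "?r ^ j * real j * (u (j + l) - u j) =
      bdiff l (j + l) + ?r ^ j * real j * (1 - ?r ^ l) * u (j + l) - real l * ?r ^ (j + l) * u (j + l)"
    by (simp add: bdiff_def bcoeff_def power_add algebra_simps)
  have "real m / 9 * \<bar>u (j + l) - u j\<bar> \<le> ?r ^ j * real j * \<bar>u (j + l) - u j\<bar>"
    using damping_power_ge[OF m assms(2)] assms mult_mono[of "1 / 9" "?r ^ j" "real m" "real j"]
    by (intro mult_right_mono) auto
  also have "\<dots> = \<bar>bdiff l (j + l) + ?r ^ j * real j * (1 - ?r ^ l) * u (j + l) - real l * ?r ^ (j + l) * u (j + l)\<bar>"
    using d by (simp add: eq[symmetric] abs_mult)
  also have "\<dots> \<le> \<bar>bdiff l (j + l)\<bar> + \<bar>?r ^ j * real j * (1 - ?r ^ l) * u (j + l)\<bar> + \<bar>real l * ?r ^ (j + l) * u (j + l)\<bar>"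
    by linarith
  also have "\<bar>?r ^ j * real j * (1 - ?r ^ l) * u (j + l)\<bar> \<le> 2 * real l * u (j + l)"
  proof -
    have "?r ^ j * real j * (1 - ?r ^ l) \<le> 1 * real (2 * m) * (real l / real m)"
      using d assms one_minus_damping_power[OF m, of l]
      by (intro mult_mono) (auto simp: power_le_one)
    then have "?r ^ j * real j * (1 - ?r ^ l) * u (j + l) \<le> 2 * real l * u (j + l)"
      using m u_nonneg by (intro mult_right_mono) auto
    then show ?thesis
      using d u_nonneg by (simp add: abs_mult power_le_one)
  qed
  also have "\<bar>real l * ?r ^ (j + l) * u (j + l)\<bar> \<le> real l * u (j + l)"
  proof -
    have "real l * ?r ^ (j + l) \<le> real l * 1"
      using d by (intro mult_left_mono power_le_one) auto
    then have "real l * ?r ^ (j + l) * u (j + l) \<le> real l * 1 * u (j + l)"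
      using u_nonneg by (intro mult_right_mono) auto
    then show ?thesis
      using d u_nonneg[of "j + l"] by (simp add: abs_mult)
  qed
  finally show ?thesis by simp
qed

lemma fser_bdiff:
  "summable (\<lambda>j. \<bar>bdiff l j\<bar>)" "norm (fser (bdiff l) t) = norm (1 - cis (real l * t)) * norm (bser m t)"
  using fser_shift_diff[OF summable_bcoeff, of l]
  by (simp_all add: bdiff_def[abs_def] fser_bcoeff norm_mult)

lemma u_diff_le_integral:
  "real m * \<bar>u (m + l) - u m\<bar> \<le>
    9 * integral {0..pi} (\<lambda>t. norm (1 - cis (real l * t)) * norm (bser m t)) + 27 * real l * u (m + l)"
proof -
  have "\<bar>bdiff l (m + l)\<bar> \<le> pi * \<bar>bdiff l (m + l)\<bar>"
    using pi_gt3 mult_right_mono[of 1 pi "\<bar>bdiff l (m + l)\<bar>"] by simp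
  also have "\<dots> \<le> integral {0..pi} (\<lambda>t. norm (1 - cis (real l * t)) * norm (bser m t))"
    using coeff_le_integral[OF fser_bdiff(1)[of l], of "m + l"] by (simp add: fser_bdiff(2))
  finally show ?thesis
    using u_diff_le[of m l] by simp
qed

text \<open>A single radius serves the whole block, because \<open>r^j >= 1/9\<close> up to
  \<open>2 * m\<close>. Cauchy-Schwarz over \<open>m\<close> indices followed by Bessel produces the
  square root.\<close>

lemma u_diff_block_le_integral:
  "real m * (\<Sum>j\<in>{m..<2*m}. \<bar>u (j + l) - u j\<bar>) \<le>
    9 * sqrt (real m * integral {0..pi} (\<lambda>t. (norm (1 - cis (real l * t)) * norm (bser m t))\<^sup>2)) +
    27 * real l * (\<Sum>j\<in>{m..<2*m}. u (j + l))"
proof -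
  let ?I = "integral {0..pi} (\<lambda>t. (norm (1 - cis (real l * t)) * norm (bser m t))\<^sup>2)"
  let ?S = "\<Sum>j\<in>{m..<2*m}. \<bar>bdiff l (j + l)\<bar>"
  have "(\<Sum>j\<in>{m..<2*m}. (bdiff l (j + l))\<^sup>2) = (\<Sum>j\<in>{m+l..<2*m+l}. (bdiff l j)\<^sup>2)"
    by (rule sum.shift_bounds_nat_ivl[symmetric])
  also have "\<dots> \<le> pi * (\<Sum>j\<in>{m+l..<2*m+l}. (bdiff l j)\<^sup>2)"
    using pi_gt3 mult_right_mono[of 1 pi "\<Sum>j\<in>{m+l..<2*m+l}. (bdiff l j)\<^sup>2"] by (simp add: sum_nonneg)
  also have "\<dots> \<le> ?I"
    using Bessel[OF fser_bdiff(1)[of l], of "{m+l..<2*m+l}"] by (simp add: fser_bdiff(2))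
  finally have I: "(\<Sum>j\<in>{m..<2*m}. (bdiff l (j + l))\<^sup>2) \<le> ?I" .
  have "?S\<^sup>2 \<le> (\<Sum>j\<in>{m..<2*m}. \<bar>bdiff l (j + l)\<bar>\<^sup>2) * real (card {m..<2*m})"
    by (rule sum_squared_le_sum_of_squares)
  also have "\<dots> \<le> ?I * real m"
    using mult_right_mono[OF I, of "real m"] by simp
  finally have S: "?S \<le> sqrt (real m * ?I)"
    by (intro real_le_rsqrt) (simp add: mult.commute)
  have "real m * (\<Sum>j\<in>{m..<2*m}. \<bar>u (j + l) - u j\<bar>) \<le>
      (\<Sum>j\<in>{m..<2*m}. 9 * \<bar>bdiff l (j + l)\<bar> + 27 * real l * u (j + l))"
    unfolding sum_distrib_left by (intro sum_mono u_diff_le) auto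
  also have "\<dots> = 9 * ?S + 27 * real l * (\<Sum>j\<in>{m..<2*m}. u (j + l))"
    by (simp add: sum.distrib sum_distrib_left)
  finally show ?thesis using S by simp
qed

end

end

subsection \<open>Uniform classes of renewal sequences\<close>

lemma powr_neg_ge_Bernoulli:
  fixes x :: real
  assumes "0 < x" "x \<le> 1" "b > 0"
  shows "1 + b * (1 - x) \<le> x powr (- b)"
proof -
  have "1 + b * (1 - x) \<le> 1 + b * (- ln x)"
    using ln_le_minus_one[of x] assms by (intro add_left_mono mult_left_mono) auto
  also have "\<dots> \<le> exp (- b * ln x)"
    using exp_ge_add_one_self[of "- b * ln x"] by simp
  also have "\<dots> = x powr (- b)"
    using assms by (simp add: powr_def)
  finally show ?thesis .
qed

lemma powr_le_Bernoulli:
  fixes x :: real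
  assumes "0 < x" "0 \<le> a" "a \<le> 1"
  shows "x powr a \<le> 1 - a * (1 - x)"
proof -
  have "convex_on UNIV exp" by (rule exp_convex)
  then have "exp ((1 - a) *\<^sub>R 0 + a *\<^sub>R ln x) \<le> (1 - a) * exp 0 + a * exp (ln x)"
    using assms by (intro convex_onD) auto
  then show ?thesis
    using assms by (simp add: powr_def algebra_simps)
qed

text \<open>Comparison with the integral of \<open>x powr (a - 1)\<close>; with
  \<open>x = n / (n + 1)\<close> the induction step is
  \<open>x powr a <= 1 - a * (1 - x)\<close>.\<close>

lemma sum_powr_le:
  assumes "0 < a" "a \<le> (1::real)"
  shows "(\<Sum>i=1..n. real i powr (a - 1)) \<le> real n powr a / a"
proof (induction n)
  case (Suc n)
  have "real n powr a + a * real (Suc n) powr (a - 1) \<le> real (Suc n) powr a"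
  proof (cases "n = 0")
    case False
    define x where "x = real n / real (Suc n)"
    have "x > 0" using False by (simp add: x_def)
    have "real n powr a = real (Suc n) powr a * x powr a"
      using False by (simp add: x_def powr_divide)
    also have "\<dots> \<le> real (Suc n) powr a * (1 - a * (1 - x))"
      using assms \<open>x > 0\<close> by (intro mult_left_mono powr_le_Bernoulli) auto
    also have "1 - x = 1 / real (Suc n)"
      by (simp add: x_def field_simps)
    also have "real (Suc n) powr a * (1 - a * (1 / real (Suc n))) =
        real (Suc n) powr a - a * real (Suc n) powr (a - 1)"
      by (simp add: powr_diff right_diff_distrib)
    finally show ?thesis by simp
  qed (use assms in auto)
  then have "(real n powr a + a * real (Suc n) powr (a - 1)) / a \<le> real (Suc n) powr a / a"
    using assms by (intro divide_right_mono) auto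
  then have "real n powr a / a + real (Suc n) powr (a - 1) \<le> real (Suc n) powr a / a"
    using assms by (simp add: add_divide_distrib del: of_nat_Suc)
  with Suc show ?case by simp
qed simp

text \<open>The summands are dominated by the telescoping differences of
  \<open>i powr (- b) / b\<close>.\<close>

lemma sum_powr_tail_le:
  assumes "0 < b" "1 \<le> n"
  shows "(\<Sum>i=Suc n..M. real i powr (- 1 - b)) \<le> real n powr (- b) / b"
proof (cases "n \<le> M")
  case True
  then have "(\<Sum>i=Suc n..M. real i powr (- 1 - b)) \<le> (real n powr (- b) - real M powr (- b)) / b"
  proof (induction M rule: dec_induct)
    case (step M)
    define x where "x = real M / real (Suc M)"
    have M: "M \<ge> 1" "x > 0" "x \<le> 1" using step assms by (auto simp: x_def)
    have "real (Suc M) powr (- b) * (1 + b * (1 - x)) \<le> real (Suc M) powr (- b) * x powr (- b)"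
      using assms M by (intro mult_left_mono powr_neg_ge_Bernoulli) auto
    also have "\<dots> = real M powr (- b)"
      using M by (simp add: x_def powr_divide)
    also have "1 - x = 1 / real (Suc M)"
      by (simp add: x_def field_simps)
    also have "real (Suc M) powr (- b) * (1 + b * (1 / real (Suc M))) =
        real (Suc M) powr (- b) + b * real (Suc M) powr (- 1 - b)"
    proof -
      have "real (Suc M) powr (- 1 - b) = real (Suc M) powr (- b) / real (Suc M)"
        by (simp add: powr_diff powr_minus field_simps)
      then show ?thesis by (simp add: algebra_simps)
    qed
    finally have "real (Suc M) powr (- 1 - b) \<le> (real M powr (- b) - real (Suc M) powr (- b)) / b"
      using assms by (simp add: field_simps)
    moreover have "(\<Sum>i=Suc n..Suc M. real i powr (- 1 - b)) =
        (\<Sum>i=Suc n..M. real i powr (- 1 - b)) + real (Suc M) powr (- 1 - b)"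
      using step by simp
    ultimately show ?case
      using step assms by (simp add: diff_divide_distrib)
  qed simp
  also have "\<dots> \<le> real n powr (- b) / b"
    using assms by (intro divide_right_mono) auto
  finally show ?thesis .
qed (use assms in auto)

text \<open>Constants obtained inside this locale depend on \<open>S\<close> and the parameters, but not on the member
  \<open>p \<in> S\<close>: this is how uniformity is expressed. The requirement \<open>1/2 < \<gamma>\<close> is harmless, as \<open>\<gamma>\<close> may
  be enlarged, and spares a case distinction in integrals of \<open>t powr (- 2 \<gamma>)\<close>.\<close>

locale renewal_class =
  fixes S :: "(nat \<Rightarrow> real) set" and \<beta> \<gamma> K c0 :: real and N :: nat
  assumes exponents: "0 < \<beta>" "\<beta> \<le> \<gamma>" "1 / 2 < \<gamma>" "\<gamma> < 1"
    and K_ge_1: "1 \<le> K" and c0_pos: "0 < c0"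
    and renewal: "\<And>p. p \<in> S \<Longrightarrow> renewal p"
    and aperiodic: "\<And>p. p \<in> S \<Longrightarrow> Gcd {k. 1 \<le> k \<and> k \<le> N \<and> c0 \<le> p k} = 1"
    and tail_lower: "\<And>p l n. p \<in> S \<Longrightarrow> 1 \<le> l \<Longrightarrow> l \<le> n \<Longrightarrow>
      renewal.z p n * (real n / real l) powr \<beta> \<le> K * renewal.z p l"
    and tail_upper: "\<And>p l n. p \<in> S \<Longrightarrow> 1 \<le> l \<Longrightarrow> l \<le> n \<Longrightarrow>
      renewal.z p l \<le> K * (real n / real l) powr \<gamma> * renewal.z p n"
    and tail_1: "\<And>p. p \<in> S \<Longrightarrow> 1 \<le> K * renewal.z p 1"
begin

lemma tail_pos:
  assumes "p \<in> S"
  shows "renewal.z p n > 0"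
proof (cases "n = 0")
  case True
  interpret renewal p using assms by (rule renewal)
  from True show ?thesis by simp
next
  case False
  have "renewal.z p 1 > 0"
    using tail_1[OF assms] K_ge_1 by (smt (verit) mult_nonneg_nonpos)
  then have "0 < K * (real n / real 1) powr \<gamma> * renewal.z p n"
    using tail_upper[OF assms, of 1 n] False by linarith
  moreover have "0 < K * (real n / real 1) powr \<gamma>"
    using False K_ge_1 by simp
  ultimately show ?thesis
    by (rule zero_less_mult_pos)
qed

text \<open>A Karamata-type estimate: as \<open>\<gamma> < 1\<close>, the tails decay slowly enough
  for their sum to be of the order of its last term times n.\<close>

lemma sum_tail_le:
  obtains C where "C > 0"
    "\<And>p n. p \<in> S \<Longrightarrow> 1 \<le> n \<Longrightarrow> (\<Sum>i\<le>n. renewal.z p i) \<le> C * (real n * renewal.z p n)"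
proof
  show "K * K + K / (1 - \<gamma>) > 0"
    using K_ge_1 exponents by (intro add_pos_pos) auto
  fix p and n :: nat assume p: "p \<in> S" and n: "1 \<le> n"
  interpret renewal p using p by (rule renewal)
  \<comment> \<open>The bounds on tails start at index 1, so the term \<open>z 0 = 1\<close> is
    treated apart.\<close>
  have "1 \<le> K * z 1" by (rule tail_1[OF p])
  also have "\<dots> \<le> K * (K * (real n / real 1) powr \<gamma> * z n)"
    using tail_upper[OF p _ n] K_ge_1 by (intro mult_left_mono) auto
  also have "(real n / real 1) powr \<gamma> \<le> real n powr 1"
    using n exponents powr_mono[of \<gamma> 1 "real n"] by simp
  finally have 1: "1 \<le> K * (K * real n powr 1 * z n)"
    using K_ge_1 z_nonneg by (simp add: mult_left_mono mult_right_mono)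
  have "(\<Sum>i=1..n. z i) \<le> (\<Sum>i=1..n. K * z n * real n powr \<gamma> * real i powr ((1 - \<gamma>) - 1))"
  proof (rule sum_mono)
    fix i assume i: "i \<in> {1..n}"
    then have "z i \<le> K * (real n / real i) powr \<gamma> * z n"
      by (intro tail_upper p) auto
    also have "(real n / real i) powr \<gamma> = real n powr \<gamma> * real i powr ((1 - \<gamma>) - 1)"
      using i by (simp add: powr_divide powr_minus_divide)
    finally show "z i \<le> K * z n * real n powr \<gamma> * real i powr ((1 - \<gamma>) - 1)"
      by (simp add: mult_ac)
  qed
  also have "\<dots> = K * z n * real n powr \<gamma> * (\<Sum>i=1..n. real i powr ((1 - \<gamma>) - 1))"
    by (simp add: sum_distrib_left)
  also have "\<dots> \<le> K * z n * real n powr \<gamma> * (real n powr (1 - \<gamma>) / (1 - \<gamma>))"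
    using K_ge_1 z_nonneg exponents by (intro mult_left_mono sum_powr_le) auto
  also have "\<dots> = K / (1 - \<gamma>) * (real n * z n)"
    using n by (simp flip: powr_add)
  finally have 2: "(\<Sum>i=1..n. z i) \<le> K / (1 - \<gamma>) * (real n * z n)" .
  have "(\<Sum>i\<le>n. z i) = 1 + (\<Sum>i=1..n. z i)"
    using sum.atMost_shift[of z n] by (simp add: sum.atLeast1_atMost_eq lessThan_Suc_atMost
        sum.lessThan_Suc_shift atLeast0AtMost[symmetric] sum.atLeast_Suc_atMost)
  also have "\<dots> \<le> K * (K * real n powr 1 * z n) + K / (1 - \<gamma>) * (real n * z n)"
    using 1 2 by linarith
  also have "\<dots> = (K * K + K / (1 - \<gamma>)) * (real n * z n)"
    using n by (simp add: algebra_simps)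
  finally show "(\<Sum>i\<le>n. z i) \<le> (K * K + K / (1 - \<gamma>)) * (real n * z n)" .
qed

text \<open>For small \<open>t\<close>, the real part of \<open>1 - \<Sum> p_n s^n\<close> is bounded below using only the mass of
  \<open>p\<close> in \<open>(k, L k]\<close> with \<open>k\<close> about \<open>1 / (L t)\<close>, where \<open>L\<close> is so large that this is at least half of
  the tail. For large \<open>t\<close>, aperiodicity and compactness give a constant lower bound.\<close>

lemma norm_pser_u_le_tail:
  obtains C where "C > 0"
    "\<And>p r t. p \<in> S \<Longrightarrow> 1 / 2 \<le> r \<Longrightarrow> r < 1 \<Longrightarrow> 0 < t \<Longrightarrow> t \<le> pi \<Longrightarrow>
      norm (pser (renewal_seq p) (of_real r * cis t)) \<le> C / renewal.z p (nat \<lceil>1 / t\<rceil>)"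
proof -
  \<comment> \<open>With this \<open>L\<close>, \<open>tail_lower\<close> between \<open>k\<close>
    and \<open>L * k\<close> makes the tail drop by at least a half.\<close>
  define L where "L = nat \<lceil>(2 * K) powr (1 / \<beta>)\<rceil>"
  have "(2 * K) powr (1 / \<beta>) \<le> real L"
    unfolding L_def by linarith
  then have "((2 * K) powr (1 / \<beta>)) powr \<beta> \<le> real L powr \<beta>"
    using exponents by (intro powr_mono2) auto
  then have LK: "2 * K \<le> real L powr \<beta>"
    using exponents K_ge_1 by (simp add: powr_powr)
  have L: "L \<ge> 1"
    using LK K_ge_1 exponents by (cases "L = 0") auto
  obtain \<kappa> where \<kappa>: "\<kappa> > 0"
    "\<And>A t. A \<subseteq> {1..N} \<Longrightarrow> Gcd A = (1::nat) \<Longrightarrow> 1 / real L \<le> t \<Longrightarrow> t \<le> pi \<Longrightarrow>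
      \<kappa> \<le> (\<Sum>k\<in>A. 1 - cos (real k * t))"
    using uniform_sum_one_minus_cos[of "1 / real L" N] L by auto
  \<comment> \<open>\<open>\<kappa>1\<close> is the least value of \<open>1 - cos\<close> on the
    angles used for small \<open>t\<close>, halved because half of the tail is kept.
    \<open>\<kappa>2\<close> collects \<open>p k >= c0\<close>, \<open>r ^ k >= (1/2) ^ N\<close>
    and the compactness constant.\<close>
  define \<kappa>1 where "\<kappa>1 = (1 - cos (1 / (2 * real L))) / 2"
  define \<kappa>2 where "\<kappa>2 = c0 * (1/2) ^ N * \<kappa>"
  have L2: "0 < 1 / (2 * real L)" "1 / (2 * real L) \<le> 1"
    using L by (auto simp: field_simps)
  have L3: "1 / (2 * real L) \<le> pi"
    using L2(2) pi_gt3 by linarith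
  have "cos (1 / (2 * real L)) < cos 0"
    by (rule cos_monotone_0_pi) (use L2 L3 in auto)
  then have \<kappa>1: "\<kappa>1 > 0" by (simp add: \<kappa>1_def)
  have \<kappa>2: "\<kappa>2 > 0" using \<kappa> c0_pos by (simp add: \<kappa>2_def)
  show ?thesis
  proof
    show "1 / min \<kappa>1 \<kappa>2 > 0" using \<kappa>1 \<kappa>2 by simp
    fix p and r t :: real
    assume p: "p \<in> S" and r: "1 / 2 \<le> r" "r < 1" and t: "0 < t" "t \<le> pi"
    interpret renewal p using p by (rule renewal)
    let ?s = "complex_of_real r * cis t"
    define n where "n = nat \<lceil>1 / t\<rceil>"
    have zn: "z n > 0" by (rule tail_pos[OF p])
    have "min \<kappa>1 \<kappa>2 * z n \<le> norm (1 - pser p ?s)"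
    proof (cases "t \<le> 1 / real L")
      case True
      \<comment> \<open>Rounding \<open>x\<close> down loses at most a factor 2, so
        \<open>k * t\<close> lies in \<open>[1/(2L), 1/L]\<close>, and every index from
        \<open>k\<close> to \<open>L * k\<close> has its angle in
        \<open>[1/(2L), 1]\<close>.\<close>
      define x where "x = 1 / (real L * t)"
      define k where "k = nat \<lfloor>x\<rfloor>"
      have x: "1 \<le> x" using True t L by (simp add: x_def field_simps)
      have k: "real k \<le> x" "x < real k + 1" "k \<ge> 1"
        using x unfolding k_def by linarith+
      then have k2: "x \<le> 2 * real k" by linarith
      have xt: "x * t = 1 / real L" using t L by (simp add: x_def)
      have kt: "1 / (2 * real L) \<le> real k * t" "real k * t \<le> 1 / real L"
        using mult_right_mono[OF k2, of t] mult_right_mono[OF k(1), of t] t xt by auto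
      have "1 / real L \<le> 1" using L by simp
      with kt(2) have "real k * t \<le> 1" by (rule order_trans)
      then have "real k \<le> 1 / t"
        using t by (simp add: le_divide_eq)
      then have "k \<le> n" unfolding n_def by linarith
      have "z (L * k) * (real (L * k) / real k) powr \<beta> \<le> K * z k"
        using k L by (intro tail_lower p) auto
      then have "z (L * k) * real L powr \<beta> \<le> K * z k"
        using k by simp
      moreover have "K * (2 * z (L * k)) \<le> z (L * k) * real L powr \<beta>"
        using mult_left_mono[OF LK z_nonneg[of "L * k"]] by (simp add: mult_ac)
      ultimately have "K * (2 * z (L * k)) \<le> K * z k"
        by linarith
      then have half: "2 * z (L * k) \<le> z k"
        using K_ge_1 by (simp only: mult_le_cancel_left_pos)
      have "k \<le> L * k" using L by simp
      then have "{..L * k} = {..k} \<union> {k<..L * k}"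
        by (rule ivl_disj_un_one(3)[symmetric])
      then have "(\<Sum>i\<le>L * k. p i) = (\<Sum>i\<le>k. p i) + (\<Sum>i\<in>{k<..L*k}. p i)"
        by (simp only:) (rule sum.union_disjoint, auto)
      then have mass: "(\<Sum>i\<in>{k<..L*k}. p i) = z k - z (L * k)"
        by (simp add: z_def)
      have "min \<kappa>1 \<kappa>2 * z n \<le> \<kappa>1 * z k"
        using z_antimono[OF \<open>k \<le> n\<close>] \<kappa>1 zn by (intro mult_mono) auto
      also have "\<dots> \<le> (1 - cos (1 / (2 * real L))) * (z k - z (L * k))"
      proof -
        have "z k / 2 \<le> z k - z (L * k)" using half by simp
        then have "2 * \<kappa>1 * (z k / 2) \<le> 2 * \<kappa>1 * (z k - z (L * k))"
          using \<kappa>1 by (intro mult_left_mono) auto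
        moreover have "1 - cos (1 / (2 * real L)) = 2 * \<kappa>1" by (simp add: \<kappa>1_def)
        ultimately show ?thesis by simp
      qed
      also have "\<dots> = (\<Sum>i\<in>{k<..L*k}. p i * (1 - cos (1 / (2 * real L))))"
        unfolding mass[symmetric] sum_distrib_right[symmetric] by (rule mult.commute)
      also have "\<dots> \<le> (\<Sum>i\<in>{k<..L*k}. p i * (1 - r ^ i * cos (real i * t)))"
      proof (intro sum_mono mult_left_mono p_nonneg)
        fix i assume i: "i \<in> {k<..L*k}"
        have it: "1 / (2 * real L) \<le> real i * t"
          by (rule order_trans[OF kt(1)]) (use i t in \<open>auto intro: mult_right_mono\<close>)
        have "real i * t \<le> real (L * k) * t"
          using i t by (intro mult_right_mono) (auto simp del: of_nat_mult)
        also have "\<dots> = real L * (real k * t)" by simp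
        also have "\<dots> \<le> real L * (1 / real L)"
          using kt(2) by (intro mult_left_mono) auto
        finally have it1: "real i * t \<le> 1" using L by simp
        have bounds: "0 \<le> real i * t" "real i * t \<le> pi / 2" "real i * t \<le> pi" "- (pi / 2) \<le> real i * t"
          using it it1 L2 pi_gt3 by linarith+
        \<comment> \<open>Angles below \<open>pi / 2\<close> make the damping harmless:
          \<open>r ^ i\<close> can only shrink a nonnegative cosine.\<close>
        have "cos (real i * t) \<ge> 0"
          using bounds by (intro cos_ge_zero)
        then have "r ^ i * cos (real i * t) \<le> cos (real i * t)"
          using r by (intro mult_left_le_one_le power_le_one) auto
        also have "\<dots> \<le> cos (1 / (2 * real L))"
          by (rule cos_monotone_0_pi_le[OF _ it bounds(3)]) (use L2 in simp)
        finally show "1 - cos (1 / (2 * real L)) \<le> 1 - r ^ i * cos (real i * t)" by simp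
      qed
      also have "\<dots> \<le> norm (1 - pser p ?s)"
        using r by (intro norm_one_minus_pser_ge) auto
      finally show ?thesis .
    next
      case False
      define A where "A = {k. 1 \<le> k \<and> k \<le> N \<and> c0 \<le> p k}"
      have A: "A \<subseteq> {1..N}" "Gcd A = 1"
        using aperiodic[OF p] by (auto simp: A_def)
      have "finite A" using A finite_subset by blast
      have "min \<kappa>1 \<kappa>2 * z n \<le> \<kappa>2 * 1"
        using \<kappa>2 zn z_le_1 by (intro mult_mono) auto
      also have "\<dots> \<le> c0 * (1/2) ^ N * (\<Sum>k\<in>A. 1 - cos (real k * t))"
        unfolding \<kappa>2_def using False t c0_pos \<kappa>(2)[OF A, of t] by simp
      also have "\<dots> \<le> (\<Sum>k\<in>A. p k * (1 - r ^ k * cos (real k * t)))"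
        unfolding sum_distrib_left
      proof (rule sum_mono)
        fix k assume k: "k \<in> A"
        have "(1/2) ^ N \<le> (1/2::real) ^ k"
          using k A by (intro power_decreasing) auto
        also have "\<dots> \<le> r ^ k" using r by (intro power_mono) auto
        finally have "(1/2) ^ N * (1 - cos (real k * t)) \<le> r ^ k * (1 - cos (real k * t))"
          by (intro mult_right_mono) auto
        \<comment> \<open>The two sides differ by \<open>1 - r ^ k\<close>.\<close>
        also have "\<dots> \<le> 1 - r ^ k * cos (real k * t)"
          using power_le_one[of r k] r by (simp add: algebra_simps)
        finally have "c0 * ((1/2) ^ N * (1 - cos (real k * t))) \<le> p k * (1 - r ^ k * cos (real k * t))"
          using k c0_pos by (intro mult_mono) (auto simp: A_def intro: mult_nonneg_nonneg)
        then show "c0 * (1/2) ^ N * (1 - cos (real k * t)) \<le> p k * (1 - r ^ k * cos (real k * t))"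
          by (simp add: mult.assoc)
      qed
      also have "\<dots> \<le> norm (1 - pser p ?s)"
        using r \<open>finite A\<close> by (intro norm_one_minus_pser_ge) auto
      finally show ?thesis .
    qed
    moreover have "norm ?s < 1" using r by (simp add: norm_mult)
    then have "norm (pser u ?s) * norm (1 - pser p ?s) = 1"
      by (simp add: pser_u flip: norm_mult)
    ultimately have "norm (pser u ?s) * (min \<kappa>1 \<kappa>2 * z n) \<le> 1"
      by (metis mult_left_mono norm_ge_zero)
    then show "norm (pser u ?s) \<le> 1 / min \<kappa>1 \<kappa>2 / z (nat \<lceil>1 / t\<rceil>)"
      using \<kappa>1 \<kappa>2 zn by (simp add: n_def[symmetric] field_simps)
  qed
qed

text \<open>As \<open>t <= pi < 4\<close>, rounding up gives \<open>1 <= n * t <= 5\<close>, so the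
  tail at \<open>1/t\<close> can be compared with \<open>z l\<close>. Which Potter bound applies
  depends on the order of \<open>l\<close> and \<open>1/t\<close>.\<close>

lemma tail_ceiling_bounds:
  assumes p: "p \<in> S" and t: "0 < t" "t \<le> pi" and l: "1 \<le> l"
  defines "n \<equiv> nat \<lceil>1 / t\<rceil>"
  shows "real l * t \<ge> 1 \<Longrightarrow> (real l * t) powr \<beta> * renewal.z p l \<le> 5 * K * renewal.z p n"
    and "real l * t \<le> 1 \<Longrightarrow> (real l * t) powr \<gamma> * renewal.z p l \<le> 5 * K * renewal.z p n"
    and "real n \<le> 5 / t" "1 \<le> n"
proof -
  interpret renewal p using p by (rule renewal)
  have n1: "1 / t \<le> real n" unfolding n_def by linarith
  have "real n \<le> 1 / t + 1" using t unfolding n_def by (simp add: of_nat_nat)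
  also have "\<dots> \<le> 1 / t + 4 / t"
  proof (rule add_left_mono)
    show "1 \<le> 4 / t" using t pi_less_4 by (simp add: le_divide_eq)
  qed
  also have "\<dots> = 5 / t" by simp
  finally show n5: "real n \<le> 5 / t" .
  have "0 < 1 / t" using t by simp
  with n1 show "1 \<le> n" by linarith
  note n = this
  have nt: "1 \<le> real n * t" "real n * t \<le> 5"
    using n1 n5 t by (auto simp: field_simps)
  show "(real l * t) powr \<beta> * z l \<le> 5 * K * z n" if lt: "real l * t \<ge> 1"
  proof -
    have "1 / t \<le> real l" using lt t by (simp add: field_simps)
    then have "n \<le> l" unfolding n_def by linarith
    have "(real l * t) powr \<beta> = (real l / real n) powr \<beta> * (real n * t) powr \<beta>"
      using n t by (simp flip: powr_mult)
    also have "\<dots> \<le> (real l / real n) powr \<beta> * (5 powr 1)"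
    proof (intro mult_left_mono)
      have "(real n * t) powr \<beta> \<le> 5 powr \<beta>"
        using nt exponents by (intro powr_mono2) auto
      also have "\<dots> \<le> 5 powr 1" using exponents by (intro powr_mono) auto
      finally show "(real n * t) powr \<beta> \<le> 5 powr 1" .
    qed simp
    finally have "(real l * t) powr \<beta> * z l \<le> (real l / real n) powr \<beta> * (5 powr 1) * z l"
      using z_nonneg by (intro mult_right_mono) auto
    also have "\<dots> = 5 * (z l * (real l / real n) powr \<beta>)" by simp
    also have "\<dots> \<le> 5 * (K * z n)"
      using tail_lower[OF p n \<open>n \<le> l\<close>] by simp
    finally show ?thesis by simp
  qed
  show "(real l * t) powr \<gamma> * z l \<le> 5 * K * z n" if lt: "real l * t \<le> 1"
  proof -
    have "real l \<le> 1 / t" using lt t by (simp add: field_simps)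
    then have "l \<le> n" using n1 by linarith
    have "(real l * t) powr \<gamma> * z l \<le> (real l * t) powr \<gamma> * (K * (real n / real l) powr \<gamma> * z n)"
      by (intro mult_left_mono tail_upper p l \<open>l \<le> n\<close>) simp
    also have "\<dots> = (real n * t) powr \<gamma> * (K * z n)"
      using l t n by (simp add: powr_mult powr_divide)
    also have "\<dots> \<le> 5 powr 1 * (K * z n)"
    proof (intro mult_right_mono)
      have "(real n * t) powr \<gamma> \<le> 5 powr \<gamma>"
        using nt exponents by (intro powr_mono2) auto
      also have "\<dots> \<le> 5 powr 1" using exponents by (intro powr_mono) auto
      finally show "(real n * t) powr \<gamma> \<le> 5 powr 1" .
    qed (use K_ge_1 z_nonneg in auto)
    finally show ?thesis by simp
  qed
qed

end

lemma integral_split_le: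
  fixes \<phi> :: "real \<Rightarrow> real"
  assumes "continuous_on UNIV \<phi>" "a \<le> b" "b \<le> c"
    and "integral {a..b} \<phi> \<le> x" "integral {b..c} \<phi> \<le> y"
  shows "integral {a..c} \<phi> \<le> x + y"
proof -
  have "continuous_on A \<phi>" for A
    using assms(1) continuous_on_subset by blast
  then have "integral {a..b} \<phi> + integral {b..c} \<phi> = integral {a..c} \<phi>"
    using assms by (intro Henstock_Kurzweil_Integration.integral_combine integrable_continuous_interval) auto
  with assms show ?thesis by linarith
qed

section \<open>Uniform bounds on the series of \<open>n u_n\<close> and on the renewal
  sequence\<close>

context renewal_class
begin

text \<open>The reference index \<open>l\<close> is free, and will be either the time index or the
  size of the increment. The exponent switches at \<open>l t = 1\<close> because
  \<open>\<beta>\<close> controls the tails up to \<open>l\<close> and \<open>\<gamma>\<close> those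
  beyond it.\<close>

lemma norm_pser_u_le_powr:
  obtains C where "C > 0"
    "\<And>p r t l. p \<in> S \<Longrightarrow> 1 / 2 \<le> r \<Longrightarrow> r < 1 \<Longrightarrow> 0 < t \<Longrightarrow> t \<le> pi \<Longrightarrow> 1 \<le> l \<Longrightarrow>
      norm (pser (renewal_seq p) (of_real r * cis t)) \<le>
        C / renewal.z p l * (real l * t) powr (- (if 1 \<le> real l * t then \<beta> else \<gamma>))"
proof -
  obtain C where C: "C > 0"
    "\<And>p r t. p \<in> S \<Longrightarrow> 1 / 2 \<le> r \<Longrightarrow> r < 1 \<Longrightarrow> 0 < t \<Longrightarrow> t \<le> pi \<Longrightarrow>
      norm (pser (renewal_seq p) (of_real r * cis t)) \<le> C / renewal.z p (nat \<lceil>1 / t\<rceil>)"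
    using norm_pser_u_le_tail by blast
  have aux: "x \<le> C * (5 * K) / Z * y powr (- \<delta>)"
    if "x \<le> C / Zn" "y powr \<delta> * Z \<le> 5 * K * Zn" "0 < Z" "0 < Zn" "0 < y" for x y \<delta> Z Zn
  proof -
    have "1 / Zn \<le> 5 * K / (y powr \<delta> * Z)"
      using that by (simp add: field_simps)
    then have "C * (1 / Zn) \<le> C * (5 * K / (y powr \<delta> * Z))"
      using C by (intro mult_left_mono) auto
    also have "\<dots> = C * (5 * K) / Z * y powr (- \<delta>)"
      by (simp add: powr_minus divide_inverse mult_ac)
    finally show ?thesis
      using that(1) by simp
  qed
  show ?thesis
  proof
    show "C * (5 * K) > 0" using C K_ge_1 by simp
    fix p and r t :: real and l :: nat
    assume a: "p \<in> S" "1 / 2 \<le> r" "r < 1" "0 < t" "t \<le> pi" "1 \<le> l"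
    have y: "0 < real l * t" using a by simp
    show "norm (pser (renewal_seq p) (of_real r * cis t)) \<le>
        C * (5 * K) / renewal.z p l * (real l * t) powr (- (if 1 \<le> real l * t then \<beta> else \<gamma>))"
      using tail_ceiling_bounds(1,2)[OF a(1,4,5,6)]
      by (intro aux[OF C(2)[OF a(1-5)] _ tail_pos[OF a(1)] tail_pos[OF a(1)] y]) auto
  qed
qed

lemma norm_bser_eq:
  fixes t :: real
  assumes p: "p \<in> S" and "m \<ge> 1"
  defines "s \<equiv> of_real (damping m) * cis t"
  shows "norm (renewal.bser p m t) = norm (pser (\<lambda>n. real n * p n) s) * (norm (pser (renewal_seq p) s))\<^sup>2"
proof -
  interpret renewal p using p by (rule renewal)
  have "norm s < 1"
    using damping_bounds[of m] assms by (simp add: s_def norm_mult)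
  then show ?thesis
    unfolding bser_def s_def[symmetric] by (simp add: pser_nu norm_mult norm_power)
qed

lemma norm_pser_np_le_tail:
  obtains C where "C > 0"
    "\<And>p m t. p \<in> S \<Longrightarrow> 1 \<le> m \<Longrightarrow>
      norm (pser (\<lambda>n. real n * p n) (of_real (damping m) * cis t)) \<le> C * (real m * renewal.z p m)"
proof -
  obtain C where C: "C > 0"
    "\<And>p n. p \<in> S \<Longrightarrow> 1 \<le> n \<Longrightarrow> (\<Sum>i\<le>n. renewal.z p i) \<le> C * (real n * renewal.z p n)"
    using sum_tail_le by blast
  show ?thesis
  proof
    fix p and m :: nat and t :: real assume a: "p \<in> S" "1 \<le> m"
    interpret renewal p using a by (intro renewal)
    have "norm (pser (\<lambda>n. real n * p n) (of_real (damping m) * cis t)) \<le> (\<Sum>i<m. z i)"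
      by (rule norm_pser_np_le) fact
    also have "\<dots> \<le> (\<Sum>i\<le>m. z i)"
      by (intro sum_mono2 z_nonneg) auto
    also have "\<dots> \<le> C * (real m * z m)" by (rule C(2)[OF a])
    finally show "norm (pser (\<lambda>n. real n * p n) (of_real (damping m) * cis t)) \<le> C * (real m * z m)" .
  qed fact
qed

text \<open>Meant for \<open>t\<close> up to \<open>1/m\<close>: the numerator bound
  \<open>m z m\<close> times \<open>(2 / z m)^2\<close>.\<close>

lemma norm_bser_near:
  obtains C where "C > 0"
    "\<And>p m t. p \<in> S \<Longrightarrow> 1 \<le> m \<Longrightarrow> norm (renewal.bser p m t) \<le> C * (real m / renewal.z p m)"
proof -
  obtain C where C: "C > 0"
    "\<And>p m t. p \<in> S \<Longrightarrow> 1 \<le> m \<Longrightarrow>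
      norm (pser (\<lambda>n. real n * p n) (of_real (damping m) * cis t)) \<le> C * (real m * renewal.z p m)"
    using norm_pser_np_le_tail by blast
  show ?thesis
  proof
    show "C * 4 > 0" using C by simp
    fix p and m :: nat and t :: real assume a: "p \<in> S" "1 \<le> m"
    interpret renewal p using a by (intro renewal)
    have "norm (bser m t) \<le> (C * (real m * z m)) * (2 / z m)\<^sup>2"
      unfolding norm_bser_eq[OF a] using C a tail_pos[OF a(1)]
      by (intro mult_mono power_mono norm_pser_u_near) (auto intro!: mult_nonneg_nonneg simp: less_imp_le)
    also have "\<dots> = C * 4 * (real m / z m)"
      using tail_pos[OF a(1), of m] by (simp add: power2_eq_square)
    finally show "norm (bser m t) \<le> C * 4 * (real m / z m)" .
  qed
qed

text \<open>As \<open>\<gamma> < 1\<close>, the sequence \<open>n z n\<close> is increasing up to a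
  constant factor.\<close>

lemma scale_tail_mono:
  assumes "p \<in> S" "1 \<le> l" "l \<le> n"
  shows "real l * renewal.z p l \<le> K * (real n * renewal.z p n)"
proof -
  have "real l * renewal.z p l \<le> real l * (K * (real n / real l) powr \<gamma> * renewal.z p n)"
    using tail_upper[OF assms] by (intro mult_left_mono) auto
  also have "\<dots> \<le> real l * (K * (real n / real l) powr 1 * renewal.z p n)"
    using assms exponents K_ge_1 tail_pos[OF assms(1), of n]
    by (intro mult_left_mono mult_right_mono powr_mono) auto
  also have "\<dots> = K * (real n * renewal.z p n)"
    using assms by simp
  finally show ?thesis .
qed

text \<open>Below \<open>1/m\<close> the bound of \<open>norm_bser_near\<close> is multiplied by the
  length \<open>1/m\<close>; above it the hypothesis is integrable as \<open>\<sigma> > 1\<close>.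
  Both give a multiple of \<open>1 / z m\<close>. The two cases enter with
  \<open>\<sigma> = 2 \<beta>\<close> and \<open>\<sigma> = 1 + \<beta>\<close>.\<close>

lemma u_le_if_bser_le:
  assumes "A \<ge> 0" "\<sigma> > 1"
    and far: "\<And>p m t. p \<in> S \<Longrightarrow> 1 \<le> m \<Longrightarrow> 1 / real m \<le> t \<Longrightarrow> t \<le> pi \<Longrightarrow>
      norm (renewal.bser p m t) \<le> A * (real m / renewal.z p m) * (real m * t) powr (- \<sigma>)"
  obtains C where "C > 0"
    "\<And>p m. p \<in> S \<Longrightarrow> 1 \<le> m \<Longrightarrow> real m * renewal_seq p m \<le> C / renewal.z p m"
proof -
  obtain B where B: "B > 0"
    "\<And>p m t. p \<in> S \<Longrightarrow> 1 \<le> m \<Longrightarrow> norm (renewal.bser p m t) \<le> B * (real m / renewal.z p m)"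
    using norm_bser_near by blast
  show ?thesis
  proof
    show "9 * (B + A / (\<sigma> - 1)) > 0" using B assms by (simp add: add_pos_nonneg)
    fix p and m :: nat assume p: "p \<in> S" and m: "1 \<le> m"
    interpret renewal p using p by (rule renewal)
    have zm: "z m > 0" by (rule tail_pos[OF p])
    have cont: "continuous_on T (\<lambda>t. norm (bser m t))" for T
      by (intro continuous_intros continuous_bser m)
    have "1 / real m \<le> 1" using m by simp
    then have pi: "1 / real m \<le> pi" using pi_gt3 by linarith
    have "integral {0..pi} (\<lambda>t. norm (bser m t)) \<le>
        B * (real m / z m) * (1 / real m) / (1 - 0) + A * (real m / z m) * (1 / real m) / (\<sigma> - 1)"
    proof (rule integral_split_le[OF cont _ pi])
      show "integral {0..1 / real m} (\<lambda>t. norm (bser m t)) \<le> B * (real m / z m) * (1 / real m) / (1 - 0)"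
        using m B(2)[OF p m] cont by (intro integral_le_powr_head) auto
      show "integral {1 / real m..pi} (\<lambda>t. norm (bser m t)) \<le> A * (real m / z m) * (1 / real m) / (\<sigma> - 1)"
        using far[OF p m] assms pi m zm cont
        by (intro integral_le_powr_tail) (auto simp: mult.commute)
    qed simp
    also have "\<dots> = (B + A / (\<sigma> - 1)) / z m"
      using m zm assms by (simp add: field_simps)
    finally show "real m * u m \<le> 9 * (B + A / (\<sigma> - 1)) / z m"
      using u_le_integral_bser[OF m] by (simp only: times_divide_eq_right[symmetric])
  qed
qed

text \<open>Treats the correction term left by \<open>u_diff_le\<close>. Since
  \<open>n + l <= 2 n\<close>, going back from \<open>n + l\<close> to \<open>n\<close> costs a
  constant.\<close>

lemma shifted_u_le:
  assumes "C > 0" and u: "\<And>p m. p \<in> S \<Longrightarrow> 1 \<le> m \<Longrightarrow> real m * renewal_seq p m \<le> C / renewal.z p m"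
    and p: "p \<in> S" and l: "1 \<le> l" "l \<le> n"
  shows "real l * renewal_seq p (n + l) \<le> 2 * K * C * (real l / (real n * renewal.z p n))"
proof -
  interpret renewal p using p by (rule renewal)
  have pos: "z n > 0" "z (n + l) > 0" by (rule tail_pos[OF p])+
  have n: "1 \<le> n" using l by simp
  have "z n \<le> K * (real (n + l) / real n) powr \<gamma> * z (n + l)"
    using l by (intro tail_upper p) auto
  also have "(real (n + l) / real n) powr \<gamma> \<le> 2 powr 1"
  proof -
    have "real (n + l) / real n \<le> 2" using l by (simp add: field_simps)
    then have "(real (n + l) / real n) powr \<gamma> \<le> 2 powr \<gamma>"
      using exponents by (intro powr_mono2) auto
    also have "\<dots> \<le> 2 powr 1" using exponents by (intro powr_mono) auto
    finally show ?thesis .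
  qed
  finally have zn: "z n \<le> 2 * K * z (n + l)"
    using K_ge_1 pos by (simp add: mult_left_mono mult_right_mono mult_ac)
  have "real n * u (n + l) \<le> real (n + l) * u (n + l)"
    by (intro mult_right_mono u_nonneg) auto
  also have "\<dots> \<le> C / z (n + l)"
    using n by (intro u p) auto
  also have "\<dots> \<le> 2 * K * C / z n"
    using zn pos \<open>C > 0\<close> by (simp add: field_simps mult_left_mono)
  finally have "real n * u (n + l) \<le> 2 * K * C / z n" .
  then have "u (n + l) \<le> 2 * K * C / (real n * z n)"
    using n pos by (simp add: field_simps)
  then have "real l * u (n + l) \<le> real l * (2 * K * C / (real n * z n))"
    by (intro mult_left_mono) auto
  then show ?thesis by (simp add: mult_ac)
qed

end

section \<open>The case of index above 1/2\<close>

locale renewal_class_large = renewal_class +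
  assumes beta_large: "1 / 2 < \<beta>"
begin

lemma strong_renewal:
  obtains C where "C > 0"
    "\<And>p m. p \<in> S \<Longrightarrow> 1 \<le> m \<Longrightarrow> real m * renewal_seq p m \<le> C / renewal.z p m"
proof -
  obtain Q where Q: "Q > 0"
    "\<And>p m t. p \<in> S \<Longrightarrow> 1 \<le> m \<Longrightarrow>
      norm (pser (\<lambda>n. real n * p n) (of_real (damping m) * cis t)) \<le> Q * (real m * renewal.z p m)"
    using norm_pser_np_le_tail by blast
  obtain C where C: "C > 0"
    "\<And>p r t l. p \<in> S \<Longrightarrow> 1 / 2 \<le> r \<Longrightarrow> r < 1 \<Longrightarrow> 0 < t \<Longrightarrow> t \<le> pi \<Longrightarrow> 1 \<le> l \<Longrightarrow>
      norm (pser (renewal_seq p) (of_real r * cis t)) \<le>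
        C / renewal.z p l * (real l * t) powr (- (if 1 \<le> real l * t then \<beta> else \<gamma>))"
    using norm_pser_u_le_powr by blast
  show ?thesis
  proof (rule u_le_if_bser_le[of "Q * C\<^sup>2" "2 * \<beta>"])
    show "0 \<le> Q * C\<^sup>2" using Q by simp
    show "1 < 2 * \<beta>" using beta_large by simp
    fix p and m :: nat and t :: real
    assume a: "p \<in> S" "1 \<le> m" "1 / real m \<le> t" "t \<le> pi"
    have t: "0 < t" by (rule less_le_trans[OF _ a(3)]) (use a in simp)
    have mt: "1 \<le> real m * t" using a by (simp add: field_simps)
    have zm: "renewal.z p m > 0" by (rule tail_pos[OF a(1)])
    have "norm (renewal.bser p m t) \<le> Q * (real m * renewal.z p m) * (C / renewal.z p m * (real m * t) powr (- \<beta>))\<^sup>2"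
      unfolding norm_bser_eq[OF a(1,2)]
      using a t mt zm Q damping_bounds[OF a(2)] C(2)[OF a(1) _ _ t a(4,2), of "damping m"]
      by (intro mult_mono power_mono Q) auto
    also have "\<dots> = Q * C\<^sup>2 * (real m / renewal.z p m) * (real m * t) powr (- (2 * \<beta>))"
    proof -
      have "((real m * t) powr (- \<beta>))\<^sup>2 = (real m * t) powr (- (2 * \<beta>))"
        using mt by (simp add: power2_eq_square flip: powr_add)
      then show ?thesis
        using zm by (simp add: power_mult_distrib power_divide) (simp add: power2_eq_square)
    qed
    finally show "norm (renewal.bser p m t) \<le> Q * C\<^sup>2 * (real m / renewal.z p m) * (real m * t) powr (- (2 * \<beta>))" .
  next
    fix C assume "C > 0" "\<And>p m. p \<in> S \<Longrightarrow> 1 \<le> m \<Longrightarrow> real m * renewal_seq p m \<le> C / renewal.z p m"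
    then show thesis by (rule that)
  qed
qed

text \<open>Cutting the integral at \<open>1/l\<close> leaves the powers
  \<open>1 - 2 \<gamma>\<close> and \<open>- 2 \<beta>\<close> of \<open>l t\<close>; each part is a
  multiple of \<open>M / l\<close>.\<close>

lemma u_diff_pointwise:
  obtains C where "C > 0"
    "\<And>p n l. p \<in> S \<Longrightarrow> 1 \<le> l \<Longrightarrow> l \<le> n \<Longrightarrow>
      \<bar>renewal_seq p (n + l) - renewal_seq p n\<bar> \<le> C * (renewal.z p n / (real l * (renewal.z p l)\<^sup>2))"
proof -
  obtain Q where Q: "Q > 0"
    "\<And>p m t. p \<in> S \<Longrightarrow> 1 \<le> m \<Longrightarrow>
      norm (pser (\<lambda>n. real n * p n) (of_real (damping m) * cis t)) \<le> Q * (real m * renewal.z p m)"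
    using norm_pser_np_le_tail by blast
  obtain C where C: "C > 0"
    "\<And>p r t l. p \<in> S \<Longrightarrow> 1 / 2 \<le> r \<Longrightarrow> r < 1 \<Longrightarrow> 0 < t \<Longrightarrow> t \<le> pi \<Longrightarrow> 1 \<le> l \<Longrightarrow>
      norm (pser (renewal_seq p) (of_real r * cis t)) \<le>
        C / renewal.z p l * (real l * t) powr (- (if 1 \<le> real l * t then \<beta> else \<gamma>))"
    using norm_pser_u_le_powr by blast
  obtain D where D: "D > 0"
    "\<And>p m. p \<in> S \<Longrightarrow> 1 \<le> m \<Longrightarrow> real m * renewal_seq p m \<le> D / renewal.z p m"
    using strong_renewal by blast
  define G where "G = 9 * (Q * C\<^sup>2) * (1 / (2 - 2 * \<gamma>) + 2 / (2 * \<beta> - 1)) + 27 * (2 * K * D) * K\<^sup>2"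
  have dens: "2 - 2 * \<gamma> > 0" "2 * \<beta> - 1 > 0" using exponents beta_large by auto
  show ?thesis
  proof
    show "G > 0" unfolding G_def
      using Q C D K_ge_1 dens by (intro add_pos_nonneg mult_pos_pos) (auto intro!: add_pos_pos)
    fix p and n l :: nat assume p: "p \<in> S" and l: "1 \<le> l" "l \<le> n"
    interpret renewal p using p by (rule renewal)
    have n: "1 \<le> n" using l by simp
    have zl: "z l > 0" and zn: "z n > 0" by (rule tail_pos[OF p])+
    \<comment> \<open>The radius belongs to \<open>n\<close>, which fixes the numerator bound
      \<open>Q n z n\<close>; the powers of \<open>t\<close> are normalised at \<open>l\<close>,
      which puts \<open>z l\<close> into the denominator.\<close>
    define M where "M = Q * C\<^sup>2 * (real n * z n / (z l)\<^sup>2)"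
    have M: "M \<ge> 0" using Q zn by (simp add: M_def)
    let ?\<phi> = "\<lambda>t. norm (1 - cis (real l * t)) * norm (bser n t)"
    have cont: "continuous_on T ?\<phi>" for T
      by (intro continuous_intros continuous_bser n)
    have "1 / real l \<le> 1" using l by simp
    then have pi: "1 / real l \<le> pi" using pi_gt3 by linarith
    have bser: "norm (bser n t) \<le> M * (real l * t) powr (- (2 * \<delta>))"
      if t: "0 < t" and "norm (pser u (of_real (damping n) * cis t)) \<le> C / z l * (real l * t) powr (- \<delta>)" for t \<delta>
    proof -
      have "norm (bser n t) \<le> Q * (real n * z n) * (C / z l * (real l * t) powr (- \<delta>))\<^sup>2"
        unfolding norm_bser_eq[OF p n] using that Q(1) zn
        by (intro mult_mono power_mono Q(2) p n) auto
      also have "\<dots> = M * (real l * t) powr (- (2 * \<delta>))"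
      proof -
        have "((real l * t) powr (- \<delta>))\<^sup>2 = (real l * t) powr (- (2 * \<delta>))"
          using l t by (simp add: power2_eq_square flip: powr_add)
        then show ?thesis
          by (simp add: power_mult_distrib power_divide M_def)
      qed
      finally show ?thesis .
    qed
    have "integral {0..pi} ?\<phi> \<le> M * (1 / real l) / (1 - (2 * \<gamma> - 1)) + 2 * M * (1 / real l) / (2 * \<beta> - 1)"
    proof (rule integral_split_le[OF cont _ pi])
      show "integral {0..1 / real l} ?\<phi> \<le> M * (1 / real l) / (1 - (2 * \<gamma> - 1))"
      proof (rule integral_le_powr_head)
        fix t assume t: "0 < t" "t \<le> 1 / real l"
        then have lt: "real l * t \<le> 1" "0 < real l * t" using l by (auto simp: field_simps)
        have "norm (bser n t) \<le> M * (real l * t) powr (- (2 * \<gamma>))"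
          using t pi lt damping_bounds[OF n] C(2)[OF p _ _ t(1) _ l(1), of "damping n"]
          by (intro bser) (auto split: if_splits)
        then have "?\<phi> t \<le> (real l * t) powr 1 * (M * (real l * t) powr (- (2 * \<gamma>)))"
          using norm_one_minus_cis_le(1)[of "real l * t"] t by (intro mult_mono) auto
        also have "\<dots> = M * (t / (1 / real l)) powr (- (2 * \<gamma> - 1))"
          using lt by (simp add: mult.commute powr_diff powr_minus field_simps)
        finally show "?\<phi> t \<le> M * (t / (1 / real l)) powr (- (2 * \<gamma> - 1))" .
      qed (use l exponents cont in auto)
      show "integral {1 / real l..pi} ?\<phi> \<le> 2 * M * (1 / real l) / (2 * \<beta> - 1)"
      proof (rule integral_le_powr_tail)
        fix t assume t: "1 / real l \<le> t" "t \<le> pi"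
        have t0: "0 < t" by (rule less_le_trans[OF _ t(1)]) (use l in simp)
        have lt: "1 \<le> real l * t" using t l by (auto simp: field_simps)
        have "norm (bser n t) \<le> M * (real l * t) powr (- (2 * \<beta>))"
          using t t0 lt damping_bounds[OF n] C(2)[OF p _ _ t0 t(2) l(1), of "damping n"]
          by (intro bser) auto
        then have "?\<phi> t \<le> 2 * (M * (real l * t) powr (- (2 * \<beta>)))"
          using norm_one_minus_cis_le(2)[of "real l * t"] by (intro mult_mono) auto
        then show "?\<phi> t \<le> 2 * M * (t / (1 / real l)) powr (- (2 * \<beta>))"
          by (simp add: mult.commute)
      qed (use l cont pi M beta_large in auto)
    qed simp
    also have "\<dots> = M / real l * (1 / (2 - 2 * \<gamma>) + 2 / (2 * \<beta> - 1))"
      by (simp add: algebra_simps)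
    finally have int: "integral {0..pi} ?\<phi> \<le> M / real l * (1 / (2 - 2 * \<gamma>) + 2 / (2 * \<beta> - 1))" .
    define X where "X = z n / (real l * (z l)\<^sup>2)"
    have Ml: "M / real l = Q * C\<^sup>2 * (real n * X)"
      using l by (simp add: M_def X_def field_simps)
    have "real l * u (n + l) \<le> 2 * K * D * (real l / (real n * z n))"
      by (rule shifted_u_le[OF D p l])
    \<comment> \<open>The square of \<open>l z l <= K n z n\<close> shows that the correction is of
      no larger order than the main term \<open>n X\<close>.\<close>
    also have "real l / (real n * z n) \<le> K\<^sup>2 * (real n * X)"
    proof -
      have "(real l * z l)\<^sup>2 \<le> (K * (real n * z n))\<^sup>2"
        using scale_tail_mono[OF p l] zl by (intro power_mono) auto
      then have "real l * (real l * (z l)\<^sup>2) \<le> K\<^sup>2 * (real n * z n) * (real n * z n)"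
        by (simp add: power2_eq_square mult_ac)
      then have "real l / (real n * z n) \<le> K\<^sup>2 * (real n * z n) / (real l * (z l)\<^sup>2)"
        using l n zl zn by (simp add: divide_le_eq le_divide_eq)
      then show ?thesis by (simp add: X_def)
    qed
    finally have third: "real l * u (n + l) \<le> 2 * K * D * (K\<^sup>2 * (real n * X))"
      using K_ge_1 D by (simp add: mult_left_mono)
    have "real n * \<bar>u (n + l) - u n\<bar> \<le> 9 * integral {0..pi} ?\<phi> + 27 * real l * u (n + l)"
      by (rule u_diff_le_integral) fact
    also have "\<dots> \<le> 9 * (M / real l * (1 / (2 - 2 * \<gamma>) + 2 / (2 * \<beta> - 1))) +
        27 * (2 * K * D * (K\<^sup>2 * (real n * X)))"
      using int third by simp
    also have "\<dots> = real n * (G * X)"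
      unfolding Ml G_def by (simp only: distrib_left distrib_right mult_ac)
    finally show "\<bar>u (n + l) - u n\<bar> \<le> G * (z n / (real l * (z l)\<^sup>2))"
      unfolding X_def[symmetric] using n by (simp only: mult_le_cancel_left_pos of_nat_0_less_iff)
  qed
qed

end

subsection \<open>The smooth case\<close>

text \<open>Summation by parts: the weight \<open>k\<close> is \<open>n\<close> plus the number of
  \<open>i\<close> with \<open>n <= i < k\<close>.\<close>

lemma sum_weighted_eq:
  fixes d :: "nat \<Rightarrow> real"
  assumes "n \<le> M"
  shows "(\<Sum>k\<in>{n<..M}. real k * d k) = real n * (\<Sum>k\<in>{n<..M}. d k) + (\<Sum>i\<in>{n..<M}. \<Sum>k\<in>{i<..M}. d k)"
  using assms
proof (induction M rule: dec_induct)
  case (step M)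
  have split: "(\<Sum>k\<in>{i<..Suc M}. f k) = (\<Sum>k\<in>{i<..M}. f k) + f (Suc M)" if "i \<le> M" for i and f :: "nat \<Rightarrow> real"
  proof -
    have "{i<..Suc M} = insert (Suc M) {i<..M}" using that by auto
    then show ?thesis by simp
  qed
  have "(\<Sum>i\<in>{n..<Suc M}. \<Sum>k\<in>{i<..Suc M}. d k) = (\<Sum>i\<in>{n..<Suc M}. (\<Sum>k\<in>{i<..M}. d k) + d (Suc M))"
    by (intro sum.cong split) auto
  also have "\<dots> = (\<Sum>i\<in>{n..<M}. \<Sum>k\<in>{i<..M}. d k) + real (Suc M - n) * d (Suc M)"
    using step by (simp add: sum.distrib)
  finally show ?case
    using step by (simp add: split of_nat_diff algebra_simps)
qed simp

text \<open>Multiplication by \<open>1 - s\<close> turns the sum into one over increments of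
  \<open>a\<close>, plus boundary terms. The 2 comes from bounding the last boundary term by the
  same quantity.\<close>

lemma Abel_summation_bound:
  fixes a :: "nat \<Rightarrow> real" and s :: complex
  assumes s: "norm s \<le> 1" and "n < M"
  shows "norm ((1 - s) * (\<Sum>k\<in>{n<..M}. of_real (a k) * s ^ k)) \<le>
    2 * (\<bar>a (Suc n)\<bar> + (\<Sum>k\<in>{n<..<M}. \<bar>a (Suc k) - a k\<bar>))"
proof -
  define V where "V = (\<lambda>M. \<Sum>k\<in>{n<..<M}. \<bar>a (Suc k) - a k\<bar>)"
  \<comment> \<open>With the boundary term included, passing from \<open>M\<close> to
    \<open>Suc M\<close> adds exactly \<open>(a (Suc M) - a M) * s ^ Suc M\<close>. The bound on
    \<open>a M\<close> is carried along to remove that boundary term afterwards.\<close>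
  have main: "norm ((1 - s) * (\<Sum>k\<in>{n<..M}. of_real (a k) * s ^ k) + of_real (a M) * s ^ Suc M) \<le> \<bar>a (Suc n)\<bar> + V M \<and>
      \<bar>a M\<bar> \<le> \<bar>a (Suc n)\<bar> + V M"
    using \<open>n < M\<close>[THEN Suc_leI]
  proof (induction M rule: dec_induct)
    case base
    have "{n<..Suc n} = {Suc n}" "{n<..<Suc n} = {}" by auto
    moreover have "norm (of_real (a (Suc n)) * s ^ Suc n) \<le> \<bar>a (Suc n)\<bar>"
      using s mult_left_le[of "norm (s ^ Suc n)" "\<bar>a (Suc n)\<bar>"]
      by (simp add: norm_mult norm_power power_le_one mult_le_one del: power_Suc)
    ultimately show ?case
      by (simp add: V_def algebra_simps)
  next
    case (step M)
    have sets: "{n<..Suc M} = insert (Suc M) {n<..M}" "{n<..<Suc M} = insert M {n<..<M}"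
      using step by auto
    have V: "V (Suc M) = V M + \<bar>a (Suc M) - a M\<bar>"
      unfolding V_def sets by simp
    have "(1 - s) * (\<Sum>k\<in>{n<..Suc M}. of_real (a k) * s ^ k) + of_real (a (Suc M)) * s ^ Suc (Suc M) =
        ((1 - s) * (\<Sum>k\<in>{n<..M}. of_real (a k) * s ^ k) + of_real (a M) * s ^ Suc M) +
        of_real (a (Suc M) - a M) * s ^ Suc M"
      unfolding sets by (simp add: algebra_simps)
    also have "norm \<dots> \<le> (\<bar>a (Suc n)\<bar> + V M) + \<bar>a (Suc M) - a M\<bar>"
    proof (rule norm_triangle_mono)
      show "norm (of_real (a (Suc M) - a M) * s ^ Suc M) \<le> \<bar>a (Suc M) - a M\<bar>"
        unfolding norm_mult norm_power norm_of_real
        using s by (intro mult_left_le power_le_one) auto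
    qed (use step in blast)
    finally show ?case
      using step V by auto
  qed
  have "norm ((1 - s) * (\<Sum>k\<in>{n<..M}. of_real (a k) * s ^ k)) \<le>
      norm ((1 - s) * (\<Sum>k\<in>{n<..M}. of_real (a k) * s ^ k) + of_real (a M) * s ^ Suc M) +
      norm (of_real (a M) * s ^ Suc M)"
  proof -
    have "norm x \<le> norm (x + y) + norm y" for x y :: complex
      using norm_triangle_ineq4[of "x + y" y] by simp
    then show ?thesis .
  qed
  also have "norm (of_real (a M) * s ^ Suc M) \<le> \<bar>a M\<bar>"
    unfolding norm_mult norm_power norm_of_real
    using s by (intro mult_left_le power_le_one) auto
  finally show ?thesis
    using main by (simp add: V_def)
qed

text \<open>The hypothesis is put on partial sums, bounded independently of \<open>M\<close>, and in
  terms of \<open>z\<close>; thus only finite sums are handled here.\<close>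

locale renewal_class_smooth = renewal_class +
  assumes smooth: "\<And>p n M. p \<in> S \<Longrightarrow> 1 \<le> n \<Longrightarrow>
    (\<Sum>k\<in>{n<..M}. \<bar>p k - p (Suc k)\<bar>) \<le> K * (renewal.z p n / real n)"
begin

text \<open>Since \<open>p\<close> tends to 0, each value is at most the total variation from there
  on.\<close>

lemma p_le_smooth:
  assumes p: "p \<in> S" and n: "1 \<le> n"
  shows "p (Suc n) \<le> K * (renewal.z p n / real n)"
proof -
  interpret renewal p using p by (rule renewal)
  have "p (Suc n) \<le> K * (z n / real n) + p (Suc M)" if "n \<le> M" for M
  proof -
    have "p (Suc n) - p (Suc M) = (\<Sum>k=Suc n..<Suc M. p k - p (Suc k))"
      using sum_Suc_diff'[of "Suc n" "Suc M" "\<lambda>k. - p k"] that by simp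
    also have "{Suc n..<Suc M} = {n<..M}" by auto
    also have "(\<Sum>k\<in>{n<..M}. p k - p (Suc k)) \<le> (\<Sum>k\<in>{n<..M}. \<bar>p k - p (Suc k)\<bar>)"
      by (intro sum_mono) auto
    also have "\<dots> \<le> K * (z n / real n)" by (rule smooth[OF p n])
    finally show ?thesis by simp
  qed
  moreover have "(\<lambda>M. p (Suc M)) \<longlonglongrightarrow> 0"
    using LIMSEQ_Suc[OF summable_LIMSEQ_zero[OF sums_summable[OF p_sums]]] .
  then have "(\<lambda>M. K * (z n / real n) + p (Suc M)) \<longlonglongrightarrow> K * (z n / real n) + 0"
    by (intro tendsto_intros)
  ultimately show ?thesis
    using LIMSEQ_le_const[of "\<lambda>M. K * (z n / real n) + p (Suc M)" "K * (z n / real n) + 0" "p (Suc n)"]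
    by auto
qed

text \<open>Summation by parts reduces the weighted sum to the unweighted variations. The resulting
  sum of \<open>z i / i\<close> is of order \<open>z n\<close>, as \<open>\<beta> > 0\<close> gives
  a summable power.\<close>

lemma weighted_variation_le:
  assumes p: "p \<in> S" and n: "1 \<le> n" and M: "n \<le> M"
  shows "(\<Sum>k\<in>{n<..M}. real k * \<bar>p k - p (Suc k)\<bar>) \<le> (K + K * (1 + K / \<beta>)) * renewal.z p n"
proof -
  interpret renewal p using p by (rule renewal)
  let ?d = "\<lambda>k. \<bar>p k - p (Suc k)\<bar>"
  have zn: "z n > 0" by (rule tail_pos[OF p])
  have "(\<Sum>i\<in>{n..<M}. \<Sum>k\<in>{i<..M}. ?d k) \<le> (\<Sum>i\<in>{n..<M}. K * (z i / real i))"
    using n by (intro sum_mono smooth p) auto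
  \<comment> \<open>The term \<open>i = n\<close> is split off because
    \<open>sum_powr_tail_le\<close> starts at \<open>Suc n\<close>.\<close>
  also have "\<dots> \<le> (\<Sum>i\<in>insert n {Suc n..M}. K * (z i / real i))"
    using K_ge_1 z_nonneg by (intro sum_mono2) auto
  also have "\<dots> = K * (z n / real n) + (\<Sum>i=Suc n..M. K * (z i / real i))"
    by simp
  also have "\<dots> \<le> K * z n + (\<Sum>i=Suc n..M. K * (K * z n * real n powr \<beta> * real i powr (- 1 - \<beta>)))"
  proof (intro add_mono sum_mono mult_left_mono)
    show "z n / real n \<le> z n" using n zn by (simp add: field_simps)
    fix i assume i: "i \<in> {Suc n..M}"
    have "z i * (real i / real n) powr \<beta> \<le> K * z n"
      using i n by (intro tail_lower p) auto
    moreover have "0 < (real i / real n) powr \<beta>" using i n by simp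
    ultimately have "z i \<le> K * z n / (real i / real n) powr \<beta>"
      by (simp add: pos_le_divide_eq)
    then have "z i / real i \<le> K * z n / (real i / real n) powr \<beta> / real i"
      by (intro divide_right_mono) auto
    also have "\<dots> = K * z n * real n powr \<beta> * real i powr (- 1 - \<beta>)"
    proof -
      have "real i powr (- 1 - \<beta>) = inverse (real i) * inverse (real i powr \<beta>)"
        using i by (simp add: powr_diff powr_minus divide_inverse)
      moreover have "(real i / real n) powr \<beta> = real i powr \<beta> / real n powr \<beta>"
        by (rule powr_divide)
      ultimately show ?thesis
        by (simp only: divide_inverse inverse_mult_distrib inverse_inverse_eq mult_ac)
    qed
    finally show "z i / real i \<le> K * z n * real n powr \<beta> * real i powr (- 1 - \<beta>)" .
  qed (use K_ge_1 in auto)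
  also have "(\<Sum>i=Suc n..M. K * (K * z n * real n powr \<beta> * real i powr (- 1 - \<beta>))) =
      K * (K * z n * real n powr \<beta>) * (\<Sum>i=Suc n..M. real i powr (- 1 - \<beta>))"
    by (simp add: sum_distrib_left mult_ac)
  also have "\<dots> \<le> K * (K * z n * real n powr \<beta>) * (real n powr (- \<beta>) / \<beta>)"
    using K_ge_1 zn exponents n by (intro mult_left_mono sum_powr_tail_le) auto
  also have "\<dots> = K * (K * z n / \<beta>)"
    using n by (simp add: powr_minus)
  finally have 1: "(\<Sum>i\<in>{n..<M}. \<Sum>k\<in>{i<..M}. ?d k) \<le> K * z n + K * (K * z n / \<beta>)"
    by simp
  have "real n * (\<Sum>k\<in>{n<..M}. ?d k) \<le> real n * (K * (z n / real n))"
    using smooth[OF p n] by (intro mult_left_mono) auto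
  then have 2: "real n * (\<Sum>k\<in>{n<..M}. ?d k) \<le> K * z n"
    using n by simp
  have "(\<Sum>k\<in>{n<..M}. real k * ?d k) \<le> K * z n + (K * z n + K * (K * z n / \<beta>))"
    unfolding sum_weighted_eq[OF M] by (rule add_mono[OF 2 1])
  also have "\<dots> = (K + K * (1 + K / \<beta>)) * z n"
    by (simp add: algebra_simps)
  finally show ?thesis .
qed

text \<open>Cut at \<open>n\<close> about \<open>1/t\<close>: up to \<open>n\<close> absolute values
  are summed, beyond \<open>n\<close> Abel summation applies and division by
  \<open>norm (1 - s) >= t / pi\<close> costs a factor of order \<open>n\<close>. The bound does not
  depend on the radius.\<close>

lemma norm_pser_np_le_smooth:
  obtains C where "C > 0"
    "\<And>p r t. p \<in> S \<Longrightarrow> 1 / 2 \<le> r \<Longrightarrow> r < 1 \<Longrightarrow> 0 < t \<Longrightarrow> t \<le> pi \<Longrightarrow>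
      norm (pser (\<lambda>n. real n * p n) (of_real r * cis t)) \<le>
        C * (real (nat \<lceil>1 / t\<rceil>) * renewal.z p (nat \<lceil>1 / t\<rceil>))"
proof -
  obtain C where C: "C > 0"
    "\<And>p n. p \<in> S \<Longrightarrow> 1 \<le> n \<Longrightarrow> (\<Sum>i\<le>n. renewal.z p i) \<le> C * (real n * renewal.z p n)"
    using sum_tail_le by blast
  define W where "W = K + K * (1 + K / \<beta>)"
  have W: "W > 0" unfolding W_def using K_ge_1 exponents by (intro add_pos_pos mult_pos_pos) auto
  show ?thesis
  proof
    show "C + 2 * pi * (2 * K + (W + 1)) > 0"
      using C W K_ge_1 by (intro add_pos_nonneg) auto
    fix p and r t :: real
    assume p: "p \<in> S" and r: "1 / 2 \<le> r" "r < 1" and t: "0 < t" "t \<le> pi"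
    interpret renewal p using p by (rule renewal)
    define n where "n = nat \<lceil>1 / t\<rceil>"
    have n: "1 \<le> n" using tail_ceiling_bounds(4)[OF p t, of 1] by (simp add: n_def)
    have nt: "1 / t \<le> real n" unfolding n_def by linarith
    let ?s = "complex_of_real r * cis t"
    have s: "norm ?s < 1" using r by (simp add: norm_mult)
    have zn: "z n > 0" by (rule tail_pos[OF p])
    let ?a = "\<lambda>k. real k * p k"
    have head: "norm (\<Sum>k\<le>n. of_real (?a k) * ?s ^ k) \<le> C * (real n * z n)"
    proof -
      have "norm (\<Sum>k\<le>n. of_real (?a k) * ?s ^ k) \<le> (\<Sum>k\<le>n. ?a k)"
      proof (rule sum_norm_le)
        fix k
        have "norm (?s ^ k) \<le> 1" unfolding norm_power using s by (intro power_le_one) auto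
        then show "norm (of_real (?a k) * ?s ^ k) \<le> ?a k"
          unfolding norm_mult norm_of_real using p_nonneg by (simp add: mult_left_le abs_mult)
      qed
      also have "\<dots> = (\<Sum>i<n. z i) - real n * z n"
        by (induction n) (auto simp: p_Suc_eq algebra_simps p_0)
      also have "\<dots> \<le> (\<Sum>i\<le>n. z i)"
      proof -
        have "0 \<le> real n * z n" using zn by simp
        then show ?thesis using zn by (simp only: lessThan_Suc_atMost[symmetric] sum.lessThan_Suc)
      qed
      also have "\<dots> \<le> C * (real n * z n)" by (rule C(2)[OF p n])
      finally show ?thesis .
    qed
    have block: "norm (\<Sum>k\<in>{n<..M}. of_real (?a k) * ?s ^ k) \<le> 2 * pi * (2 * K + (W + 1)) * (real n * z n)"
      if M: "n < M" for M
    proof -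
      have first: "\<bar>?a (Suc n)\<bar> \<le> 2 * K * z n"
      proof -
        have "?a (Suc n) \<le> real (2 * n) * (K * (z n / real n))"
          using n p_nonneg by (intro mult_mono p_le_smooth[OF p n]) auto
        then show ?thesis using n p_nonneg by simp
      qed
      have "(\<Sum>k\<in>{n<..<M}. \<bar>?a (Suc k) - ?a k\<bar>) \<le> (\<Sum>k\<in>{n<..M}. real k * \<bar>p k - p (Suc k)\<bar> + p (Suc k))"
      proof -
        have "(\<Sum>k\<in>{n<..<M}. \<bar>?a (Suc k) - ?a k\<bar>) \<le> (\<Sum>k\<in>{n<..M}. \<bar>?a (Suc k) - ?a k\<bar>)"
          by (intro sum_mono2) auto
        also have "\<dots> \<le> (\<Sum>k\<in>{n<..M}. real k * \<bar>p k - p (Suc k)\<bar> + p (Suc k))"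
        proof (rule sum_mono)
          fix k
          \<comment> \<open>The increment of \<open>k * p k\<close> is a weighted increment of
            \<open>p\<close> plus \<open>p (Suc k)\<close>, and the latter sums to at most
            \<open>z n\<close>.\<close>
          have "?a (Suc k) - ?a k = real k * (p (Suc k) - p k) + p (Suc k)"
            by (simp add: algebra_simps)
          also have "\<bar>\<dots>\<bar> \<le> \<bar>real k * (p (Suc k) - p k)\<bar> + \<bar>p (Suc k)\<bar>"
            by (rule abs_triangle_ineq)
          also have "\<dots> = real k * \<bar>p k - p (Suc k)\<bar> + p (Suc k)"
            using p_nonneg by (simp add: abs_mult abs_minus_commute)
          finally show "\<bar>?a (Suc k) - ?a k\<bar> \<le> real k * \<bar>p k - p (Suc k)\<bar> + p (Suc k)" .
        qed
        finally show ?thesis .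
      qed
      also have "\<dots> \<le> W * z n + 1 * z n"
        unfolding sum.distrib
      proof (intro add_mono)
        show "(\<Sum>k\<in>{n<..M}. real k * \<bar>p k - p (Suc k)\<bar>) \<le> W * z n"
          unfolding W_def using M by (intro weighted_variation_le p n) auto
        have "(\<Sum>k\<in>{n<..M}. p (Suc k)) = (\<Sum>k\<in>{n<..M}. z k - z (Suc k))"
          by (simp add: p_Suc_eq)
        also have "\<dots> = (\<Sum>k=Suc n..<Suc M. z k - z (Suc k))"
          by (intro sum.cong) auto
        also have "\<dots> = z (Suc n) - z (Suc M)"
          using sum_Suc_diff'[of "Suc n" "Suc M" "\<lambda>k. - z k"] M by simp
        also have "\<dots> \<le> 1 * z n"
          using z_nonneg[of "Suc M"] z_antimono[of n "Suc n"] by simp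
        finally show "(\<Sum>k\<in>{n<..M}. p (Suc k)) \<le> 1 * z n" .
      qed
      finally have var: "(\<Sum>k\<in>{n<..<M}. \<bar>?a (Suc k) - ?a k\<bar>) \<le> (W + 1) * z n"
        by (simp add: distrib_right)
      have "norm (1 - ?s) * norm (\<Sum>k\<in>{n<..M}. of_real (?a k) * ?s ^ k) \<le>
          2 * (2 * K * z n + (W + 1) * z n)"
        unfolding norm_mult[symmetric]
        by (rule order_trans[OF Abel_summation_bound[OF less_imp_le[OF s] M]])
          (intro mult_left_mono add_mono first var, simp)
      moreover have "t / pi * norm (\<Sum>k\<in>{n<..M}. of_real (?a k) * ?s ^ k) \<le>
          norm (1 - ?s) * norm (\<Sum>k\<in>{n<..M}. of_real (?a k) * ?s ^ k)"
        using r t by (intro mult_right_mono norm_one_minus_polar_ge) auto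
      ultimately have "t / pi * norm (\<Sum>k\<in>{n<..M}. of_real (?a k) * ?s ^ k) \<le> 2 * (2 * K + (W + 1)) * z n"
        by (simp add: algebra_simps)
      then have "norm (\<Sum>k\<in>{n<..M}. of_real (?a k) * ?s ^ k) \<le> 2 * pi * (2 * K + (W + 1)) * z n * (1 / t)"
        using t by (simp add: pos_le_divide_eq pos_divide_le_eq mult_ac)
      also have "\<dots> \<le> 2 * pi * (2 * K + (W + 1)) * z n * real n"
        using K_ge_1 W zn by (intro mult_left_mono nt) auto
      finally show ?thesis by (simp add: mult_ac)
    qed
    have lim: "(\<lambda>M. \<Sum>k\<le>M. of_real (?a k) * ?s ^ k) \<longlonglongrightarrow> pser ?a ?s"
      unfolding pser_def by (intro summable_LIMSEQ' lingrow_summable s lingrow_seqs)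
    have "norm (pser ?a ?s) \<le> (C + 2 * pi * (2 * K + (W + 1))) * (real n * z n)"
    proof (rule LIMSEQ_le_const2[OF tendsto_norm[OF lim]], intro exI allI impI)
      fix M assume M: "Suc n \<le> M"
      have "{..M} = {..n} \<union> {n<..M}"
        using M by (intro ivl_disj_un_one(3)[symmetric]) auto
      then have "(\<Sum>k\<le>M. of_real (?a k) * ?s ^ k) =
          (\<Sum>k\<le>n. of_real (?a k) * ?s ^ k) + (\<Sum>k\<in>{n<..M}. of_real (?a k) * ?s ^ k)"
        by (simp only:) (rule sum.union_disjoint, auto)
      then have "norm (\<Sum>k\<le>M. of_real (?a k) * ?s ^ k) \<le>
          C * (real n * z n) + 2 * pi * (2 * K + (W + 1)) * (real n * z n)"
        using M by (simp only:) (intro norm_triangle_mono head block, simp)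
      then show "norm (\<Sum>k\<le>M. of_real (?a k) * ?s ^ k) \<le> (C + 2 * pi * (2 * K + (W + 1))) * (real n * z n)"
        by (simp add: distrib_right)
    qed
    then show "norm (pser ?a ?s) \<le> (C + 2 * pi * (2 * K + (W + 1))) *
        (real (nat \<lceil>1 / t\<rceil>) * z (nat \<lceil>1 / t\<rceil>))"
      by (simp add: n_def)
  qed
qed

end

context renewal_class_smooth
begin

text \<open>With \<open>n\<close> about \<open>1/t\<close>, the factors \<open>n z n\<close> and
  \<open>1 / (z n)^2\<close> leave \<open>n / z n\<close>. Neither depends on the radius, so
  \<open>m\<close> is absent from the bound and \<open>l\<close> is arbitrary.\<close>

lemma norm_bser_le_smooth:
  obtains C where "C > 0"
    "\<And>p m l t. p \<in> S \<Longrightarrow> 1 \<le> m \<Longrightarrow> 1 \<le> l \<Longrightarrow> 0 < t \<Longrightarrow> t \<le> pi \<Longrightarrow>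
      norm (renewal.bser p m t) \<le>
        C * (real l / renewal.z p l) * (real l * t) powr (- (1 + (if 1 \<le> real l * t then \<beta> else \<gamma>)))"
proof -
  obtain A where A: "A > 0"
    "\<And>p r t. p \<in> S \<Longrightarrow> 1 / 2 \<le> r \<Longrightarrow> r < 1 \<Longrightarrow> 0 < t \<Longrightarrow> t \<le> pi \<Longrightarrow>
      norm (pser (\<lambda>n. real n * p n) (of_real r * cis t)) \<le>
        A * (real (nat \<lceil>1 / t\<rceil>) * renewal.z p (nat \<lceil>1 / t\<rceil>))"
    using norm_pser_np_le_smooth by blast
  obtain B where B: "B > 0"
    "\<And>p r t. p \<in> S \<Longrightarrow> 1 / 2 \<le> r \<Longrightarrow> r < 1 \<Longrightarrow> 0 < t \<Longrightarrow> t \<le> pi \<Longrightarrow>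
      norm (pser (renewal_seq p) (of_real r * cis t)) \<le> B / renewal.z p (nat \<lceil>1 / t\<rceil>)"
    using norm_pser_u_le_tail by blast
  show ?thesis
  proof
    show "A * B\<^sup>2 * (25 * K) > 0" using A B K_ge_1 by simp
    fix p and m l :: nat and t :: real
    assume p: "p \<in> S" and m: "1 \<le> m" and l: "1 \<le> l" and t: "0 < t" "t \<le> pi"
    interpret renewal p using p by (rule renewal)
    define n where "n = nat \<lceil>1 / t\<rceil>"
    define \<delta> where "\<delta> = (if 1 \<le> real l * t then \<beta> else \<gamma>)"
    have zn: "z n > 0" and zl: "z l > 0" by (rule tail_pos[OF p])+
    have lt: "0 < real l * t" using l t by simp
    have n: "real n \<le> 5 / t"
      using tail_ceiling_bounds(3)[OF p t l] by (simp add: n_def)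
    have tail: "(real l * t) powr \<delta> * z l \<le> 5 * K * z n"
      using tail_ceiling_bounds(1,2)[OF p t l] by (auto simp: n_def \<delta>_def)
    have zinv: "1 / z n \<le> 5 * K / ((real l * t) powr \<delta> * z l)"
    proof -
      have "1 / z n \<le> 5 * K / X" if "X \<le> 5 * K * z n" "0 < X" for X
        using that zn by (simp add: field_simps)
      note * = this[OF tail]
      show ?thesis
        by (rule *) (use zl l t in simp)
    qed
    have d: "1 / 2 \<le> damping m" "damping m < 1" using damping_bounds[OF m] by auto
    have "norm (bser m t) \<le> A * (real n * z n) * (B / z n)\<^sup>2"
      unfolding norm_bser_eq[OF p m] n_def
      using A B d t p tail_pos[OF p] by (intro mult_mono power_mono A(2) B(2)) (auto intro: less_imp_le)
    also have "\<dots> = A * B\<^sup>2 * (real n * (1 / z n))"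
      using zn by (simp add: power_divide power2_eq_square)
    also have "\<dots> \<le> A * B\<^sup>2 * ((5 / t) * (5 * K / ((real l * t) powr \<delta> * z l)))"
      using A B n zinv zn t by (intro mult_left_mono mult_mono) auto
    also have "\<dots> = A * B\<^sup>2 * (25 * K) * (real l / z l) * ((1 / (real l * t)) * (1 / (real l * t) powr \<delta>))"
      using l by (simp add: mult_ac)
    also have "(1 / (real l * t)) * (1 / (real l * t) powr \<delta>) = (real l * t) powr (- (1 + \<delta>))"
      using lt by (simp only: powr_minus_divide powr_add) simp
    finally show "norm (bser m t) \<le> A * B\<^sup>2 * (25 * K) * (real l / z l) *
        (real l * t) powr (- (1 + (if 1 \<le> real l * t then \<beta> else \<gamma>)))"
      by (simp add: \<delta>_def)
  qed
qed

text \<open>Take \<open>l = m\<close> in the preceding bound: \<open>1 + \<beta>\<close> exceeds 1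
  for every positive \<open>\<beta>\<close>, so small \<open>\<alpha>\<close> is covered.\<close>

lemma strong_renewal:
  obtains C where "C > 0"
    "\<And>p m. p \<in> S \<Longrightarrow> 1 \<le> m \<Longrightarrow> real m * renewal_seq p m \<le> C / renewal.z p m"
proof -
  obtain A where A: "A > 0"
    "\<And>p m l t. p \<in> S \<Longrightarrow> 1 \<le> m \<Longrightarrow> 1 \<le> l \<Longrightarrow> 0 < t \<Longrightarrow> t \<le> pi \<Longrightarrow>
      norm (renewal.bser p m t) \<le>
        A * (real l / renewal.z p l) * (real l * t) powr (- (1 + (if 1 \<le> real l * t then \<beta> else \<gamma>)))"
    using norm_bser_le_smooth by blast
  show ?thesis
  proof (rule u_le_if_bser_le[of A "1 + \<beta>"])
    fix p and m :: nat and t :: real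
    assume a: "p \<in> S" "1 \<le> m" "1 / real m \<le> t" "t \<le> pi"
    have t: "0 < t" by (rule less_le_trans[OF _ a(3)]) (use a in simp)
    have mt: "1 \<le> real m * t" using a by (simp add: field_simps)
    show "norm (renewal.bser p m t) \<le> A * (real m / renewal.z p m) * (real m * t) powr (- (1 + \<beta>))"
      using A(2)[OF a(1,2,2) t a(4)] mt by simp
  next
    fix C assume "C > 0" "\<And>p m. p \<in> S \<Longrightarrow> 1 \<le> m \<Longrightarrow> real m * renewal_seq p m \<le> C / renewal.z p m"
    then show thesis by (rule that)
  qed (use A exponents in auto)
qed

text \<open>Below \<open>1/l\<close> one power of \<open>l t\<close> from the increment leaves the
  integrable \<open>(l t) powr (- \<gamma>)\<close>. Summed over \<open>j\<close> from
  \<open>l\<close> to \<open>n\<close> the bound would cost \<open>ln (n / l)\<close>, so it serves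
  only for \<open>j\<close> comparable to \<open>n\<close>.\<close>

lemma u_diff_pointwise:
  obtains C where "C > 0"
    "\<And>p n l. p \<in> S \<Longrightarrow> 1 \<le> l \<Longrightarrow> l \<le> n \<Longrightarrow>
      \<bar>renewal_seq p (n + l) - renewal_seq p n\<bar> \<le> C / (real n * renewal.z p l)"
proof -
  obtain A where A: "A > 0"
    "\<And>p m l t. p \<in> S \<Longrightarrow> 1 \<le> m \<Longrightarrow> 1 \<le> l \<Longrightarrow> 0 < t \<Longrightarrow> t \<le> pi \<Longrightarrow>
      norm (renewal.bser p m t) \<le>
        A * (real l / renewal.z p l) * (real l * t) powr (- (1 + (if 1 \<le> real l * t then \<beta> else \<gamma>)))"
    using norm_bser_le_smooth by blast
  obtain D where D: "D > 0"
    "\<And>p m. p \<in> S \<Longrightarrow> 1 \<le> m \<Longrightarrow> real m * renewal_seq p m \<le> D / renewal.z p m"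
    using strong_renewal by blast
  define G where "G = 9 * (A / (1 - \<gamma>) + 2 * A / \<beta>) + 27 * (2 * K * D * K)"
  show ?thesis
  proof
    show "G > 0" unfolding G_def
      using A D K_ge_1 exponents by (intro add_pos_nonneg mult_pos_pos) (auto intro!: add_pos_pos)
    fix p and n l :: nat assume p: "p \<in> S" and l: "1 \<le> l" "l \<le> n"
    interpret renewal p using p by (rule renewal)
    have n: "1 \<le> n" using l by simp
    have zl: "z l > 0" and zn: "z n > 0" by (rule tail_pos[OF p])+
    define M where "M = A * (real l / z l)"
    have M: "M \<ge> 0" using A zl by (simp add: M_def)
    let ?\<phi> = "\<lambda>t. norm (1 - cis (real l * t)) * norm (bser n t)"
    have cont: "continuous_on T ?\<phi>" for T
      by (intro continuous_intros continuous_bser n)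
    have "1 / real l \<le> 1" using l by simp
    then have pi: "1 / real l \<le> pi" using pi_gt3 by linarith
    have "integral {0..pi} ?\<phi> \<le> M * (1 / real l) / (1 - \<gamma>) + 2 * M * (1 / real l) / (1 + \<beta> - 1)"
    proof (rule integral_split_le[OF cont _ pi])
      show "integral {0..1 / real l} ?\<phi> \<le> M * (1 / real l) / (1 - \<gamma>)"
      proof (rule integral_le_powr_head)
        fix t assume t: "0 < t" "t \<le> 1 / real l"
        then have lt: "real l * t \<le> 1" "0 < real l * t" using l by (auto simp: field_simps)
        have "norm (bser n t) \<le> M * (real l * t) powr (- (1 + \<gamma>))"
          using A(2)[OF p n l(1) t(1)] t pi lt by (auto simp: M_def split: if_splits)
        then have "?\<phi> t \<le> (real l * t) powr 1 * (M * (real l * t) powr (- (1 + \<gamma>)))"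
          using norm_one_minus_cis_le(1)[of "real l * t"] t by (intro mult_mono) auto
        also have "\<dots> = M * ((real l * t) powr 1 * (real l * t) powr (- (1 + \<gamma>)))"
          by (simp only: mult_ac)
        also have "(real l * t) powr 1 * (real l * t) powr (- (1 + \<gamma>)) = (real l * t) powr (- \<gamma>)"
          unfolding powr_add[symmetric] by simp
        finally show "?\<phi> t \<le> M * (t / (1 / real l)) powr (- \<gamma>)"
          by (simp add: mult.commute)
      qed (use l exponents cont in auto)
      show "integral {1 / real l..pi} ?\<phi> \<le> 2 * M * (1 / real l) / (1 + \<beta> - 1)"
      proof (rule integral_le_powr_tail)
        fix t assume t: "1 / real l \<le> t" "t \<le> pi"
        have t0: "0 < t" by (rule less_le_trans[OF _ t(1)]) (use l in simp)
        have lt: "1 \<le> real l * t" using t l by (auto simp: field_simps)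
        have "norm (bser n t) \<le> M * (real l * t) powr (- (1 + \<beta>))"
          using A(2)[OF p n l(1) t0 t(2)] lt by (simp add: M_def)
        then have "?\<phi> t \<le> 2 * (M * (real l * t) powr (- (1 + \<beta>)))"
          using norm_one_minus_cis_le(2)[of "real l * t"] by (intro mult_mono) auto
        then show "?\<phi> t \<le> 2 * M * (t / (1 / real l)) powr (- (1 + \<beta>))"
          by (simp add: mult.commute)
      qed (use l cont pi M exponents in auto)
    qed simp
    also have "\<dots> = (A / (1 - \<gamma>) + 2 * A / \<beta>) * (1 / z l)"
      using l by (simp add: M_def add_divide_distrib mult.commute)
    finally have int: "integral {0..pi} ?\<phi> \<le> (A / (1 - \<gamma>) + 2 * A / \<beta>) * (1 / z l)" .
    have "real l * u (n + l) \<le> 2 * K * D * (real l / (real n * z n))"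
      by (rule shifted_u_le[OF D p l])
    also have "real l / (real n * z n) \<le> K * (1 / z l)"
      using scale_tail_mono[OF p l] n zl zn by (simp add: divide_le_eq le_divide_eq mult_ac)
    finally have third: "real l * u (n + l) \<le> 2 * K * D * (K * (1 / z l))"
      using K_ge_1 D by (simp add: mult_left_mono)
    have "real n * \<bar>u (n + l) - u n\<bar> \<le> 9 * integral {0..pi} ?\<phi> + 27 * (real l * u (n + l))"
      using u_diff_le_integral[OF n, of l] by (simp only: mult.assoc)
    also have "\<dots> \<le> 9 * ((A / (1 - \<gamma>) + 2 * A / \<beta>) * (1 / z l)) + 27 * (2 * K * D * (K * (1 / z l)))"
      by (intro add_mono mult_left_mono int third) auto
    also have "\<dots> = G * (1 / z l)"
      unfolding G_def by (simp only: distrib_left distrib_right mult_ac)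
    finally show "\<bar>u (n + l) - u n\<bar> \<le> G / (real n * z l)"
      using n zl by (simp add: le_divide_eq mult_ac)
  qed
qed

text \<open>The middle range \<open>[1/m, 1/l]\<close> gives the main term, through
  \<open>(l t) powr (- 2 \<gamma>)\<close>. That power is not integrable at 0, so below
  \<open>1/m\<close> the bound \<open>norm_bser_near\<close> takes over.\<close>

lemma u_diff_block:
  obtains C where "C > 0"
    "\<And>p m l. p \<in> S \<Longrightarrow> 1 \<le> l \<Longrightarrow> l \<le> m \<Longrightarrow>
      (\<Sum>j\<in>{m..<2*m}. \<bar>renewal_seq p (j + l) - renewal_seq p j\<bar>) \<le>
        C / renewal.z p l * (real m / real l) powr (\<gamma> - 1)"
proof -
  obtain A where A: "A > 0"
    "\<And>p m l t. p \<in> S \<Longrightarrow> 1 \<le> m \<Longrightarrow> 1 \<le> l \<Longrightarrow> 0 < t \<Longrightarrow> t \<le> pi \<Longrightarrow>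
      norm (renewal.bser p m t) \<le>
        A * (real l / renewal.z p l) * (real l * t) powr (- (1 + (if 1 \<le> real l * t then \<beta> else \<gamma>)))"
    using norm_bser_le_smooth by blast
  obtain B where B: "B > 0"
    "\<And>p m t. p \<in> S \<Longrightarrow> 1 \<le> m \<Longrightarrow> norm (renewal.bser p m t) \<le> B * (real m / renewal.z p m)"
    using norm_bser_near by blast
  define H where "H = B\<^sup>2 * K\<^sup>2 + A\<^sup>2 / (2 * \<gamma> - 1) + 4 * A\<^sup>2 / (1 + 2 * \<beta>)"
  have H: "H > 0" unfolding H_def
    using A B K_ge_1 exponents by (intro add_pos_pos mult_pos_pos divide_pos_pos) auto
  define G where "G = 9 * sqrt H + 27 * (3 * K * K)"
  show ?thesis
  proof
    show "G > 0" unfolding G_def using H K_ge_1 by (intro add_pos_pos) auto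
    fix p and m l :: nat assume p: "p \<in> S" and l: "1 \<le> l" "l \<le> m"
    interpret renewal p using p by (rule renewal)
    have m: "1 \<le> m" using l by simp
    have zl: "z l > 0" and zm: "z m > 0" by (rule tail_pos[OF p])+
    define \<eta> where "\<eta> = real m / real l"
    have \<eta>: "1 \<le> \<eta>" using l by (simp add: \<eta>_def field_simps)
    \<comment> \<open>The common size of the three parts of the integral:
      \<open>sqrt (m * Y)\<close> is \<open>l / z l * \<eta> powr \<gamma>\<close>, and division by
      \<open>m\<close> gives the claimed rate.\<close>
    define Y where "Y = (real l / z l)\<^sup>2 * \<eta> powr (2 * \<gamma>) / real m"
    have Y: "Y \<ge> 0" by (simp add: Y_def)
    have zml: "1 / z m \<le> K * \<eta> powr \<gamma> / z l"
      using tail_upper[OF p l] zl zm unfolding \<eta>_def[symmetric]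
      by (simp add: divide_le_eq le_divide_eq)
    define M where "M = A * (real l / z l)"
    have M: "M \<ge> 0" using A zl by (simp add: M_def)
    let ?\<phi> = "\<lambda>t. (norm (1 - cis (real l * t)) * norm (bser m t))\<^sup>2"
    have cont: "continuous_on T ?\<phi>" for T
      by (intro continuous_intros continuous_bser m)
    have le1: "1 / real l \<le> 1" "1 / real m \<le> 1" "1 / real m \<le> 1 / real l"
      using l by (auto simp: frac_le)
    then have pi: "1 / real l \<le> pi" using pi_gt3 by linarith
    have i1: "integral {0..1 / real m} ?\<phi> \<le> B\<^sup>2 * K\<^sup>2 * Y"
    proof -
      have "integral {0..1 / real m} ?\<phi> \<le> (real l * B / z m)\<^sup>2 * (1 / real m) / (1 - 0)"
      proof (rule integral_le_powr_head)
        fix t assume t: "0 < t" "t \<le> 1 / real m"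
        then have mt: "real m * t \<le> 1" using m by (simp add: field_simps)
        have "norm (1 - cis (real l * t)) * norm (bser m t) \<le> (real l * t) * (B * (real m / z m))"
          using norm_one_minus_cis_le(1)[of "real l * t"] B(2)[OF p m, of t] t by (intro mult_mono) auto
        also have "\<dots> = (real l * B / z m) * (real m * t)" by simp
        also have "\<dots> \<le> (real l * B / z m) * 1"
          using mt B zm by (intro mult_left_mono) auto
        finally have "?\<phi> t \<le> (real l * B / z m * 1)\<^sup>2"
          by (intro power_mono) auto
        then show "?\<phi> t \<le> (real l * B / z m)\<^sup>2 * (t / (1 / real m)) powr (- 0)"
          using t m by simp
      qed (use m cont in auto)
      also have "\<dots> = (real l * B)\<^sup>2 * (1 / z m)\<^sup>2 * (1 / real m)"
        by (simp add: power_divide)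
      also have "\<dots> \<le> (real l * B)\<^sup>2 * (K * \<eta> powr \<gamma> / z l)\<^sup>2 * (1 / real m)"
        using zml zm by (intro mult_right_mono mult_left_mono power_mono) auto
      also have "\<dots> = B\<^sup>2 * K\<^sup>2 * Y"
        unfolding Y_def mult_2 powr_add by (simp add: power2_eq_square)
      finally show ?thesis .
    qed
    have i2: "integral {1 / real m..1 / real l} ?\<phi> \<le> A\<^sup>2 / (2 * \<gamma> - 1) * Y"
    proof -
      have "integral {1 / real m..1 / real l} ?\<phi> \<le> M\<^sup>2 * \<eta> powr (2 * \<gamma>) * (1 / real m) / (2 * \<gamma> - 1)"
      proof (rule integral_le_powr_tail)
        fix t assume t: "1 / real m \<le> t" "t \<le> 1 / real l"
        have t0: "0 < t" by (rule less_le_trans[OF _ t(1)]) (use m in simp)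
        then have lt: "real l * t \<le> 1" "0 < real l * t" using t l by (auto simp: field_simps)
        have "norm (bser m t) \<le> M * (real l * t) powr (- (1 + \<gamma>))"
          using A(2)[OF p m l(1) t0] t pi lt by (auto simp: M_def split: if_splits)
        then have "norm (1 - cis (real l * t)) * norm (bser m t) \<le> (real l * t) powr 1 * (M * (real l * t) powr (- (1 + \<gamma>)))"
          using norm_one_minus_cis_le(1)[of "real l * t"] t0 by (intro mult_mono) auto
        also have "\<dots> = M * ((real l * t) powr 1 * (real l * t) powr (- (1 + \<gamma>)))"
          by (simp only: mult_ac)
        also have "(real l * t) powr 1 * (real l * t) powr (- (1 + \<gamma>)) = (real l * t) powr (- \<gamma>)"
          unfolding powr_add[symmetric] by simp
        finally have "?\<phi> t \<le> (M * (real l * t) powr (- \<gamma>))\<^sup>2"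
          by (intro power_mono) auto
        also have "\<dots> = M\<^sup>2 * (real l * t) powr (- (2 * \<gamma>))"
          by (simp add: power_mult_distrib power2_eq_square flip: powr_add)
        also have "(real l * t) powr (- (2 * \<gamma>)) = \<eta> powr (2 * \<gamma>) * (real m * t) powr (- (2 * \<gamma>))"
        proof -
          have "real l * t = (real m * t) / \<eta>"
            using l by (simp add: \<eta>_def)
          then show ?thesis
            by (simp only: powr_divide powr_minus inverse_divide) (simp only: divide_inverse)
        qed
        finally show "?\<phi> t \<le> M\<^sup>2 * \<eta> powr (2 * \<gamma>) * (t / (1 / real m)) powr (- (2 * \<gamma>))"
          by (simp add: mult_ac)
      qed (use m l le1 cont exponents in auto)
      also have "\<dots> = A\<^sup>2 / (2 * \<gamma> - 1) * Y"
        unfolding M_def Y_def power_mult_distrib by (simp add: mult_ac)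
      finally show ?thesis .
    qed
    have i3: "integral {1 / real l..pi} ?\<phi> \<le> 4 * A\<^sup>2 / (1 + 2 * \<beta>) * Y"
    proof -
      have "integral {1 / real l..pi} ?\<phi> \<le> (2 * M)\<^sup>2 * (1 / real l) / (2 + 2 * \<beta> - 1)"
      proof (rule integral_le_powr_tail)
        fix t assume t: "1 / real l \<le> t" "t \<le> pi"
        have t0: "0 < t" by (rule less_le_trans[OF _ t(1)]) (use l in simp)
        have lt: "1 \<le> real l * t" using t l by (auto simp: field_simps)
        have "norm (bser m t) \<le> M * (real l * t) powr (- (1 + \<beta>))"
          using A(2)[OF p m l(1) t0 t(2)] lt by (simp add: M_def)
        then have "norm (1 - cis (real l * t)) * norm (bser m t) \<le> 2 * (M * (real l * t) powr (- (1 + \<beta>)))"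
          using norm_one_minus_cis_le(2)[of "real l * t"] by (intro mult_mono) auto
        then have "?\<phi> t \<le> (2 * (M * (real l * t) powr (- (1 + \<beta>))))\<^sup>2"
          by (intro power_mono) auto
        also have "\<dots> = (2 * M)\<^sup>2 * (real l * t) powr (- (2 + 2 * \<beta>))"
          by (simp add: power_mult_distrib power2_eq_square flip: powr_add)
        finally show "?\<phi> t \<le> (2 * M)\<^sup>2 * (t / (1 / real l)) powr (- (2 + 2 * \<beta>))"
          by (simp add: mult.commute)
      qed (use l cont pi exponents in auto)
      also have "\<dots> = 4 * A\<^sup>2 / (1 + 2 * \<beta>) * ((real l / z l)\<^sup>2 * (1 / real l))"
      proof -
        have "2 + 2 * \<beta> - 1 = 1 + 2 * \<beta>" by simp
        then show ?thesis
          unfolding M_def power_mult_distrib by (simp only:) (simp add: mult_ac)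
      qed
      also have "\<dots> \<le> 4 * A\<^sup>2 / (1 + 2 * \<beta>) * Y"
      proof (rule mult_left_mono)
        \<comment> \<open>Here \<open>2 \<gamma> > 1\<close> lets the range beyond
          \<open>1/l\<close> be absorbed into \<open>Y\<close>.\<close>
        have "\<eta> powr 1 \<le> \<eta> powr (2 * \<gamma>)"
          using \<eta> exponents by (intro powr_mono) auto
        then have "1 / real l \<le> \<eta> powr (2 * \<gamma>) / real m"
          using l \<eta> by (simp add: \<eta>_def field_simps)
        then have "(real l / z l)\<^sup>2 * (1 / real l) \<le> (real l / z l)\<^sup>2 * (\<eta> powr (2 * \<gamma>) / real m)"
          by (intro mult_left_mono) auto
        then show "(real l / z l)\<^sup>2 * (1 / real l) \<le> Y"
          by (simp add: Y_def)
      qed (use exponents in simp)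
      finally show ?thesis .
    qed
    have "integral {0..pi} ?\<phi> \<le> B\<^sup>2 * K\<^sup>2 * Y + (A\<^sup>2 / (2 * \<gamma> - 1) * Y + 4 * A\<^sup>2 / (1 + 2 * \<beta>) * Y)"
      using le1 pi by (intro integral_split_le[OF cont _ _ i1] integral_split_le[OF cont _ _ i2 i3]) auto
    also have "\<dots> = H * Y" by (simp add: H_def distrib_right)
    finally have "real m * integral {0..pi} ?\<phi> \<le> real m * (H * Y)"
      by (intro mult_left_mono) auto
    also have "\<dots> = H * (real l / z l * \<eta> powr \<gamma>)\<^sup>2"
      using m unfolding Y_def mult_2 powr_add by (simp add: power2_eq_square)
    finally have "sqrt (real m * integral {0..pi} ?\<phi>) \<le> sqrt (H * (real l / z l * \<eta> powr \<gamma>)\<^sup>2)"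
      by (rule real_sqrt_le_mono)
    also have "\<dots> = sqrt H * (real l / z l * \<eta> powr \<gamma>)"
      using zl by (simp add: real_sqrt_mult)
    finally have sq: "sqrt (real m * integral {0..pi} ?\<phi>) \<le> sqrt H * (real l / z l * \<eta> powr \<gamma>)" .
    \<comment> \<open>No cancellation is used for this term, only the bound on the expected number
      of visits up to time \<open>3 * m\<close>.\<close>
    have us: "(\<Sum>j\<in>{m..<2*m}. u (j + l)) \<le> 3 * K * K * (\<eta> powr \<gamma> / z l)"
    proof -
      have "(\<Sum>j\<in>{m..<2*m}. u (j + l)) = (\<Sum>j\<in>{m+l..<2*m+l}. u j)"
        by (rule sum.shift_bounds_nat_ivl[symmetric])
      also have "\<dots> \<le> (\<Sum>j\<le>3*m. u j)"
        using l by (intro sum_mono2 u_nonneg) auto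
      also have "\<dots> \<le> 1 / z (3 * m)"
        using u_sum_le[of "3 * m"] tail_pos[OF p, of "3 * m"] by (simp add: pos_le_divide_eq)
      also have "\<dots> \<le> K * 3 / z m"
      proof -
        have "z m \<le> K * (real (3 * m) / real m) powr \<gamma> * z (3 * m)"
          using m by (intro tail_upper p) auto
        also have "(real (3 * m) / real m) powr \<gamma> \<le> 3 powr 1"
          using m exponents powr_mono[of \<gamma> 1 3] by simp
        finally have "z m \<le> K * 3 * z (3 * m)"
          using K_ge_1 tail_pos[OF p, of "3 * m"] by (simp add: mult_left_mono mult_right_mono)
        then show ?thesis
          using zm tail_pos[OF p, of "3 * m"] by (simp add: divide_le_eq le_divide_eq)
      qed
      also have "\<dots> = K * 3 * (1 / z m)" by simp
      also have "\<dots> \<le> K * 3 * (K * \<eta> powr \<gamma> / z l)"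
        using K_ge_1 by (intro mult_left_mono zml) auto
      finally show ?thesis by (simp add: mult_ac)
    qed
    have "real m * (\<Sum>j\<in>{m..<2*m}. \<bar>u (j + l) - u j\<bar>) \<le>
        9 * sqrt (real m * integral {0..pi} ?\<phi>) + 27 * real l * (\<Sum>j\<in>{m..<2*m}. u (j + l))"
      by (rule u_diff_block_le_integral) fact
    also have "\<dots> \<le> 9 * (sqrt H * (real l / z l * \<eta> powr \<gamma>)) + 27 * real l * (3 * K * K * (\<eta> powr \<gamma> / z l))"
      using sq us by (intro add_mono mult_left_mono) auto
    also have "\<dots> = G * (\<eta> powr \<gamma> / z l) * real l"
      by (simp add: G_def add_divide_distrib algebra_simps)
    also have "\<dots> = real m * (G / z l * \<eta> powr (\<gamma> - 1))"
    proof -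
      have "real m * \<eta> powr (\<gamma> - 1) = real l * \<eta> powr \<gamma>"
        using l by (simp add: powr_diff) (simp add: \<eta>_def)
      then show ?thesis by (simp add: divide_inverse mult_ac)
    qed
    finally show "(\<Sum>j\<in>{m..<2*m}. \<bar>u (j + l) - u j\<bar>) \<le> G / z l * (real m / real l) powr (\<gamma> - 1)"
      unfolding \<eta>_def[symmetric] using m by (simp only: mult_le_cancel_left_pos of_nat_0_less_iff)
  qed
qed

end

subsection \<open>The l1 distance\<close>

lemma sum_lessThan_add:
  fixes f :: "nat \<Rightarrow> real"
  shows "(\<Sum>j<l + m. f j) = (\<Sum>j<l. f j) + (\<Sum>j<m. f (j + l))"
  by (induction m) (auto simp: ac_simps)

text \<open>The l1 distance between the laws at times \<open>n + l\<close> and \<open>n\<close>,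
  with the common factor \<open>z k\<close> taken out.\<close>

definition (in renewal) l1_diff :: "nat \<Rightarrow> nat \<Rightarrow> real" where
  "l1_diff n l = (\<Sum>k\<le>n + l. z k * \<bar>u (n + l - k) - (if k \<le> n then u (n - k) else 0)\<bar>)"

lemma (in renewal) renewal_identity': "(\<Sum>k\<le>n. z k * u (n - k)) = 1"
proof -
  have "(\<Sum>k\<le>n. z k * u (n - k)) = (\<Sum>j\<le>n. u j * z (n - j))"
    by (rule sum.reindex_bij_witness[of _ "\<lambda>j. n - j" "\<lambda>j. n - j"]) auto
  then show ?thesis by (simp add: renewal_identity)
qed

lemma (in renewal) l1_diff_le_2: "l1_diff n l \<le> 2"
proof -
  have "l1_diff n l \<le> (\<Sum>k\<le>n + l. z k * u (n + l - k) + z k * (if k \<le> n then u (n - k) else 0))"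
    unfolding l1_diff_def
  proof (rule sum_mono)
    fix k
    have "\<bar>u (n + l - k) - (if k \<le> n then u (n - k) else 0)\<bar> \<le> u (n + l - k) + (if k \<le> n then u (n - k) else 0)"
      using u_nonneg[of "n + l - k"] u_nonneg[of "n - k"] by auto
    then show "z k * \<bar>u (n + l - k) - (if k \<le> n then u (n - k) else 0)\<bar> \<le>
        z k * u (n + l - k) + z k * (if k \<le> n then u (n - k) else 0)"
      using mult_left_mono[OF _ z_nonneg[of k]] by (simp only: distrib_left[symmetric])
  qed
  also have "\<dots> = 1 + (\<Sum>k\<le>n + l. z k * (if k \<le> n then u (n - k) else 0))"
    by (simp add: sum.distrib renewal_identity')
  also have "(\<Sum>k\<le>n + l. z k * (if k \<le> n then u (n - k) else 0)) = (\<Sum>k\<le>n. z k * u (n - k))"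
    by (rule sum.mono_neutral_cong_right) auto
  finally show ?thesis by (simp add: renewal_identity')
qed

text \<open>Reindexed by \<open>j = n - k\<close>. The last sum is over the states
  \<open>k > n\<close>, which only the later law charges, with \<open>j = n + l - k\<close>.\<close>

lemma (in renewal) l1_diff_split:
  assumes "1 \<le> l" "2 * l \<le> n"
  shows "l1_diff n l =
    (\<Sum>j<l. z (n - j) * \<bar>u (j + l) - u j\<bar>) + (\<Sum>j\<in>{l..n div 2}. z (n - j) * \<bar>u (j + l) - u j\<bar>) +
    (\<Sum>j\<in>{n div 2<..n}. z (n - j) * \<bar>u (j + l) - u j\<bar>) + (\<Sum>j<l. z (n + l - j) * u j)"
proof -
  define f where "f = (\<lambda>j. z (n - j) * \<bar>u (j + l) - u j\<bar>)"
  have "l1_diff n l = (\<Sum>k\<in>{..n} \<union> {n<..n + l}. z k * \<bar>u (n + l - k) - (if k \<le> n then u (n - k) else 0)\<bar>)"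
    unfolding l1_diff_def by (rule sum.cong) auto
  also have "\<dots> = (\<Sum>k\<le>n. z k * \<bar>u (n + l - k) - (if k \<le> n then u (n - k) else 0)\<bar>) +
      (\<Sum>k\<in>{n<..n + l}. z k * \<bar>u (n + l - k) - (if k \<le> n then u (n - k) else 0)\<bar>)"
    by (rule sum.union_disjoint) auto
  also have "(\<Sum>k\<le>n. z k * \<bar>u (n + l - k) - (if k \<le> n then u (n - k) else 0)\<bar>) = (\<Sum>j\<le>n. f j)"
    unfolding f_def
    by (rule sum.reindex_bij_witness[of _ "\<lambda>j. n - j" "\<lambda>j. n - j"]) (auto simp: algebra_simps)
  also have "(\<Sum>k\<in>{n<..n + l}. z k * \<bar>u (n + l - k) - (if k \<le> n then u (n - k) else 0)\<bar>) =
      (\<Sum>j<l. z (n + l - j) * u j)"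
    by (rule sum.reindex_bij_witness[of _ "\<lambda>j. n + l - j" "\<lambda>j. n + l - j"])
      (use u_nonneg in auto)
  also have "(\<Sum>j\<le>n. f j) = (\<Sum>j\<in>({..<l} \<union> {l..n div 2}) \<union> {n div 2<..n}. f j)"
    using assms by (intro sum.cong) auto
  also have "\<dots> = (\<Sum>j\<in>{..<l} \<union> {l..n div 2}. f j) + (\<Sum>j\<in>{n div 2<..n}. f j)"
    using assms by (intro sum.union_disjoint) auto
  also have "(\<Sum>j\<in>{..<l} \<union> {l..n div 2}. f j) = (\<Sum>j<l. f j) + (\<Sum>j\<in>{l..n div 2}. f j)"
    by (intro sum.union_disjoint) auto
  finally show ?thesis by (simp only: f_def)
qed

context renewal_class
begin

lemma tail_le_twice:
  assumes p: "p \<in> S" and "1 \<le> m" "m \<le> n" "n \<le> 2 * m"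
  shows "renewal.z p m \<le> 2 * K * renewal.z p n"
proof -
  have zn: "renewal.z p n > 0" by (rule tail_pos[OF p])
  have "renewal.z p m \<le> K * (real n / real m) powr \<gamma> * renewal.z p n"
    using assms by (intro tail_upper) auto
  also have "(real n / real m) powr \<gamma> \<le> (real n / real m) powr 1"
    using assms exponents by (intro powr_mono) auto
  also have "\<dots> = real n / real m" by simp
  also have "\<dots> \<le> 2"
    using assms by (simp add: divide_le_eq)
  finally show ?thesis
    using zn K_ge_1 by (simp add: mult_left_mono mult_right_mono mult_ac)
qed

text \<open>For \<open>j < l\<close> and for states beyond \<open>n\<close> the bound on sums of
  \<open>u\<close> suffices. For \<open>j\<close> up to \<open>n/2\<close> the weight
  \<open>z (n - j)\<close> is comparable to \<open>z n\<close>; for larger \<open>j\<close> the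
  weights sum to order \<open>n z n\<close>. \<open>V\<close> and \<open>X\<close> stay open because
  the two cases supply them differently.\<close>

lemma l1_diff_le:
  obtains C where "C > 0"
    "\<And>p l n V X. p \<in> S \<Longrightarrow> 1 \<le> l \<Longrightarrow> 2 * l \<le> n \<Longrightarrow>
      (\<Sum>j\<in>{l..n div 2}. \<bar>renewal_seq p (j + l) - renewal_seq p j\<bar>) \<le> V \<Longrightarrow>
      (\<And>j. n < 2 * j \<Longrightarrow> j \<le> n \<Longrightarrow> \<bar>renewal_seq p (j + l) - renewal_seq p j\<bar> \<le> X) \<Longrightarrow>
      renewal.l1_diff p n l \<le> C * (renewal.z p n / renewal.z p l + renewal.z p n * V + real n * renewal.z p n * X)"
proof -
  obtain A where A: "A > 0"
    "\<And>p n. p \<in> S \<Longrightarrow> 1 \<le> n \<Longrightarrow> (\<Sum>i\<le>n. renewal.z p i) \<le> A * (real n * renewal.z p n)"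
    using sum_tail_le by blast
  define C where "C = 4 * K * K + 1 + 2 * K + A"
  show ?thesis
  proof
    show "C > 0" unfolding C_def using A K_ge_1 by (intro add_pos_pos) auto
    fix p and l n :: nat and V X :: real
    assume p: "p \<in> S" and l: "1 \<le> l" and n: "2 * l \<le> n"
      and V: "(\<Sum>j\<in>{l..n div 2}. \<bar>renewal_seq p (j + l) - renewal_seq p j\<bar>) \<le> V"
      and X: "\<And>j. n < 2 * j \<Longrightarrow> j \<le> n \<Longrightarrow> \<bar>renewal_seq p (j + l) - renewal_seq p j\<bar> \<le> X"
    interpret renewal p using p by (rule renewal)
    have zn: "z n > 0" and zl: "z l > 0" by (rule tail_pos[OF p])+
    have n1: "1 \<le> n" using l n by simp
    have near: "z (n - j) \<le> 2 * K * z n" if "2 * j \<le> n" for j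
      using that n1 by (intro tail_le_twice p) auto
    have usum: "(\<Sum>j<m. u j) \<le> 1 / z m" for m
    proof -
      have "(\<Sum>j<m. u j) \<le> (\<Sum>j\<le>m. u j)"
        by (intro sum_mono2 u_nonneg) auto
      also have "\<dots> \<le> 1 / z m"
        using u_sum_le[of m] tail_pos[OF p, of m] by (simp add: pos_le_divide_eq)
      finally show ?thesis .
    qed
    have s1: "(\<Sum>j<l. z (n - j) * \<bar>u (j + l) - u j\<bar>) \<le> 4 * K * K * (z n / z l)"
    proof -
      have "(\<Sum>j<l. z (n - j) * \<bar>u (j + l) - u j\<bar>) \<le> (\<Sum>j<l. 2 * K * z n * (u (j + l) + u j))"
      proof (intro sum_mono mult_mono near)
        fix j
        show "\<bar>u (j + l) - u j\<bar> \<le> u (j + l) + u j"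
          using u_nonneg[of j] u_nonneg[of "j + l"] by linarith
      qed (use n zn K_ge_1 in auto)
      also have "\<dots> = 2 * K * z n * (\<Sum>j<2 * l. u j)"
      proof -
        have "(\<Sum>j<2 * l. u j) = (\<Sum>j<l. u j) + (\<Sum>j<l. u (j + l))"
          unfolding mult_2 by (rule sum_lessThan_add)
        then show ?thesis
          by (simp add: sum_distrib_left[symmetric] sum.distrib)
      qed
      also have "\<dots> \<le> 2 * K * z n * (1 / z (2 * l))"
        using zn K_ge_1 by (intro mult_left_mono usum) auto
      also have "1 / z (2 * l) \<le> 2 * K * (1 / z l)"
      proof -
        have "z l \<le> 2 * K * z (2 * l)" using l by (intro tail_le_twice p) auto
        then show ?thesis
          using zl tail_pos[OF p, of "2 * l"] by (simp add: field_simps)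
      qed
      finally show ?thesis
        using zn K_ge_1 by (simp add: mult_left_mono mult_ac)
    qed
    have s2: "(\<Sum>j\<in>{l..n div 2}. z (n - j) * \<bar>u (j + l) - u j\<bar>) \<le> 2 * K * (z n * V)"
    proof -
      have "(\<Sum>j\<in>{l..n div 2}. z (n - j) * \<bar>u (j + l) - u j\<bar>) \<le> (\<Sum>j\<in>{l..n div 2}. 2 * K * z n * \<bar>u (j + l) - u j\<bar>)"
        by (intro sum_mono mult_right_mono near) auto
      also have "\<dots> = 2 * K * z n * (\<Sum>j\<in>{l..n div 2}. \<bar>u (j + l) - u j\<bar>)"
        by (simp add: sum_distrib_left)
      also have "\<dots> \<le> 2 * K * z n * V"
        using zn K_ge_1 by (intro mult_left_mono V) auto
      finally show ?thesis by (simp add: mult_ac)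
    qed
    have X0: "X \<ge> 0" using X[of n] n1 by simp
    have s3: "(\<Sum>j\<in>{n div 2<..n}. z (n - j) * \<bar>u (j + l) - u j\<bar>) \<le> A * (real n * z n * X)"
    proof -
      have "(\<Sum>j\<in>{n div 2<..n}. z (n - j) * \<bar>u (j + l) - u j\<bar>) \<le> (\<Sum>j\<in>{n div 2<..n}. z (n - j) * X)"
        by (intro sum_mono mult_left_mono X z_nonneg) auto
      also have "\<dots> \<le> (\<Sum>j\<le>n. z (n - j) * X)"
        using X0 z_nonneg by (intro sum_mono2) auto
      also have "\<dots> = (\<Sum>i\<le>n. z i * X)"
        by (rule sum.reindex_bij_witness[of _ "\<lambda>j. n - j" "\<lambda>j. n - j"]) auto
      also have "\<dots> = (\<Sum>i\<le>n. z i) * X" by (simp add: sum_distrib_right)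
      also have "\<dots> \<le> A * (real n * z n) * X"
        using X0 by (intro mult_right_mono A(2) p n1)
      finally show ?thesis by (simp add: mult_ac)
    qed
    have s4: "(\<Sum>j<l. z (n + l - j) * u j) \<le> z n / z l"
    proof -
      have "(\<Sum>j<l. z (n + l - j) * u j) \<le> (\<Sum>j<l. z n * u j)"
        by (intro sum_mono mult_right_mono z_antimono u_nonneg) auto
      also have "\<dots> = z n * (\<Sum>j<l. u j)" by (simp add: sum_distrib_left)
      also have "\<dots> \<le> z n * (1 / z l)"
        using zn by (intro mult_left_mono usum) auto
      finally show ?thesis by simp
    qed
    have V0: "V \<ge> 0" using V by (rule order_trans[rotated]) (simp add: sum_nonneg)
    have a: "0 \<le> z n / z l" "0 \<le> z n * V" "0 \<le> real n * z n * X"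
      using zn zl V0 X0 by auto
    have "l1_diff n l \<le> (4 * K * K + 1) * (z n / z l) + 2 * K * (z n * V) + A * (real n * z n * X)"
    proof -
      have "(4 * K * K + 1) * (z n / z l) = 4 * K * K * (z n / z l) + z n / z l"
        by (simp only: distrib_right mult_1)
      then show ?thesis
        unfolding l1_diff_split[OF l n] using s1 s2 s3 s4 by linarith
    qed
    also have "\<dots> \<le> C * (z n / z l) + C * (z n * V) + C * (real n * z n * X)"
    proof -
      have "0 \<le> K * K" by simp
      then have "4 * K * K + 1 \<le> C" "2 * K \<le> C" "A \<le> C"
        unfolding C_def using A(1) K_ge_1 by linarith+
      with a show ?thesis by (intro add_mono mult_right_mono)
    qed
    finally show "l1_diff n l \<le> C * (z n / z l + z n * V + real n * z n * X)"
      by (simp add: distrib_left)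
  qed
qed

text \<open>Here \<open>z n\<close> and \<open>z l\<close> are comparable, so the right side is at
  least the trivial bound 2.\<close>

lemma l1_diff_le_close:
  assumes p: "p \<in> S" and l: "1 \<le> l" "l \<le> n" "n < 2 * l"
  shows "renewal.l1_diff p n l \<le> 4 * K * (renewal.z p n / renewal.z p l)"
proof -
  interpret renewal p using p by (rule renewal)
  have "z l \<le> 2 * K * z n" using l by (intro tail_le_twice p) auto
  then have "2 \<le> 4 * K * (z n / z l)"
    using tail_pos[OF p, of l] by (simp add: field_simps)
  with l1_diff_le_2[of n l] show ?thesis by linarith
qed

end

lemma (in renewal_class_smooth) l1_diff_bound:
  obtains C where "C > 0"
    "\<And>p l n. p \<in> S \<Longrightarrow> 1 \<le> l \<Longrightarrow> l \<le> n \<Longrightarrow>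
      renewal.l1_diff p n l \<le> C * (renewal.z p n / renewal.z p l)"
proof -
  obtain A where A: "A > 0"
    "\<And>p l n V X. p \<in> S \<Longrightarrow> 1 \<le> l \<Longrightarrow> 2 * l \<le> n \<Longrightarrow>
      (\<Sum>j\<in>{l..n div 2}. \<bar>renewal_seq p (j + l) - renewal_seq p j\<bar>) \<le> V \<Longrightarrow>
      (\<And>j. n < 2 * j \<Longrightarrow> j \<le> n \<Longrightarrow> \<bar>renewal_seq p (j + l) - renewal_seq p j\<bar> \<le> X) \<Longrightarrow>
      renewal.l1_diff p n l \<le> A * (renewal.z p n / renewal.z p l + renewal.z p n * V + real n * renewal.z p n * X)"
    using l1_diff_le by blast
  obtain B where B: "B > 0"
    "\<And>p n l. p \<in> S \<Longrightarrow> 1 \<le> l \<Longrightarrow> l \<le> n \<Longrightarrow>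
      \<bar>renewal_seq p (n + l) - renewal_seq p n\<bar> \<le> B / (real n * renewal.z p l)"
    using u_diff_pointwise by blast
  obtain D where D: "D > 0"
    "\<And>p m l. p \<in> S \<Longrightarrow> 1 \<le> l \<Longrightarrow> l \<le> m \<Longrightarrow>
      (\<Sum>j\<in>{m..<2*m}. \<bar>renewal_seq p (j + l) - renewal_seq p j\<bar>) \<le>
        D / renewal.z p l * (real m / real l) powr (\<gamma> - 1)"
    using u_diff_block by blast
  define q :: real where "q = 2 powr (\<gamma> - 1)"
  have q: "0 < q" "q < 1"
    using exponents by (auto simp: q_def powr_less_one)
  define C where "C = A * (1 + D / (1 - q) + 2 * B) + 4 * K"
  show ?thesis
  proof
    show "C > 0" unfolding C_def using A(1) B(1) D(1) q K_ge_1
      by (intro add_pos_pos mult_pos_pos) auto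
    fix p and l n :: nat assume p: "p \<in> S" and l: "1 \<le> l" "l \<le> n"
    interpret renewal p using p by (rule renewal)
    have zn: "z n > 0" and zl: "z l > 0" by (rule tail_pos[OF p])+
    show "l1_diff n l \<le> C * (z n / z l)"
    proof (cases "n < 2 * l")
      case True
      have "l1_diff n l \<le> 4 * K * (z n / z l)"
        by (rule l1_diff_le_close[OF p l True])
      also have "\<dots> \<le> C * (z n / z l)"
      proof (rule mult_right_mono)
        have "0 \<le> 1 + D / (1 - q) + 2 * B"
          using B(1) D(1) q by simp
        then have "0 \<le> A * (1 + D / (1 - q) + 2 * B)"
          using A(1) by (intro mult_nonneg_nonneg) auto
        then show "4 * K \<le> C" by (simp add: C_def)
      qed (use zn zl in simp)
      finally show ?thesis .
    next
      case False
      then have n: "2 * l \<le> n" by simp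
      \<comment> \<open>The block from \<open>2^i * l\<close> to \<open>2^(i+1) * l\<close>
        contributes at most \<open>D / z l * q ^ i\<close>, with \<open>q < 1\<close> because
        \<open>\<gamma> < 1\<close>.\<close>
      have dyadic: "(\<Sum>j\<in>{l..<2^i*l}. \<bar>u (j + l) - u j\<bar>) \<le> D / z l * (\<Sum>h<i. q ^ h)" for i
      proof (induction i)
        case (Suc i)
        have le: "l \<le> 2^i*l" by simp
        then have "{l..<2^Suc i*l} = {l..<2^i*l} \<union> {2^i*l..<2*(2^i*l)}"
          by (subst ivl_disj_un_two(3)) (auto simp: mult.assoc)
        then have "(\<Sum>j\<in>{l..<2^Suc i*l}. \<bar>u (j + l) - u j\<bar>) =
            (\<Sum>j\<in>{l..<2^i*l}. \<bar>u (j + l) - u j\<bar>) + (\<Sum>j\<in>{2^i*l..<2*(2^i*l)}. \<bar>u (j + l) - u j\<bar>)"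
          by (simp only:) (rule sum.union_disjoint, auto)
        also have "(\<Sum>j\<in>{2^i*l..<2*(2^i*l)}. \<bar>u (j + l) - u j\<bar>) \<le> D / z l * (real (2^i*l) / real l) powr (\<gamma> - 1)"
          by (intro D p l le)
        also have "(real (2^i*l) / real l) powr (\<gamma> - 1) = q ^ i"
          using l by (simp add: q_def powr_power mult.commute powr_realpow[symmetric] powr_powr)
        finally show ?case
          using Suc by (simp add: distrib_left)
      qed simp
      \<comment> \<open>Taking \<open>n\<close> blocks is wasteful but harmless: the geometric sum
        is bounded independently of their number.\<close>
      have "n < 2 ^ n" by (rule less_exp)
      also have "\<dots> \<le> 2 ^ n * l" using l by simp
      finally have "{l..n div 2} \<subseteq> {l..<2^n*l}" by auto
      then have "(\<Sum>j\<in>{l..n div 2}. \<bar>u (j + l) - u j\<bar>) \<le> (\<Sum>j\<in>{l..<2^n*l}. \<bar>u (j + l) - u j\<bar>)"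
        by (intro sum_mono2) auto
      also have "\<dots> \<le> D / z l * (\<Sum>h<n. q ^ h)" by (rule dyadic)
      also have "\<dots> \<le> D / z l * (1 / (1 - q))"
      proof (rule mult_left_mono)
        have "(\<Sum>h<n. q ^ h) = (1 - q ^ n) / (1 - q)"
          using q by (simp add: sum_gp_strict)
        also have "\<dots> \<le> 1 / (1 - q)"
          using q by (intro divide_right_mono) auto
        finally show "(\<Sum>h<n. q ^ h) \<le> 1 / (1 - q)" .
      qed (use D(1) zl in simp)
      finally have V: "(\<Sum>j\<in>{l..n div 2}. \<bar>u (j + l) - u j\<bar>) \<le> D / z l * (1 / (1 - q))" .
      have X: "\<bar>u (j + l) - u j\<bar> \<le> 2 * B / (real n * z l)" if j: "n < 2 * j" "j \<le> n" for j
      proof -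
        have "\<bar>u (j + l) - u j\<bar> \<le> B / (real j * z l)"
          using j n l by (intro B p) auto
        also have "\<dots> \<le> B / (real n / 2 * z l)"
          using j n l B(1) zl by (intro divide_left_mono mult_right_mono mult_pos_pos) auto
        finally show ?thesis by (simp add: mult.commute)
      qed
      have "l1_diff n l \<le> A * (z n / z l + z n * (D / z l * (1 / (1 - q))) + real n * z n * (2 * B / (real n * z l)))"
        by (rule A(2)[OF p l(1) n V X])
      also have "\<dots> = A * (1 + D / (1 - q) + 2 * B) * (z n / z l)"
        using l zl by (simp add: distrib_left distrib_right mult_ac)
      also have "\<dots> \<le> C * (z n / z l)"
        unfolding C_def using K_ge_1 zn zl by (intro mult_right_mono) auto
      finally show ?thesis .
    qed
  qed
qed

text \<open>The pointwise bound carries a factor \<open>z j\<close>, so it can be summed directly: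
  the sum of tails is of order \<open>n z n\<close> and no logarithm appears.\<close>

lemma (in renewal_class_large) l1_diff_bound:
  obtains C where "C > 0"
    "\<And>p l n. p \<in> S \<Longrightarrow> 1 \<le> l \<Longrightarrow> l \<le> n \<Longrightarrow>
      renewal.l1_diff p n l \<le> C * ((real n * (renewal.z p n)\<^sup>2) / (real l * (renewal.z p l)\<^sup>2))"
proof -
  obtain A where A: "A > 0"
    "\<And>p l n V X. p \<in> S \<Longrightarrow> 1 \<le> l \<Longrightarrow> 2 * l \<le> n \<Longrightarrow>
      (\<Sum>j\<in>{l..n div 2}. \<bar>renewal_seq p (j + l) - renewal_seq p j\<bar>) \<le> V \<Longrightarrow>
      (\<And>j. n < 2 * j \<Longrightarrow> j \<le> n \<Longrightarrow> \<bar>renewal_seq p (j + l) - renewal_seq p j\<bar> \<le> X) \<Longrightarrow>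
      renewal.l1_diff p n l \<le> A * (renewal.z p n / renewal.z p l + renewal.z p n * V + real n * renewal.z p n * X)"
    using l1_diff_le by blast
  obtain E where E: "E > 0"
    "\<And>p n. p \<in> S \<Longrightarrow> 1 \<le> n \<Longrightarrow> (\<Sum>i\<le>n. renewal.z p i) \<le> E * (real n * renewal.z p n)"
    using sum_tail_le by blast
  obtain B where B: "B > 0"
    "\<And>p n l. p \<in> S \<Longrightarrow> 1 \<le> l \<Longrightarrow> l \<le> n \<Longrightarrow>
      \<bar>renewal_seq p (n + l) - renewal_seq p n\<bar> \<le> B * (renewal.z p n / (real l * (renewal.z p l)\<^sup>2))"
    using u_diff_pointwise by blast
  define C where "C = A * (K + B * E + B * (2 * K)) + 4 * K * K"
  show ?thesis
  proof
    show "C > 0" unfolding C_def using A(1) B(1) E(1) K_ge_1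
      by (intro add_pos_pos mult_pos_pos) auto
    fix p and l n :: nat assume p: "p \<in> S" and l: "1 \<le> l" "l \<le> n"
    interpret renewal p using p by (rule renewal)
    have zn: "z n > 0" and zl: "z l > 0" by (rule tail_pos[OF p])+
    define R where "R = 1 / (real l * (z l)\<^sup>2)"
    have R: "R \<ge> 0" using zl by (simp add: R_def)
    \<comment> \<open>Raising \<open>l z l\<close> to \<open>K n z n\<close> shows that
      \<open>z n / z l\<close> is dominated by the rate claimed here.\<close>
    have zz: "z n / z l \<le> K * (real n * (z n)\<^sup>2 * R)"
    proof -
      have "z n / z l = real l * z l * z n * R"
        using l zl by (simp add: R_def power2_eq_square)
      also have "\<dots> \<le> K * (real n * z n) * z n * R"
        using scale_tail_mono[OF p l] zn R by (intro mult_right_mono) auto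
      finally show ?thesis by (simp add: power2_eq_square mult_ac)
    qed
    have "l1_diff n l \<le> C * (real n * (z n)\<^sup>2 * R)"
    proof (cases "n < 2 * l")
      case True
      have "l1_diff n l \<le> 4 * K * (z n / z l)"
        by (rule l1_diff_le_close[OF p l True])
      also have "\<dots> \<le> 4 * K * (K * (real n * (z n)\<^sup>2 * R))"
        using zz K_ge_1 by (intro mult_left_mono) auto
      also have "\<dots> = 4 * K * K * (real n * (z n)\<^sup>2 * R)" by simp
      also have "\<dots> \<le> C * (real n * (z n)\<^sup>2 * R)"
      proof (rule mult_right_mono)
        have "0 \<le> K + B * E + B * (2 * K)"
          using B(1) E(1) K_ge_1 by simp
        then have "0 \<le> A * (K + B * E + B * (2 * K))"
          using A(1) by (intro mult_nonneg_nonneg) auto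
        then show "4 * K * K \<le> C" by (simp add: C_def)
      qed (use R in simp)
      finally show ?thesis .
    next
      case False
      then have n: "2 * l \<le> n" by simp
      have "(\<Sum>j\<in>{l..n div 2}. \<bar>u (j + l) - u j\<bar>) \<le> (\<Sum>j\<in>{l..n div 2}. B * (z j / (real l * (z l)\<^sup>2)))"
        using l by (intro sum_mono B p) auto
      also have "\<dots> = B * R * (\<Sum>j\<in>{l..n div 2}. z j)"
        by (simp add: R_def sum_distrib_left)
      also have "\<dots> \<le> B * R * (\<Sum>j\<le>n. z j)"
        using B(1) R z_nonneg by (intro mult_left_mono sum_mono2) auto
      also have "\<dots> \<le> B * R * (E * (real n * z n))"
        using B(1) R l by (intro mult_left_mono E p) auto
      finally have V: "(\<Sum>j\<in>{l..n div 2}. \<bar>u (j + l) - u j\<bar>) \<le> B * R * (E * (real n * z n))" .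
      have X: "\<bar>u (j + l) - u j\<bar> \<le> B * (2 * K * z n * R)" if j: "n < 2 * j" "j \<le> n" for j
      proof -
        have "\<bar>u (j + l) - u j\<bar> \<le> B * (z j / (real l * (z l)\<^sup>2))"
          using j n l by (intro B p) auto
        also have "\<dots> = B * (z j * R)" by (simp add: R_def)
        also have "\<dots> \<le> B * (2 * K * z n * R)"
          using j n l B(1) R by (intro mult_left_mono mult_right_mono tail_le_twice p) auto
        finally show ?thesis .
      qed
      have "l1_diff n l \<le> A * (z n / z l + z n * (B * R * (E * (real n * z n))) + real n * z n * (B * (2 * K * z n * R)))"
        by (rule A(2)[OF p l(1) n V X])
      also have "\<dots> \<le> A * (K * (real n * (z n)\<^sup>2 * R) + z n * (B * R * (E * (real n * z n))) + real n * z n * (B * (2 * K * z n * R)))"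
        using A(1) zz by (intro mult_left_mono add_mono order_refl) auto
      also have "\<dots> = A * (K + B * E + B * (2 * K)) * (real n * (z n)\<^sup>2 * R)"
        by (simp add: power2_eq_square algebra_simps)
      also have "\<dots> \<le> C * (real n * (z n)\<^sup>2 * R)"
        unfolding C_def using K_ge_1 R by (intro mult_right_mono) auto
      finally show ?thesis .
    qed
    then show "l1_diff n l \<le> C * ((real n * (z n)\<^sup>2) / (real l * (z l)\<^sup>2))"
      by (simp add: R_def)
  qed
qed

subsection \<open>The Markov chain\<close>

text \<open>The sum alone is already an upper bound for \<open>tv_dist\<close>; the extra factor 2
  makes the argument shorter and goes into the constant.\<close>

lemma tv_dist_le_sum:
  assumes "set_pmf \<mu> \<subseteq> {..M}" "set_pmf \<nu> \<subseteq> {..M::nat}"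
  shows "tv_dist \<mu> \<nu> \<le> 2 * (\<Sum>k\<le>M. \<bar>pmf \<mu> k - pmf \<nu> k\<bar>)"
proof -
  have prob: "measure_pmf.prob \<theta> A = (\<Sum>k\<in>A \<inter> {..M}. pmf \<theta> k)" if "set_pmf \<theta> \<subseteq> {..M}" for \<theta> A
  proof -
    have "A \<inter> set_pmf \<theta> = (A \<inter> {..M}) \<inter> set_pmf \<theta>" using that by auto
    then have "measure_pmf.prob \<theta> A = measure_pmf.prob \<theta> (A \<inter> {..M})"
      by (metis measure_Int_set_pmf)
    also have "\<dots> = (\<Sum>k\<in>A \<inter> {..M}. pmf \<theta> k)"
      by (rule measure_measure_pmf_finite) auto
    finally show ?thesis .
  qed
  have "\<bar>measure_pmf.prob \<mu> A - measure_pmf.prob \<nu> A\<bar> \<le> (\<Sum>k\<le>M. \<bar>pmf \<mu> k - pmf \<nu> k\<bar>)" for A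
  proof -
    have "\<bar>measure_pmf.prob \<mu> A - measure_pmf.prob \<nu> A\<bar> \<le> (\<Sum>k\<in>A \<inter> {..M}. \<bar>pmf \<mu> k - pmf \<nu> k\<bar>)"
      unfolding prob[OF assms(1)] prob[OF assms(2)] sum_subtractf[symmetric] by (rule sum_abs)
    also have "\<dots> \<le> (\<Sum>k\<le>M. \<bar>pmf \<mu> k - pmf \<nu> k\<bar>)"
      by (rule sum_mono2) auto
    finally show ?thesis .
  qed
  then have "(SUP A. \<bar>measure_pmf.prob \<mu> A - measure_pmf.prob \<nu> A\<bar>) \<le> (\<Sum>k\<le>M. \<bar>pmf \<mu> k - pmf \<nu> k\<bar>)"
    by (intro cSUP_least) auto
  then show ?thesis by (simp add: tv_dist_def)
qed

section \<open>The law of the chain at time n\<close>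

context renewal
begin

context
  fixes q :: "nat \<Rightarrow> real"
  assumes z_pos: "\<And>n. z n > 0" and q: "\<And>n. q n = p (Suc n) / z n"
begin

lemma q_range: "0 \<le> q n" "q n \<le> 1"
  using z_pos[of n] p_nonneg[of "Suc n"] p_le_z[of n] by (auto simp: q)

lemma pmf_chain_kernel:
  "pmf (chain_kernel q x) k = (if k = 0 then q x else if k = Suc x then 1 - q x else 0)"
proof -
  have "pmf (chain_kernel q x) k = measure_pmf.prob (bernoulli_pmf (q x)) ((\<lambda>b. if b then 0 else x + 1) -` {k})"
    unfolding chain_kernel_def by (rule pmf_map)
  also have "(\<lambda>b. if b then 0 else x + 1) -` {k} = (if k = 0 then {True} else if k = Suc x then {False} else {})"
    by (auto split: if_splits)
  finally show ?thesis
    using q_range[of x] by (auto simp: measure_pmf_single)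
qed

text \<open>Being at \<open>k\<close> at time \<open>n\<close> means that the last visit to 0 was at
  time \<open>n - k\<close>, followed by \<open>k\<close> steps without return, which has
  probability \<open>z k\<close>. In the induction, state 0 reproduces the renewal recursion and
  state \<open>Suc j\<close> uses \<open>(1 - q j) * z j = z (Suc j)\<close>.\<close>

lemma pmf_chain:
  "pmf ((transition_op q ^^ n) (return_pmf 0)) k = (if k \<le> n then z k * u (n - k) else 0)"
proof (induction n arbitrary: k)
  case (Suc n)
  let ?\<mu> = "(transition_op q ^^ n) (return_pmf 0)"
  have supp: "set_pmf ?\<mu> \<subseteq> {..n}"
    using Suc by (auto simp: set_pmf_iff split: if_splits)
  have "pmf ((transition_op q ^^ Suc n) (return_pmf 0)) k = measure_pmf.expectation ?\<mu> (\<lambda>x. pmf (chain_kernel q x) k)"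
    by (simp add: transition_op_def pmf_bind)
  also have "\<dots> = (\<Sum>x\<le>n. pmf (chain_kernel q x) k * pmf ?\<mu> x)"
    using supp by (intro integral_measure_pmf_real) auto
  also have "\<dots> = (\<Sum>x\<le>n. pmf (chain_kernel q x) k * (z x * u (n - x)))"
    using Suc by (intro sum.cong) auto
  also have "\<dots> = (if k \<le> Suc n then z k * u (Suc n - k) else 0)"
  proof (cases k)
    case 0
    have "(\<Sum>x\<le>n. pmf (chain_kernel q x) 0 * (z x * u (n - x))) = (\<Sum>x\<le>n. p (Suc x) * u (n - x))"
    proof (rule sum.cong[OF refl])
      fix x
      show "pmf (chain_kernel q x) 0 * (z x * u (n - x)) = p (Suc x) * u (n - x)"
        using z_pos[of x] by (simp add: pmf_chain_kernel q)
    qed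
    also have "\<dots> = u (Suc n)"
      unfolding renewal_seq.simps
      by (rule sum.reindex_bij_witness[of _ "\<lambda>j. n - j" "\<lambda>j. n - j"]) (auto simp: Suc_diff_le)
    finally show ?thesis using 0 by simp
  next
    case (Suc j)
    have "(\<Sum>x\<le>n. pmf (chain_kernel q x) k * (z x * u (n - x))) =
        (\<Sum>x\<le>n. if x = j then (1 - q j) * (z j * u (n - j)) else 0)"
      using Suc by (intro sum.cong) (auto simp: pmf_chain_kernel)
    also have "\<dots> = (if j \<le> n then (1 - q j) * (z j * u (n - j)) else 0)"
      by simp
    also have "(1 - q j) * (z j * u (n - j)) = z (Suc j) * u (n - j)"
      using z_pos[of j] by (simp add: q z_Suc field_simps)
    finally show ?thesis using Suc by simp
  qed
  finally show ?case .
qed (simp add: pmf_return)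

lemma tv_dist_le_l1_diff:
  "tv_dist ((transition_op q ^^ (n + l)) (return_pmf 0)) ((transition_op q ^^ n) (return_pmf 0)) \<le> 2 * l1_diff n l"
proof -
  have "tv_dist ((transition_op q ^^ (n + l)) (return_pmf 0)) ((transition_op q ^^ n) (return_pmf 0)) \<le>
      2 * (\<Sum>k\<le>n + l. \<bar>pmf ((transition_op q ^^ (n + l)) (return_pmf 0)) k - pmf ((transition_op q ^^ n) (return_pmf 0)) k\<bar>)"
    by (rule tv_dist_le_sum) (auto simp: set_pmf_iff pmf_chain split: if_splits)
  also have "(\<Sum>k\<le>n + l. \<bar>pmf ((transition_op q ^^ (n + l)) (return_pmf 0)) k - pmf ((transition_op q ^^ n) (return_pmf 0)) k\<bar>) = l1_diff n l"
    unfolding l1_diff_def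
  proof (rule sum.cong[OF refl])
    fix k assume "k \<in> {..n + l}"
    then have "pmf ((transition_op q ^^ (n + l)) (return_pmf 0)) k - pmf ((transition_op q ^^ n) (return_pmf 0)) k =
        z k * (u (n + l - k) - (if k \<le> n then u (n - k) else 0))"
      by (simp add: pmf_chain right_diff_distrib)
    then show "\<bar>pmf ((transition_op q ^^ (n + l)) (return_pmf 0)) k - pmf ((transition_op q ^^ n) (return_pmf 0)) k\<bar> =
        z k * \<bar>u (n + l - k) - (if k \<le> n then u (n - k) else 0)\<bar>"
      using z_nonneg[of k] by (simp add: abs_mult)
  qed
  finally show ?thesis .
qed

end

end

section \<open>From unordered sums to the renewal setting\<close>

lemma prob_seq_renewal:
  assumes "prob_seq p"
  defines "p' \<equiv> p(0 := 0)"
  shows "renewal p'" "renewal.z p' n = tail p n"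
proof -
  have nonneg: "p' k \<ge> 0" for k
    using assms by (auto simp: prob_seq_def p'_def)
  have "(p has_sum 1) {1..} \<longleftrightarrow> (p' has_sum 1) UNIV"
    by (rule has_sum_cong_neutral) (auto simp: p'_def)
  then have hs: "(p' has_sum 1) UNIV"
    using assms by (simp add: prob_seq_def)
  then show ren: "renewal p'"
    using nonneg has_sum_imp_sums[OF hs] by unfold_locales (auto simp: p'_def)
  have "(p' has_sum (1 - (\<Sum>k\<le>n. p' k))) (UNIV - {..n})"
    by (rule has_sum_Diff[OF hs has_sum_finite]) auto
  moreover have "(p' has_sum (1 - (\<Sum>k\<le>n. p' k))) (UNIV - {..n}) \<longleftrightarrow>
      (p has_sum (1 - (\<Sum>k\<le>n. p' k))) {n<..}"
    by (rule has_sum_cong_neutral) (auto simp: p'_def)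
  ultimately have "tail p n = 1 - (\<Sum>k\<le>n. p' k)"
    unfolding tail_def using infsumI by blast
  then show "renewal.z p' n = tail p n"
    by (simp add: renewal.z_def[OF ren])
qed

text \<open>An \<open>infsum\<close> over a non-summable family is 0, so summability has to be shown
  first; it follows from \<open>p k + p (Suc k)\<close> as a majorant.\<close>

lemma partial_variation_le_infsum:
  assumes "prob_seq p" "1 \<le> n"
  shows "(\<Sum>k\<in>{n<..M}. \<bar>p k - p (Suc k)\<bar>) \<le> (\<Sum>\<^sub>\<infinity>k\<in>{n<..}. \<bar>p k - p (k + 1)\<bar>)"
proof -
  have nonneg: "p k \<ge> 0" if "k \<ge> 1" for k
    using assms that by (auto simp: prob_seq_def)
  have "p summable_on {1..}"
    using assms by (auto simp: prob_seq_def summable_on_def)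
  then have 1: "p summable_on {n<..}"
    by (rule summable_on_subset_banach) (use assms in auto)
  have "p summable_on Suc ` {n<..}"
    by (rule summable_on_subset_banach[OF \<open>p summable_on {1..}\<close>]) auto
  then have 2: "(\<lambda>k. p (Suc k)) summable_on {n<..}"
    by (subst (asm) summable_on_reindex) (auto simp: o_def)
  have "(\<lambda>k. \<bar>p k - p (k + 1)\<bar>) summable_on {n<..}"
  proof (rule summable_on_comparison_test[OF summable_on_add[OF 1 2]])
    fix k assume "k \<in> {n<..}"
    then have "0 \<le> p k" "0 \<le> p (Suc k)" by (auto intro: nonneg)
    then show "\<bar>p k - p (k + 1)\<bar> \<le> p k + p (Suc k)" by auto
  qed auto
  then have "(\<Sum>k\<in>{n<..M}. \<bar>p k - p (k + 1)\<bar>) \<le> (\<Sum>\<^sub>\<infinity>k\<in>{n<..}. \<bar>p k - p (k + 1)\<bar>)"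
    by (intro finite_sum_le_infsum) auto
  then show ?thesis by simp
qed

section \<open>Potter bounds for the tails\<close>

lemma regularly_varying_doubling:
  assumes "regularly_varying 1 (- \<alpha>) \<rho>" "\<beta> < \<alpha>" "\<alpha> < \<gamma>"
  obtains n0 :: nat where "1 \<le> n0"
    "\<And>n. n0 \<le> n \<Longrightarrow> \<rho> (real (2 * n)) \<le> 2 powr (- \<beta>) * \<rho> (real n)"
    "\<And>n. n0 \<le> n \<Longrightarrow> 2 powr (- \<gamma>) * \<rho> (real n) \<le> \<rho> (real (2 * n))"
proof -
  have pos: "\<rho> x > 0" if "x \<ge> 1" for x
    using assms that by (auto simp: regularly_varying_def)
  have lim: "((\<lambda>x. \<rho> (2 * x) / \<rho> x) \<longlongrightarrow> 2 powr (- \<alpha>)) at_top"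
    using assms(1) unfolding regularly_varying_def by (elim conjE allE[of _ 2]) auto
  \<comment> \<open>The strict gaps on both sides of \<open>\<alpha>\<close> absorb the error in the
    limit, at the price of a threshold \<open>n0\<close> depending only on \<open>\<rho>\<close> and
    the exponents.\<close>
  have "2 powr (- \<alpha>) < 2 powr (- \<beta>)" "2 powr (- \<gamma>) < (2::real) powr (- \<alpha>)"
    using assms by (auto intro!: powr_less_mono)
  then have "\<forall>\<^sub>F x in at_top. \<rho> (2 * x) / \<rho> x < 2 powr (- \<beta>) \<and> 2 powr (- \<gamma>) < \<rho> (2 * x) / \<rho> x"
    using order_tendstoD[OF lim] by (intro eventually_conj) auto
  then obtain X where X: "\<And>x. x \<ge> X \<Longrightarrow> \<rho> (2 * x) / \<rho> x < 2 powr (- \<beta>) \<and> 2 powr (- \<gamma>) < \<rho> (2 * x) / \<rho> x"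
    by (auto simp: eventually_at_top_linorder)
  define n0 where "n0 = max 1 (nat \<lceil>X\<rceil>)"
  have *: "\<rho> (2 * real n) / \<rho> (real n) < 2 powr (- \<beta>) \<and> 2 powr (- \<gamma>) < \<rho> (2 * real n) / \<rho> (real n) \<and> \<rho> (real n) > 0"
    if "n0 \<le> n" for n
  proof -
    have "X \<le> real n" "1 \<le> real n"
      using that unfolding n0_def by linarith+
    with X pos show ?thesis by blast
  qed
  show ?thesis
  proof
    show "1 \<le> n0" by (simp add: n0_def)
    fix n assume "n0 \<le> n"
    from *[OF this] show "\<rho> (real (2 * n)) \<le> 2 powr (- \<beta>) * \<rho> (real n)"
      "2 powr (- \<gamma>) * \<rho> (real n) \<le> \<rho> (real (2 * n))"
      by (auto simp: pos_divide_less_eq pos_less_divide_eq)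
  qed
qed

context
  fixes z :: "nat \<Rightarrow> real" and \<rho> :: "real \<Rightarrow> real" and c \<beta> \<gamma> :: real and n0 :: nat
  assumes z_antimono: "\<And>m n. m \<le> n \<Longrightarrow> z n \<le> z m" and z_le_1: "\<And>n. z n \<le> 1"
    and c: "0 < c" "c \<le> 1"
    and z_\<rho>: "\<And>n. 1 \<le> n \<Longrightarrow> c * \<rho> (real n) \<le> z n" "\<And>n. 1 \<le> n \<Longrightarrow> z n \<le> \<rho> (real n)"
    and \<rho>_pos: "\<And>n. 1 \<le> n \<Longrightarrow> 0 < \<rho> (real n)"
    and exponents: "0 < \<beta>" "\<beta> \<le> \<gamma>" "\<gamma> < 1"
    and n0: "1 \<le> n0"
    and doubling: "\<And>n. n0 \<le> n \<Longrightarrow> \<rho> (real (2 * n)) \<le> 2 powr (- \<beta>) * \<rho> (real n)"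
      "\<And>n. n0 \<le> n \<Longrightarrow> 2 powr (- \<gamma>) * \<rho> (real n) \<le> \<rho> (real (2 * n))"
begin

lemma z_positive: "1 \<le> n \<Longrightarrow> 0 < z n"
  by (rule less_le_trans[OF _ z_\<rho>(1)]) (auto intro!: mult_pos_pos \<rho>_pos c)

lemma doubling_iterated:
  assumes "n0 \<le> l"
  shows "\<rho> (real (2 ^ i * l)) \<le> (2 ^ i) powr (- \<beta>) * \<rho> (real l)"
    and "(2 ^ i) powr (- \<gamma>) * \<rho> (real l) \<le> \<rho> (real (2 ^ i * l))"
proof (induction i)
  case (Suc i)
  have n: "n0 \<le> 2 ^ i * l" by (rule order_trans[OF assms]) simp
  {
    case 1
    have "\<rho> (real (2 * (2 ^ i * l))) \<le> 2 powr (- \<beta>) * \<rho> (real (2 ^ i * l))"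
      by (rule doubling(1)[OF n])
    also have "\<dots> \<le> 2 powr (- \<beta>) * ((2 ^ i) powr (- \<beta>) * \<rho> (real l))"
      using Suc by (intro mult_left_mono) auto
    finally show ?case by (simp add: powr_mult mult_ac)
  next
    case 2
    have "2 powr (- \<gamma>) * ((2 ^ i) powr (- \<gamma>) * \<rho> (real l)) \<le> 2 powr (- \<gamma>) * \<rho> (real (2 ^ i * l))"
      using Suc by (intro mult_left_mono) auto
    also have "\<dots> \<le> \<rho> (real (2 * (2 ^ i * l)))"
      by (rule doubling(2)[OF n])
    finally show ?case by (simp add: powr_mult mult_ac)
  }
qed auto

text \<open>Compare \<open>n\<close> with the dyadic multiples \<open>2^i * l\<close> and
  \<open>2^(i+1) * l\<close> around it. The step to these multiples uses monotonicity of
  \<open>z\<close>, as \<open>\<rho>\<close> need not be monotone. The 2 pays for rounding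
  \<open>n / l\<close>, and \<open>1/c\<close> for switching between \<open>\<rho>\<close> and
  \<open>z\<close>.\<close>

lemma Potter_large:
  assumes l: "n0 \<le> l" "l \<le> n"
  shows "z n * (real n / real l) powr \<beta> \<le> 2 / c * z l"
    and "z l \<le> 2 / c * (real n / real l) powr \<gamma> * z n"
proof -
  have l1: "1 \<le> l" using l n0 by simp
  have "1 \<le> n div l" using l l1 by (simp add: Suc_le_eq div_greater_zero_iff)
  then obtain i where i: "2 ^ i \<le> n div l" "n div l < 2 ^ (i + 1)"
    using ex_power_ivl1[of 2 "n div l"] by auto
  have lo: "2 ^ i * l \<le> n"
    using i(1) l1 by (simp add: less_eq_div_iff_mult_less_eq)
  have hi: "n < 2 ^ (i + 1) * l"
    using i(2) l1 by (simp add: div_less_iff_less_mult)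
  have "real (2 ^ i * l) \<le> real n" "real n \<le> real (2 ^ (i + 1) * l)"
    using lo hi by (simp_all only: of_nat_le_iff less_imp_le)
  then have lo': "2 ^ i \<le> real n / real l" and hi': "real n / real l \<le> 2 * 2 ^ i"
    using l1 by (simp_all add: le_divide_eq divide_le_eq)
  have two: "(2 * 2 ^ i) powr \<delta> \<le> 2 * (2 ^ i) powr \<delta>" if "\<delta> \<le> 1" for \<delta> :: real
    using powr_mono[OF that, of 2] by (simp add: powr_mult mult_right_mono)
  have "z n * (real n / real l) powr \<beta> \<le> ((2 ^ i) powr (- \<beta>) * (z l / c)) * (2 * (2 ^ i) powr \<beta>)"
  proof (rule mult_mono)
    have "z n \<le> z (2 ^ i * l)" by (rule z_antimono[OF lo])
    also have "\<dots> \<le> \<rho> (real (2 ^ i * l))" using l1 by (intro z_\<rho>(2)) simp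
    also have "\<dots> \<le> (2 ^ i) powr (- \<beta>) * \<rho> (real l)" by (rule doubling_iterated(1)[OF l(1)])
    also have "\<dots> \<le> (2 ^ i) powr (- \<beta>) * (z l / c)"
      using z_\<rho>(1)[OF l1] c by (intro mult_left_mono) (auto simp: field_simps)
    finally show "z n \<le> (2 ^ i) powr (- \<beta>) * (z l / c)" .
    have "(real n / real l) powr \<beta> \<le> (2 * 2 ^ i) powr \<beta>"
      using hi' exponents by (intro powr_mono2) auto
    also have "\<dots> \<le> 2 * (2 ^ i) powr \<beta>" using exponents by (intro two) auto
    finally show "(real n / real l) powr \<beta> \<le> 2 * (2 ^ i) powr \<beta>" .
  qed (use z_positive[OF l1] c in auto)
  also have "\<dots> = 2 / c * z l" by (simp add: powr_minus)
  finally show "z n * (real n / real l) powr \<beta> \<le> 2 / c * z l" .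
  have "c * ((2 * 2 ^ i) powr (- \<gamma>) * z l) \<le> c * ((2 * 2 ^ i) powr (- \<gamma>) * \<rho> (real l))"
    using z_\<rho>(2)[OF l1] c by (intro mult_left_mono) auto
  also have "\<dots> \<le> c * \<rho> (real (2 ^ (i + 1) * l))"
    using doubling_iterated(2)[OF l(1), of "i + 1"] c by (intro mult_left_mono) auto
  also have "\<dots> \<le> z (2 ^ (i + 1) * l)" using l1 by (intro z_\<rho>(1)) simp
  also have "\<dots> \<le> z n" using hi by (intro z_antimono) simp
  finally have "z l \<le> z n / c * (2 * 2 ^ i) powr \<gamma>"
    using c by (simp add: powr_minus field_simps)
  also have "\<dots> \<le> z n / c * (2 * (real n / real l) powr \<gamma>)"
  proof (rule mult_left_mono)
    have "(2 * 2 ^ i) powr \<gamma> \<le> 2 * (2 ^ i) powr \<gamma>" using exponents by (intro two) auto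
    also have "(2 ^ i) powr \<gamma> \<le> (real n / real l) powr \<gamma>"
      using lo' exponents by (intro powr_mono2) auto
    finally show "(2 * 2 ^ i) powr \<gamma> \<le> 2 * (real n / real l) powr \<gamma>" by simp
  qed (use z_positive[of n] l l1 c in simp)
  finally show "z l \<le> 2 / c * (real n / real l) powr \<gamma> * z n"
    by (simp add: mult_ac)
qed

text \<open>Below \<open>n0\<close> the doubling bounds say nothing, and tails are only known to lie
  between \<open>z n0\<close> and 1. \<open>\<kappa>\<close> bounds \<open>z n0\<close> from below
  through \<open>c\<close> and \<open>\<rho>\<close>, so the constant is common to all admissible
  sequences. The last conclusion later converts the variation hypothesis from \<open>\<rho>\<close>
  to \<open>z\<close>.\<close>

lemma Potter:
  defines "\<kappa> \<equiv> min 1 (c * \<rho> (real n0))"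
  assumes l: "1 \<le> l" "l \<le> n"
  shows "z n * (real n / real l) powr \<beta> \<le> 2 * real n0 / (c * c * \<kappa>) * z l"
    and "z l \<le> 2 * real n0 / (c * c * \<kappa>) * (real n / real l) powr \<gamma> * z n"
    and "1 \<le> 2 * real n0 / (c * c * \<kappa>) * z 1"
    and "1 / (c * c) \<le> 2 * real n0 / (c * c * \<kappa>)"
proof -
  define K where "K = 2 * real n0 / (c * c * \<kappa>)"
  have \<kappa>: "0 < \<kappa>" "\<kappa> \<le> 1" "\<kappa> \<le> z n0"
    using z_\<rho>(1)[OF n0] \<rho>_pos[OF n0] c by (auto simp: \<kappa>_def)
  have cc: "c * c * \<kappa> > 0" "c * c * \<kappa> \<le> c * \<kappa>" "c * \<kappa> \<le> c" "c * \<kappa> \<le> \<kappa>" "c * c * \<kappa> \<le> c * c"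
    using c \<kappa> by (auto simp: mult_left_le mult_right_le_one_le mult_left_le_one_le)
  have K1: "2 / (c * \<kappa>) \<le> K"
    unfolding K_def using n0 cc c by (intro frac_le) auto
  have K2: "2 * real n0 / c \<le> K"
    unfolding K_def using n0 c \<kappa> order_trans[OF cc(2,3)]
    by (intro divide_left_mono mult_pos_pos) auto
  have K3: "1 / \<kappa> \<le> K"
    unfolding K_def using n0 cc(1) order_trans[OF cc(2,4)] by (intro frac_le) auto
  have K4: "real n0 \<le> K"
  proof -
    have "real n0 \<le> 2 * real n0 / c" using c n0 by (simp add: field_simps)
    then show ?thesis using K2 by linarith
  qed
  show "1 / (c * c) \<le> 2 * real n0 / (c * c * \<kappa>)"
    using n0 cc c by (intro frac_le) auto
  have Kpos: "K > 0" using K4 n0 by linarith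
  have n: "1 \<le> n" using l by simp
  have zn: "0 < z n" and zl: "0 < z l" using z_positive n l by auto
  have one_le: "1 \<le> z m / \<kappa>" if "m \<le> n0" for m
    using order_trans[OF \<kappa>(3) z_antimono[OF that]] \<kappa> by (simp add: le_divide_eq)
  have "1 \<le> 1 / \<kappa> * z 1" using one_le[OF n0] by simp
  also have "\<dots> \<le> K * z 1" using K3 z_positive[of 1] by (intro mult_right_mono) auto
  finally show "1 \<le> 2 * real n0 / (c * c * \<kappa>) * z 1" by (simp add: K_def)
  show "z n * (real n / real l) powr \<beta> \<le> 2 * real n0 / (c * c * \<kappa>) * z l"
    unfolding K_def[symmetric]
  proof (cases "n0 \<le> n")
    case True
    \<comment> \<open>Lifting \<open>l\<close> to the threshold changes the power of the ratio by at
      most \<open>n0\<close>, since \<open>l' / l <= n0\<close> and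
      \<open>\<beta> < 1\<close>.\<close>
    define l' where "l' = max l n0"
    have l': "n0 \<le> l'" "l' \<le> n" "l \<le> l'" "1 \<le> l'" using True l by (auto simp: l'_def)
    have "(real n / real l) powr \<beta> = (real n / real l') powr \<beta> * (real l' / real l) powr \<beta>"
      using l l' by (simp flip: powr_mult)
    also have "(real l' / real l) powr \<beta> \<le> real n0"
    proof -
      have "(real l' / real l) powr \<beta> \<le> (real l' / real l) powr 1"
        using l l' exponents by (intro powr_mono) auto
      also have "\<dots> = real l' / real l" by simp
      also have "\<dots> \<le> real n0"
        using l n0 by (auto simp: l'_def max_def divide_le_eq mult_left_le)
      finally show ?thesis .
    qed
    finally have "z n * (real n / real l) powr \<beta> \<le> z n * ((real n / real l') powr \<beta> * real n0)"
      using zn by (simp add: mult_left_mono)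
    also have "\<dots> = z n * (real n / real l') powr \<beta> * real n0" by simp
    also have "\<dots> \<le> 2 / c * z l' * real n0"
      using Potter_large(1)[OF l'(1,2)] by (intro mult_right_mono) auto
    also have "\<dots> = 2 * real n0 / c * z l'" by simp
    also have "\<dots> \<le> K * z l"
      using K2 z_antimono[OF l'(3)] z_positive[OF l'(4)] Kpos by (intro mult_mono) auto
    finally show "z n * (real n / real l) powr \<beta> \<le> K * z l" .
  next
    case False
    have "(real n / real l) powr \<beta> \<le> (real n / real l) powr 1"
      using l exponents by (intro powr_mono) auto
    also have "\<dots> = real n / real l" by simp
    also have "\<dots> \<le> real n" using l by (simp add: divide_le_eq mult_left_le)
    also have "\<dots> \<le> K" using K4 False by linarith
    finally have "z n * (real n / real l) powr \<beta> \<le> z l * K"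
      using z_antimono[OF l(2)] zl by (intro mult_mono) auto
    then show "z n * (real n / real l) powr \<beta> \<le> K * z l" by (simp add: mult.commute)
  qed
  show "z l \<le> 2 * real n0 / (c * c * \<kappa>) * (real n / real l) powr \<gamma> * z n"
    unfolding K_def[symmetric]
  proof (cases "n0 \<le> n")
    case True
    define l' where "l' = max l n0"
    have l': "n0 \<le> l'" "l' \<le> n" "l \<le> l'" "1 \<le> l'" using True l by (auto simp: l'_def)
    \<comment> \<open>Here the lift is paid for by the tail: if \<open>l <= n0\<close>, then
      \<open>z l <= 1 <= z n0 / \<kappa>\<close>.\<close>
    have "z l \<le> z l' / \<kappa>"
    proof (cases "l \<le> n0")
      case True
      then show ?thesis using one_le[of n0] z_le_1[of l] by (simp add: l'_def)
    next
      case False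
      then show ?thesis using \<kappa> zl by (simp add: l'_def le_divide_eq mult_left_le)
    qed
    also have "\<dots> \<le> (2 / c * (real n / real l') powr \<gamma> * z n) / \<kappa>"
      using Potter_large(2)[OF l'(1,2)] \<kappa> by (intro divide_right_mono) auto
    also have "\<dots> \<le> (2 / c * (real n / real l) powr \<gamma> * z n) / \<kappa>"
      using \<kappa> c zn l l' exponents
      by (intro divide_right_mono mult_right_mono mult_left_mono powr_mono2 divide_left_mono) auto
    also have "\<dots> = 2 / (c * \<kappa>) * ((real n / real l) powr \<gamma> * z n)" by simp
    also have "\<dots> \<le> K * ((real n / real l) powr \<gamma> * z n)"
      using K1 zn by (intro mult_right_mono) auto
    finally show "z l \<le> K * (real n / real l) powr \<gamma> * z n" by simp
  next
    case False
    have "z l \<le> 1" by (rule z_le_1)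
    also have "1 \<le> 1 / \<kappa> * 1 * z n" using one_le[of n] False by simp
    also have "\<dots> \<le> K * (real n / real l) powr \<gamma> * z n"
      using K3 zn Kpos l exponents by (intro mult_right_mono mult_mono ge_one_powr_ge_zero) auto
    finally show "z l \<le> K * (real n / real l) powr \<gamma> * z n" .
  qed
qed

end

theorem theorem2p10:
  fixes \<alpha> c c0 :: real and \<rho> :: "real \<Rightarrow> real" and N :: nat
  assumes "0 < \<alpha>" "\<alpha> < 1"
    and "regularly_varying 1 (- \<alpha>) \<rho>"
    and "0 < c" "c \<le> 1"
    and "c0 > 0"
    and "N \<ge> 1"
  shows "\<exists>C :: real. \<forall>(p :: nat \<Rightarrow> real) (q :: nat \<Rightarrow> real).
    prob_seq p \<longrightarrow>
    Gcd {k. 1 \<le> k \<and> k \<le> N \<and> p k \<ge> c0} = 1 \<longrightarrow>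
    (\<forall>n\<ge>1. c * \<rho> (real n) \<le> tail p n \<and> tail p n \<le> \<rho> (real n)) \<longrightarrow>
    return_probs p q \<longrightarrow>
    (\<alpha> > 1/2 \<longrightarrow>
      (\<forall>n l. n \<ge> l \<longrightarrow> l \<ge> 1 \<longrightarrow>
        tv_dist ((transition_op q ^^ (n + l)) (return_pmf 0)) ((transition_op q ^^ n) (return_pmf 0))
          \<le> C * ((real n * (\<rho> (real n))\<^sup>2) / (real l * (\<rho> (real l))\<^sup>2)))) \<and>
    ((\<forall>n\<ge>1. (\<Sum>\<^sub>\<infinity>k\<in>{n<..}. \<bar>p k - p (k + 1)\<bar>) \<le> inverse c * inverse (real n) * \<rho> (real n)) \<longrightarrow>
      (\<forall>n l. n \<ge> l \<longrightarrow> l \<ge> 1 \<longrightarrow>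
        tv_dist ((transition_op q ^^ (n + l)) (return_pmf 0)) ((transition_op q ^^ n) (return_pmf 0))
          \<le> C * (\<rho> (real n) / \<rho> (real l))))"
proof -
  have \<rho>_pos: "0 < \<rho> (real n)" if "1 \<le> n" for n
    using assms(3) that by (auto simp: regularly_varying_def)
  \<comment> \<open>For \<open>\<alpha> > 1/2\<close> this is the midpoint of 1/2 and
    \<open>\<alpha>\<close>, so that \<open>2 \<beta> > 1\<close>; \<open>\<gamma>\<close> is the
    midpoint of \<open>\<alpha>\<close> and 1.\<close>
  define \<beta> where "\<beta> = (if \<alpha> > 1/2 then (2 * \<alpha> + 1) / 4 else \<alpha> / 2)"
  define \<gamma> where "\<gamma> = (1 + \<alpha>) / 2"
  have \<beta>: "0 < \<beta>" "\<beta> < \<alpha>" "\<alpha> > 1/2 \<Longrightarrow> \<beta> > 1/2"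
    using assms(1,2) by (auto simp: \<beta>_def)
  have \<gamma>: "\<alpha> < \<gamma>" "1/2 < \<gamma>" "\<gamma> < 1"
    using assms(1,2) by (auto simp: \<gamma>_def)
  obtain n0 :: nat where n0: "1 \<le> n0"
    "\<And>n. n0 \<le> n \<Longrightarrow> \<rho> (real (2 * n)) \<le> 2 powr (- \<beta>) * \<rho> (real n)"
    "\<And>n. n0 \<le> n \<Longrightarrow> 2 powr (- \<gamma>) * \<rho> (real n) \<le> \<rho> (real (2 * n))"
    using regularly_varying_doubling[OF assms(3) \<beta>(2) \<gamma>(1)] by blast
  define K where "K = 2 * real n0 / (c * c * min 1 (c * \<rho> (real n0)))"
  \<comment> \<open>All sequences admissible for the given data. Constants obtained for the class
    \<open>S\<close>, and for its smooth part \<open>S'\<close>, depend only on these data, and this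
    is the required uniformity.\<close>
  define S where "S = {p. renewal p \<and> Gcd {k. 1 \<le> k \<and> k \<le> N \<and> c0 \<le> p k} = 1 \<and>
    (\<forall>n\<ge>1. c * \<rho> (real n) \<le> renewal.z p n \<and> renewal.z p n \<le> \<rho> (real n))}"
  define S' where "S' = {p \<in> S. \<forall>n\<ge>1. \<forall>M.
    (\<Sum>k\<in>{n<..M}. \<bar>p k - p (Suc k)\<bar>) \<le> inverse c * inverse (real n) * \<rho> (real n)}"
  have Potter_S: "renewal.z p n * (real n / real l) powr \<beta> \<le> K * renewal.z p l"
    "renewal.z p l \<le> K * (real n / real l) powr \<gamma> * renewal.z p n"
    "1 \<le> K * renewal.z p 1" "1 / (c * c) \<le> K"
    if p: "p \<in> S" and l: "1 \<le> l" "l \<le> n" for p l n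
  proof -
    interpret renewal p using p by (simp add: S_def)
    have z: "c * \<rho> (real n) \<le> z n" "z n \<le> \<rho> (real n)" if "1 \<le> n" for n
      using p that by (auto simp: S_def)
    note P = Potter[of z c \<rho> \<beta> \<gamma> n0 l n, OF z_antimono z_le_1 assms(4,5) z \<rho>_pos \<beta>(1)
      less_imp_le[OF less_trans[OF \<beta>(2) \<gamma>(1)]] \<gamma>(3) n0 l, folded K_def]
    show "z n * (real n / real l) powr \<beta> \<le> K * z l"
      "z l \<le> K * (real n / real l) powr \<gamma> * z n" "1 \<le> K * z 1" "1 / (c * c) \<le> K"
      by (rule P; assumption)+
  qed
  have K: "1 \<le> K"
  proof -
    define \<kappa> where "\<kappa> = min 1 (c * \<rho> (real n0))"
    have \<kappa>: "0 < \<kappa>" "\<kappa> \<le> 1" using assms(4) \<rho>_pos[OF n0(1)] by (auto simp: \<kappa>_def)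
    have "c * c * \<kappa> \<le> 1"
      using assms(4,5) \<kappa> by (intro mult_le_one) auto
    moreover have "0 < c * c * \<kappa>" using assms(4) \<kappa> by simp
    moreover have "1 \<le> 2 * real n0" using n0(1) by simp
    ultimately show ?thesis
      unfolding K_def \<kappa>_def[symmetric] by (simp only: le_divide_eq_1_pos)
  qed
  have renewal_class_subset: "renewal_class T \<beta> \<gamma> K c0 N" if T: "T \<subseteq> S" for T
  proof (rule renewal_class.intro)
    show "0 < \<beta>" "\<beta> \<le> \<gamma>" "1 / 2 < \<gamma>" "\<gamma> < 1" "1 \<le> K" "0 < c0"
      using \<beta> \<gamma> K assms by auto
    fix p assume "p \<in> T"
    with T have p: "p \<in> S" by auto
    then show "renewal p" "Gcd {k. 1 \<le> k \<and> k \<le> N \<and> c0 \<le> p k} = 1"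
      by (simp_all add: S_def)
    show "1 \<le> K * renewal.z p 1"
      by (rule Potter_S(3)[OF p, of 1 1]) auto
    fix l n :: nat assume "1 \<le> l" "l \<le> n"
    then show "renewal.z p n * (real n / real l) powr \<beta> \<le> K * renewal.z p l"
      "renewal.z p l \<le> K * (real n / real l) powr \<gamma> * renewal.z p n"
      using Potter_S[OF p] by auto
  qed
  \<comment> \<open>The implication sits inside the existential so that \<open>C1\<close> is
    available for the definition of \<open>C\<close> also when
    \<open>\<alpha> <= 1/2\<close>.\<close>
  have "\<exists>C1>0. \<alpha> > 1/2 \<longrightarrow> (\<forall>p\<in>S. \<forall>l n. 1 \<le> l \<longrightarrow> l \<le> n \<longrightarrow> renewal.l1_diff p n l \<le>
      C1 * ((real n * (renewal.z p n)\<^sup>2) / (real l * (renewal.z p l)\<^sup>2)))"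
  proof (cases "\<alpha> > 1/2")
    case True
    interpret renewal_class_large S \<beta> \<gamma> K c0 N
      using \<beta>(3)[OF True]
      by (intro renewal_class_large.intro renewal_class_subset renewal_class_large_axioms.intro order_refl)
    show ?thesis using l1_diff_bound by metis
  qed (auto intro: exI[of _ 1])
  then obtain C1 where C1: "C1 > 0" "\<And>p l n. \<alpha> > 1/2 \<Longrightarrow> p \<in> S \<Longrightarrow> 1 \<le> l \<Longrightarrow> l \<le> n \<Longrightarrow>
      renewal.l1_diff p n l \<le> C1 * ((real n * (renewal.z p n)\<^sup>2) / (real l * (renewal.z p l)\<^sup>2))"
    by blast
  have "renewal_class_smooth S' \<beta> \<gamma> K c0 N"
  proof (intro renewal_class_smooth.intro renewal_class_subset renewal_class_smooth_axioms.intro)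
    show "S' \<subseteq> S" by (auto simp: S'_def)
    fix p and n M :: nat assume p: "p \<in> S'" and n: "1 \<le> n"
    then have pS: "p \<in> S" by (simp add: S'_def)
    have \<rho>z: "c * \<rho> (real n) \<le> renewal.z p n" "0 < renewal.z p n"
      using pS n less_le_trans[OF mult_pos_pos[OF assms(4) \<rho>_pos[OF n]]] by (auto simp: S_def)
    have "(\<Sum>k\<in>{n<..M}. \<bar>p k - p (Suc k)\<bar>) \<le> inverse c * inverse (real n) * \<rho> (real n)"
      using p n by (auto simp: S'_def)
    also have "\<dots> \<le> inverse c * inverse (real n) * (renewal.z p n / c)"
      using \<rho>z assms(4) by (intro mult_left_mono) (auto simp: field_simps)
    also have "\<dots> = 1 / (c * c) * (renewal.z p n / real n)"
      by (simp add: divide_inverse mult_ac)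
    also have "\<dots> \<le> K * (renewal.z p n / real n)"
      using \<rho>z Potter_S(4)[OF pS, of 1 1] by (intro mult_right_mono) auto
    finally show "(\<Sum>k\<in>{n<..M}. \<bar>p k - p (Suc k)\<bar>) \<le> K * (renewal.z p n / real n)" .
  qed
  then obtain C2 where C2: "C2 > 0" "\<And>p l n. p \<in> S' \<Longrightarrow> 1 \<le> l \<Longrightarrow> l \<le> n \<Longrightarrow>
      renewal.l1_diff p n l \<le> C2 * (renewal.z p n / renewal.z p l)"
    using renewal_class_smooth.l1_diff_bound by blast
  \<comment> \<open>The 2 comes from \<open>tv_dist_le_l1_diff\<close>. Replacing \<open>z l\<close>
    by \<open>c * \<rho>\<close> in the denominator costs \<open>1/c\<close>, squared in the first
    case; \<open>z n\<close> is simply bounded by \<open>\<rho>\<close>.\<close>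
  define C where "C = 2 * C1 / (c * c) + 2 * C2 / c"
  have CC: "2 * C1 / (c * c) \<le> C" "2 * C2 / c \<le> C"
    using C1(1) C2(1) assms(4) by (auto simp: C_def)
  show ?thesis
  proof (intro exI[of _ C] allI impI conjI)
    fix p q :: "nat \<Rightarrow> real" and n l :: nat
    assume p: "prob_seq p" and gcd: "Gcd {k. 1 \<le> k \<and> k \<le> N \<and> p k \<ge> c0} = 1"
      and tails: "\<forall>n\<ge>1. c * \<rho> (real n) \<le> tail p n \<and> tail p n \<le> \<rho> (real n)"
      and q: "return_probs p q" and l: "l \<le> n" "1 \<le> l"
    define p' where "p' = p(0 := 0)"
    interpret renewal p'
      unfolding p'_def by (rule prob_seq_renewal(1)[OF p])
    have z: "z k = tail p k" for k
      unfolding p'_def by (rule prob_seq_renewal(2)[OF p])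
    have "{k. 1 \<le> k \<and> k \<le> N \<and> c0 \<le> p' k} = {k. 1 \<le> k \<and> k \<le> N \<and> c0 \<le> p k}"
      by (auto simp: p'_def)
    then have S: "p' \<in> S"
      using gcd tails renewal_axioms by (auto simp: S_def z)
    have z_pos: "z k > 0" for k
      by (rule renewal_class.tail_pos[OF renewal_class_subset[OF order_refl] S])
    have p'_Suc: "p' (Suc k) = p (Suc k)" for k
      by (simp add: p'_def)
    have q': "q k = p' (Suc k) / z k" for k
      using q z_pos[of k] by (auto simp: return_probs_def z p'_Suc)
    have tv: "tv_dist ((transition_op q ^^ (n + l)) (return_pmf 0)) ((transition_op q ^^ n) (return_pmf 0)) \<le> 2 * l1_diff n l"
      by (rule tv_dist_le_l1_diff[OF z_pos q'])
    have n: "1 \<le> n" using l by simp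
    have zn: "z n \<le> \<rho> (real n)" and zl: "c * \<rho> (real l) \<le> z l"
      using tails l n by (auto simp: z)
    note pos = z_pos[of n] z_pos[of l] \<rho>_pos[OF n] \<rho>_pos[OF l(2)]
    {
      assume "\<alpha> > 1/2"
      have "l1_diff n l \<le> C1 * ((real n * (z n)\<^sup>2) / (real l * (z l)\<^sup>2))"
        by (rule C1(2)[OF \<open>\<alpha> > 1/2\<close> S l(2,1)])
      also have "\<dots> \<le> C1 * ((real n * (\<rho> (real n))\<^sup>2) / (real l * (c * \<rho> (real l))\<^sup>2))"
        using zn zl pos l C1(1) assms(4)
        by (intro mult_left_mono frac_le mult_mono power_mono mult_pos_pos) auto
      also have "\<dots> = C1 / (c * c) * ((real n * (\<rho> (real n))\<^sup>2) / (real l * (\<rho> (real l))\<^sup>2))"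
        by (simp add: power_mult_distrib power2_eq_square)
      finally have "2 * l1_diff n l \<le> 2 * C1 / (c * c) * ((real n * (\<rho> (real n))\<^sup>2) / (real l * (\<rho> (real l))\<^sup>2))"
        by simp
      also have "\<dots> \<le> C * ((real n * (\<rho> (real n))\<^sup>2) / (real l * (\<rho> (real l))\<^sup>2))"
        by (intro mult_right_mono CC) auto
      finally show "tv_dist ((transition_op q ^^ (n + l)) (return_pmf 0)) ((transition_op q ^^ n) (return_pmf 0))
          \<le> C * ((real n * (\<rho> (real n))\<^sup>2) / (real l * (\<rho> (real l))\<^sup>2))"
        using tv by linarith
    }
    {
      assume sm: "\<forall>n\<ge>1. (\<Sum>\<^sub>\<infinity>k\<in>{n<..}. \<bar>p k - p (k + 1)\<bar>) \<le> inverse c * inverse (real n) * \<rho> (real n)"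
      have "p' \<in> S'"
        unfolding S'_def
      proof (intro CollectI conjI S allI impI)
        fix n M :: nat assume n: "1 \<le> n"
        have "(\<Sum>k\<in>{n<..M}. \<bar>p' k - p' (Suc k)\<bar>) = (\<Sum>k\<in>{n<..M}. \<bar>p k - p (Suc k)\<bar>)"
          by (rule sum.cong) (auto simp: p'_def)
        also have "\<dots> \<le> (\<Sum>\<^sub>\<infinity>k\<in>{n<..}. \<bar>p k - p (k + 1)\<bar>)"
          by (rule partial_variation_le_infsum[OF p n])
        also have "\<dots> \<le> inverse c * inverse (real n) * \<rho> (real n)"
          using sm n by blast
        finally show "(\<Sum>k\<in>{n<..M}. \<bar>p' k - p' (Suc k)\<bar>) \<le> inverse c * inverse (real n) * \<rho> (real n)" .
      qed
      from C2(2)[OF this l(2,1)] have "l1_diff n l \<le> C2 * (z n / z l)" .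
      also have "\<dots> \<le> C2 * (\<rho> (real n) / (c * \<rho> (real l)))"
        using zn zl pos C2(1) assms(4) by (intro mult_left_mono frac_le) auto
      also have "\<dots> = C2 / c * (\<rho> (real n) / \<rho> (real l))" by simp
      finally have "2 * l1_diff n l \<le> 2 * C2 / c * (\<rho> (real n) / \<rho> (real l))" by simp
      also have "\<dots> \<le> C * (\<rho> (real n) / \<rho> (real l))"
        using pos by (intro mult_right_mono CC) auto
      finally show "tv_dist ((transition_op q ^^ (n + l)) (return_pmf 0)) ((transition_op q ^^ n) (return_pmf 0))
          \<le> C * (\<rho> (real n) / \<rho> (real l))"
        using tv by linarith
    }
  qed
qed

end
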